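(* In the Wyner-Ziv problem with a helper described in the context, where $Y-Z-X$ is a Markov chain, the operational achievable region equals the single-letter region: $\mathcal R^O_{Y-Z-X}(D)=\mathcal R_{Y-Z-X}(D)$.
   Context: Let $\mathcal X,\mathcal Y,\mathcal Z,\hat{\mathcal X}$ be finite alphabets, $d:\mathcal X\times\hat{\mathcal X}\to[0,\infty)$ a distortion measure, and $(X_i,Y_i,Z_i)$ i.i.d. with distribution $p(x,y,z)=p(z,y)p(x|z)$ (Markov chain $Y-Z-X$). A helper observing $Y^n$ sends a message $T_1=f_1(Y^n)\in\{1,\dots,2^{nR_1}\}$ to both the encoder and the decoder; the encoder observing $X^n$ sends $T=f(X^n,T_1)\in\{1,\dots,2^{nR}\}$ to the decoder; the decoder observes side information $Z^n$ and outputs $\hat X^n=g(T,T_1,Z^n)\in\hat{\mathcal X}^n$. A pair $(R,R_1)$ is achievable at distortion $D$ if for every $\epsilon>0$ and all sufficiently large $n$ there exist such $f_1,f,g$ with $\mathbb E\big[\frac1n\sum_{i=1}^n d(X_i,\hat X_i)\big]\le D+\epsilon$; $\mathcal R^O_{Y-Z-X}(D)$ is the closure of the set of achievable pairs. $\mathcal R_{Y-Z-X}(D)$ is the set of all pairs $(R,R_1)$ with $R_1\ge I(U;Y|X)$ and $R\ge I(X;V|U,Z)$ for some finite-alphabet auxiliary random variables $U,V$ with joint distribution $p(x,y,z,u,v)=p(z,y)p(x|z)p(u|y)p(v|x,u)$ and a deterministic function $\hat X(U,V,Z)$ with $\mathbb E\, d(X,\hat X(U,V,Z))\le D$. *)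

theory Defs
  imports "HOL-Analysis.Analysis" "HOL-Library.FuncSet"
begin

abbreviation Seq :: "nat \<Rightarrow> (nat \<Rightarrow> 'a::finite) set" where
  "Seq n \<equiv> PiE {..<n} (\<lambda>_. UNIV)"

definition msgs :: "nat \<Rightarrow> real \<Rightarrow> nat set" where
  "msgs n R = {1 .. nat \<lfloor>2 powr (real n * R)\<rfloor>}"

definition cond_mi :: "'w set \<Rightarrow> ('w \<Rightarrow> real) \<Rightarrow> ('w \<Rightarrow> 'a) \<Rightarrow> ('w \<Rightarrow> 'b) \<Rightarrow> ('w \<Rightarrow> 'c) \<Rightarrow> real" where
  "cond_mi S P A B C =
     (\<Sum>w\<in>S. P w * log 2
        ((\<Sum>w'\<in>{w'\<in>S. A w' = A w \<and> B w' = B w \<and> C w' = C w}. P w') *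
         (\<Sum>w'\<in>{w'\<in>S. C w' = C w}. P w') /
         ((\<Sum>w'\<in>{w'\<in>S. A w' = A w \<and> C w' = C w}. P w') *
          (\<Sum>w'\<in>{w'\<in>S. B w' = B w \<and> C w' = C w}. P w'))))"

definition achievable ::
  "('z::finite \<Rightarrow> 'y::finite \<Rightarrow> real) \<Rightarrow> ('z \<Rightarrow> 'x::finite \<Rightarrow> real) \<Rightarrow> ('x \<Rightarrow> 'xh::finite \<Rightarrow> real)
   \<Rightarrow> real \<Rightarrow> real \<Rightarrow> real \<Rightarrow> bool" where
  "achievable pZY pXgZ d D R R1 \<longleftrightarrow>
    (\<forall>\<epsilon>>0. \<exists>N. \<forall>n\<ge>N. \<exists>(f1 :: (nat \<Rightarrow> 'y) \<Rightarrow> nat) (f :: (nat \<Rightarrow> 'x) \<Rightarrow> nat \<Rightarrow> nat)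
                              (g :: nat \<Rightarrow> nat \<Rightarrow> (nat \<Rightarrow> 'z) \<Rightarrow> nat \<Rightarrow> 'xh).
       (\<forall>ys\<in>Seq n. f1 ys \<in> msgs n R1) \<and>
       (\<forall>xs\<in>Seq n. \<forall>t1\<in>msgs n R1. f xs t1 \<in> msgs n R) \<and>
       (\<Sum>xs\<in>Seq n. \<Sum>ys\<in>Seq n. \<Sum>zs\<in>Seq n.
          (\<Prod>i<n. pZY (zs i) (ys i) * pXgZ (zs i) (xs i)) *
          ((1 / real n) * (\<Sum>i<n. d (xs i) (g (f xs (f1 ys)) (f1 ys) zs i))))
         \<le> D + \<epsilon>)"

definition op_region ::
  "('z::finite \<Rightarrow> 'y::finite \<Rightarrow> real) \<Rightarrow> ('z \<Rightarrow> 'x::finite \<Rightarrow> real) \<Rightarrow> ('x \<Rightarrow> 'xh::finite \<Rightarrow> real)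
   \<Rightarrow> real \<Rightarrow> (real \<times> real) set" where
  "op_region pZY pXgZ d D = closure {(R, R1). achievable pZY pXgZ d D R R1}"

text \<open>Single-letter region. Finite auxiliary alphabets are modelled as finite subsets SU, SV of nat;
  the joint pmf is p(z,y) p(x|z) p(u|y) p(v|x,u) on the sample space of tuples (x,y,z,u,v).\<close>
definition joint5 ::
  "('z \<Rightarrow> 'y \<Rightarrow> real) \<Rightarrow> ('z \<Rightarrow> 'x \<Rightarrow> real) \<Rightarrow> ('y \<Rightarrow> nat \<Rightarrow> real) \<Rightarrow> ('x \<Rightarrow> nat \<Rightarrow> nat \<Rightarrow> real)
   \<Rightarrow> 'x \<times> 'y \<times> 'z \<times> nat \<times> nat \<Rightarrow> real" where
  "joint5 pZY pXgZ qU qV = (\<lambda>(x, y, z, u, v). pZY z y * pXgZ z x * qU y u * qV x u v)"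

definition sl_region ::
  "('z::finite \<Rightarrow> 'y::finite \<Rightarrow> real) \<Rightarrow> ('z \<Rightarrow> 'x::finite \<Rightarrow> real) \<Rightarrow> ('x \<Rightarrow> 'xh::finite \<Rightarrow> real)
   \<Rightarrow> real \<Rightarrow> (real \<times> real) set" where
  "sl_region pZY pXgZ d D =
    {(R, R1). \<exists>(SU :: nat set) (SV :: nat set) (qU :: 'y \<Rightarrow> nat \<Rightarrow> real) (qV :: 'x \<Rightarrow> nat \<Rightarrow> nat \<Rightarrow> real)
                 (xhat :: nat \<Rightarrow> nat \<Rightarrow> 'z \<Rightarrow> 'xh).
       finite SU \<and> finite SV \<and>
       (\<forall>y u. qU y u \<ge> 0) \<and> (\<forall>y. (\<Sum>u\<in>SU. qU y u) = 1) \<and>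
       (\<forall>x u v. qV x u v \<ge> 0) \<and> (\<forall>x u. (\<Sum>v\<in>SV. qV x u v) = 1) \<and>
       (let S = (UNIV :: 'x set) \<times> (UNIV :: 'y set) \<times> (UNIV :: 'z set) \<times> SU \<times> SV;
            P = joint5 pZY pXgZ qU qV in
         R1 \<ge> cond_mi S P (\<lambda>(x,y,z,u,v). u) (\<lambda>(x,y,z,u,v). y) (\<lambda>(x,y,z,u,v). x) \<and>
         R \<ge> cond_mi S P (\<lambda>(x,y,z,u,v). x) (\<lambda>(x,y,z,u,v). v) (\<lambda>(x,y,z,u,v). (u, z)) \<and>
         (\<Sum>w\<in>S. P w * (case w of (x,y,z,u,v) \<Rightarrow> d x (xhat u v z))) \<le> D)}"

end

theory Submission
  imports Defs "HOL-Real_Asymp.Real_Asymp"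
begin

text \<open>
  Achievability uses random binning in one shot. Every value of \<open>U\<close> (and then of \<open>V\<close>) receives a random
  pair consisting of a message and a bin index. If there are slightly fewer than \<open>2\<close> to the \<open>n H(U | Y)\<close>
  bins, then the bin index is almost independent of the observation, so it can be fixed in advance and
  the sender only has to pick a value inside that bin. If messages and bins together exceed
  \<open>2\<close> to the \<open>n H(U | X)\<close>, then \<open>U\<close> is recovered from \<open>X\<close>, and also from \<open>Z\<close> because \<open>H(U | Z) \<le> H(U | X)\<close>.
  The required helper rate is \<open>H(U | X) - H(U | Y) = I(U; Y | X)\<close>; likewise the encoder needs
  \<open>H(V | U, Z) - H(V | X, U) = I(X; V | U, Z)\<close>.

  For the converse take \<open>U\<^sub>i = (T\<^sub>1, X\<^sub>1, \<dots>, X\<^sub>i\<^sub>-\<^sub>1, Z\<^sub>i\<^sub>+\<^sub>1, \<dots>, Z\<^sub>n)\<close> and let \<open>V\<^sub>i\<close> be the optimal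
  reconstruction, as a function of \<open>Z\<^sub>i\<close>, given \<open>(T, U\<^sub>i)\<close>; both rate bounds follow from the chain rule.
  With \<open>V\<close> ranging over functions from \<open>Z\<close> to reconstructions, the attainable triples of conditional entropy,
  mutual information and distortion, together with the law of \<open>Y\<close>, form the convex hull of a compact set.
  Hence the single-letter region is closed, without a separate bound on the alphabet of \<open>U\<close>.
\<close>

section \<open>Entropy on finite spaces\<close>

text \<open>The helper sees neither X nor Z, yet U has to be recovered from each of them separately.
  The picked value of U is a deterministic function of the observation, so its exact joint law with
  X and Z is hard to control. Binning avoids that analysis: averaged over a uniform bin index,
  picking the cheapest value in the bin is no worse than drawing from the test channel, up to the
  bias of the bins. Hence every error is computed under the product law, and some fixed index does
  no worse than the average. In the converse the decoder uses all of Z, but a single-letter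
  reconstruction may use only U, V and one letter of Z. Making V a function of that letter keeps its
  alphabet independent of the block length. The alphabet of U does grow, but U only indexes a
  mixture: one value of U contributes a law on Y and a channel from X to V, a point of a fixed
  compact set. The law of Y is recorded because the mixture has to reproduce that of the source, and
  H(Y, Z | X, U) replaces H(Y | X, U) because \<open>U\<^sub>i\<close> contains later letters of
  Z.\<close>

definition mass :: "'w set \<Rightarrow> ('w \<Rightarrow> real) \<Rightarrow> ('w \<Rightarrow> 'a) \<Rightarrow> 'a \<Rightarrow> real" where
  "mass S P A a = (\<Sum>w\<in>{w\<in>S. A w = a}. P w)"

text \<open>Meant for unnormalised weights as well: later \<open>P\<close> is often the restriction
  of a law to one value of U, and then only differences of such entropies have a meaning.\<close>

definition ent :: "'w set \<Rightarrow> ('w \<Rightarrow> real) \<Rightarrow> ('w \<Rightarrow> 'a) \<Rightarrow> real" where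
  "ent S P A = - (\<Sum>w\<in>S. P w * log 2 (mass S P A (A w)))"

lemma sum_Times: "(\<Sum>c\<in>A \<times> B. F c) = (\<Sum>a\<in>A. \<Sum>b\<in>B. F (a, b))"
  by (simp add: sum.cartesian_product)

definition eta :: "real \<Rightarrow> real" where
  "eta t = - t * log 2 t"

lemma eta_0 [simp]: "eta 0 = 0"
  by (simp add: eta_def)

text \<open>Continuity at 0 matters because the compact set of laws used in the converse contains
  laws with vanishing masses.\<close>

lemma continuous_on_eta: "continuous_on {0..} eta"
proof -
  have "isCont eta t" if "t > 0" for t
    unfolding eta_def log_def using that by (auto intro!: continuous_intros)
  moreover have "(eta \<longlongrightarrow> eta 0) (at 0 within {0..})"
  proof -
    have "((\<lambda>t::real. - t * log 2 t) \<longlongrightarrow> 0) (at_right 0)"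
      by real_asymp
    moreover have "at 0 within {0..} = at_right (0::real)"
      by (rule at_within_Ici_at_right)
    ultimately show ?thesis
      unfolding eta_def by simp
  qed
  ultimately have "(eta \<longlongrightarrow> eta t) (at t within {0..})" if "t \<ge> 0" for t
    using that by (cases "t = 0") (auto simp: isCont_def intro: tendsto_mono[OF at_le[OF subset_UNIV]])
  then show ?thesis
    unfolding continuous_on_def by simp
qed

lemma mass_nonneg: "(\<And>w. w \<in> S \<Longrightarrow> P w \<ge> 0) \<Longrightarrow> mass S P A a \<ge> 0"
  unfolding mass_def by (rule sum_nonneg) auto

lemma mass_ge: "finite S \<Longrightarrow> (\<And>w. w \<in> S \<Longrightarrow> P w \<ge> 0) \<Longrightarrow> w \<in> S \<Longrightarrow> P w \<le> mass S P A (A w)"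
  unfolding mass_def by (rule member_le_sum) auto

lemma mass_pos: "finite S \<Longrightarrow> (\<And>w. w \<in> S \<Longrightarrow> P w \<ge> 0) \<Longrightarrow> w \<in> S \<Longrightarrow> P w > 0 \<Longrightarrow> mass S P A (A w) > 0"
  by (meson mass_ge order_less_le_trans)

lemma sum_mass:
  assumes "finite S" "finite T" "A ` S \<subseteq> T"
  shows "(\<Sum>a\<in>T. mass S P A a * F a) = (\<Sum>w\<in>S. P w * F (A w))"
proof -
  have "(\<Sum>w\<in>S. P w * F (A w)) = (\<Sum>a\<in>T. \<Sum>w\<in>{w\<in>S. A w = a}. P w * F (A w))"
    by (rule sum.group[symmetric]) (use assms in auto)
  also have "\<dots> = (\<Sum>a\<in>T. mass S P A a * F a)"
    unfolding mass_def sum_distrib_right by (intro sum.cong) auto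
  finally show ?thesis by simp
qed

lemma sum_mass_pair:
  assumes "finite S" "finite T" "A ` S \<subseteq> T"
  shows "(\<Sum>a\<in>T. mass S P (\<lambda>w. (A w, C w)) (a, c)) = mass S P C c"
proof -
  have "mass S P C c = (\<Sum>a\<in>T. \<Sum>w\<in>{w \<in> {w\<in>S. C w = c}. A w = a}. P w)"
    unfolding mass_def by (rule sum.group[symmetric]) (use assms in auto)
  also have "\<dots> = (\<Sum>a\<in>T. mass S P (\<lambda>w. (A w, C w)) (a, c))"
    unfolding mass_def by (intro sum.cong) auto
  finally show ?thesis by simp
qed

lemma mass_comp:
  assumes "finite S" "finite T" "Q ` S \<subseteq> T"
  shows "mass S P (\<lambda>w. A (Q w)) a = mass T (mass S P Q) A a"
proof -
  have "mass T (mass S P Q) A a = (\<Sum>q\<in>T. mass S P Q q * of_bool (A q = a))"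
    unfolding mass_def[of T] using assms by (auto intro!: sum.mono_neutral_cong_left)
  also have "\<dots> = (\<Sum>w\<in>S. P w * of_bool (A (Q w) = a))"
    by (rule sum_mass) (use assms in auto)
  also have "\<dots> = mass S P (\<lambda>w. A (Q w)) a"
    unfolding mass_def[of S] using assms by (auto intro!: sum.mono_neutral_cong_right)
  finally show ?thesis by simp
qed

lemma ent_eq_sum_eta:
  assumes "finite S" "finite T" "A ` S \<subseteq> T"
  shows "ent S P A = (\<Sum>a\<in>T. eta (mass S P A a))"
  using sum_mass[OF assms, of P "\<lambda>a. log 2 (mass S P A a)"]
  by (simp add: ent_def eta_def sum_negf)

lemma ent_comp:
  assumes "finite S" "finite T" "Q ` S \<subseteq> T" "\<And>q. q \<in> T \<Longrightarrow> mass S P Q q = M q"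
  shows "ent S P (\<lambda>w. A (Q w)) = ent T M A"
proof -
  have "mass S P (\<lambda>w. A (Q w)) a = mass T M A a" for a
    unfolding mass_comp[OF assms(1-3)] unfolding mass_def[of T] using assms(4) by (auto intro: sum.cong)
  moreover have "ent S P (\<lambda>w. A (Q w)) = (\<Sum>a\<in>A ` T. eta (mass S P (\<lambda>w. A (Q w)) a))"
    by (rule ent_eq_sum_eta) (use assms in auto)
  moreover have "ent T M A = (\<Sum>a\<in>A ` T. eta (mass T M A a))"
    by (rule ent_eq_sum_eta) (use assms in auto)
  ultimately show ?thesis by simp
qed

text \<open>Without normalisation the masses of a pair are those of its fibres, so the entropy is a
  plain sum over u, free of weights and logarithmic corrections. This makes a mixture over U
  additive.\<close>

lemma ent_fiber:
  assumes "finite T" "finite K"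
  shows "ent (T \<times> K) M (\<lambda>(q, u). (A q, u)) = (\<Sum>u\<in>K. ent T (\<lambda>q. M (q, u)) A)"
proof -
  have m: "mass (T \<times> K) M (\<lambda>(q, u). (A q, u)) (a, u) = mass T (\<lambda>q. M (q, u)) A a" if "u \<in> K" for a u
    unfolding mass_def
    by (rule sum.reindex_bij_witness[of _ "\<lambda>q. (q, u)" fst]) (use that in auto)
  have "ent (T \<times> K) M (\<lambda>(q, u). (A q, u)) =
      (\<Sum>au\<in>A ` T \<times> K. eta (mass (T \<times> K) M (\<lambda>(q, u). (A q, u)) au))"
    by (rule ent_eq_sum_eta) (use assms in auto)
  also have "\<dots> = (\<Sum>(a, u)\<in>A ` T \<times> K. eta (mass T (\<lambda>q. M (q, u)) A a))"
    by (intro sum.cong) (auto simp: m)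
  also have "\<dots> = (\<Sum>u\<in>K. \<Sum>a\<in>A ` T. eta (mass T (\<lambda>q. M (q, u)) A a))"
    unfolding sum.cartesian_product[symmetric] by (rule sum.swap)
  also have "\<dots> = (\<Sum>u\<in>K. ent T (\<lambda>q. M (q, u)) A)"
    using assms by (intro sum.cong ent_eq_sum_eta[symmetric]) auto
  finally show ?thesis .
qed

text \<open>The correction depends on \<open>P\<close> only through its total mass and not on
  \<open>A\<close>. It cancels in a difference of entropies over the same space, which is why
  conditional entropy and mutual information scale linearly.\<close>

lemma ent_scale:
  assumes "finite S" "\<And>w. w \<in> S \<Longrightarrow> P w \<ge> 0" "c > 0"
  shows "ent S (\<lambda>w. c * P w) A = c * ent S P A - c * log 2 c * sum P S"
proof -
  have m: "mass S (\<lambda>w. c * P w) A a = c * mass S P A a" for a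
    by (simp add: mass_def sum_distrib_left)
  have "c * P w * log 2 (c * mass S P A (A w)) = c * (P w * log 2 (mass S P A (A w))) + c * log 2 c * P w"
    if "w \<in> S" for w
  proof (cases "P w = 0")
    case False
    then have "mass S P A (A w) > 0"
      using assms that by (intro mass_pos) (auto simp: order_less_le)
    then show ?thesis
      using assms(3) by (simp add: log_mult algebra_simps)
  qed simp
  then have "(\<Sum>w\<in>S. c * P w * log 2 (c * mass S P A (A w))) =
      (\<Sum>w\<in>S. c * (P w * log 2 (mass S P A (A w))) + c * log 2 c * P w)"
    by (rule sum.cong[OF refl])
  then show ?thesis
    by (simp add: ent_def m sum.distrib sum_distrib_left sum_negf)
qed

text \<open>Only the partition of \<open>S\<close> by the variable enters \<open>ent\<close>. This
  is used throughout to reorder tuples and to drop components determined by the others.\<close>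

lemma ent_cong_fibers:
  assumes "\<And>w w'. w \<in> S \<Longrightarrow> w' \<in> S \<Longrightarrow> A w = A w' \<longleftrightarrow> B w = B w'"
  shows "ent S P A = ent S P B"
proof -
  have "{w' \<in> S. A w' = A w} = {w' \<in> S. B w' = B w}" if "w \<in> S" for w
    using assms that by auto
  then show ?thesis
    unfolding ent_def mass_def by (auto intro!: sum.cong)
qed

lemma ent_mono:
  assumes "finite S" "\<And>w. w \<in> S \<Longrightarrow> P w \<ge> 0"
    and det: "\<And>w w'. w \<in> S \<Longrightarrow> w' \<in> S \<Longrightarrow> B w = B w' \<Longrightarrow> A w = A w'"
  shows "ent S P A \<le> ent S P B"
proof -
  have "P w * log 2 (mass S P B (B w)) \<le> P w * log 2 (mass S P A (A w))" if w: "w \<in> S" for w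
  proof (cases "P w = 0")
    case False
    then have "mass S P B (B w) > 0"
      using assms w by (intro mass_pos) (auto simp: order_less_le)
    moreover have "mass S P B (B w) \<le> mass S P A (A w)"
      unfolding mass_def using assms(1,2) det[OF _ w] by (intro sum_mono2) (simp, blast, simp)
    ultimately show ?thesis
      using assms(2)[OF w] by (intro mult_left_mono) auto
  qed simp
  then show ?thesis
    unfolding ent_def by (simp add: sum_mono)
qed

lemma cond_mi_eq_ent:
  assumes "finite S" "\<And>w. w \<in> S \<Longrightarrow> P w \<ge> 0"
  shows "cond_mi S P A B C = ent S P (\<lambda>w. (A w, C w)) + ent S P (\<lambda>w. (B w, C w))
    - ent S P (\<lambda>w. (A w, B w, C w)) - ent S P C"
proof -
  let ?abc = "\<lambda>w. mass S P (\<lambda>w. (A w, B w, C w)) (A w, B w, C w)"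
  let ?ac = "\<lambda>w. mass S P (\<lambda>w. (A w, C w)) (A w, C w)"
  let ?bc = "\<lambda>w. mass S P (\<lambda>w. (B w, C w)) (B w, C w)"
  let ?c = "\<lambda>w. mass S P C (C w)"
  have "cond_mi S P A B C = (\<Sum>w\<in>S. P w * log 2 (?abc w * ?c w / (?ac w * ?bc w)))"
    by (simp add: cond_mi_def mass_def)
  also have "\<dots> = (\<Sum>w\<in>S. P w * log 2 (?abc w) + P w * log 2 (?c w) - P w * log 2 (?ac w) - P w * log 2 (?bc w))"
  proof (rule sum.cong[OF refl])
    fix w assume w: "w \<in> S"
    show "P w * log 2 (?abc w * ?c w / (?ac w * ?bc w)) =
      P w * log 2 (?abc w) + P w * log 2 (?c w) - P w * log 2 (?ac w) - P w * log 2 (?bc w)"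
    proof (cases "P w = 0")
      case False
      then have "P w > 0" using assms(2)[OF w] by simp
      then have "?abc w > 0" "?ac w > 0" "?bc w > 0" "?c w > 0"
        using mass_pos[OF assms w, where A = "\<lambda>w. (A w, B w, C w)"]
          mass_pos[OF assms w, where A = "\<lambda>w. (A w, C w)"]
          mass_pos[OF assms w, where A = "\<lambda>w. (B w, C w)"] mass_pos[OF assms w, where A = C] by auto
      then show ?thesis
        by (simp add: log_mult log_divide algebra_simps)
    qed simp
  qed
  finally show ?thesis
    by (simp add: ent_def sum.distrib sum_subtractf)
qed

text \<open>Gibbs' inequality: with \<open>r\<close> the ratio of the conditionally independent law
  to the joint law, ln r <= r - 1, and the mean of \<open>r\<close> is at most the total
  mass.\<close>

lemma cond_mi_nonneg:
  assumes "finite S" "\<And>w. w \<in> S \<Longrightarrow> P w \<ge> 0"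
  shows "cond_mi S P A B C \<ge> 0"
proof -
  let ?mabc = "mass S P (\<lambda>w. (A w, B w, C w))"
  let ?mac = "mass S P (\<lambda>w. (A w, C w))"
  let ?mbc = "mass S P (\<lambda>w. (B w, C w))"
  let ?mc = "mass S P C"
  let ?abc = "\<lambda>w. ?mabc (A w, B w, C w)"
  let ?ac = "\<lambda>w. ?mac (A w, C w)"
  let ?bc = "\<lambda>w. ?mbc (B w, C w)"
  let ?c = "\<lambda>w. ?mc (C w)"
  define r where "r = (\<lambda>w. ?ac w * ?bc w / (?abc w * ?c w))"
  have pw: "P w * log 2 (?abc w * ?c w / (?ac w * ?bc w)) \<ge> P w * (1 - r w) / ln 2" if w: "w \<in> S" for w
  proof (cases "P w = 0")
    case False
    then have "P w > 0" using assms(2)[OF w] by simp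
    then have pos: "?abc w > 0" "?ac w > 0" "?bc w > 0" "?c w > 0"
      using mass_pos[OF assms w, where A = "\<lambda>w. (A w, B w, C w)"]
        mass_pos[OF assms w, where A = "\<lambda>w. (A w, C w)"]
        mass_pos[OF assms w, where A = "\<lambda>w. (B w, C w)"] mass_pos[OF assms w, where A = C] by auto
    then have "r w > 0" by (simp add: r_def)
    then have "ln (r w) \<le> r w - 1" by (rule ln_le_minus_one)
    moreover have "ln (?abc w * ?c w / (?ac w * ?bc w)) = - ln (r w)"
      using pos by (simp add: r_def ln_mult ln_div)
    ultimately have "(1 - r w) / ln 2 \<le> log 2 (?abc w * ?c w / (?ac w * ?bc w))"
      unfolding log_def by (intro divide_right_mono) auto
    then have "P w * ((1 - r w) / ln 2) \<le> P w * log 2 (?abc w * ?c w / (?ac w * ?bc w))"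
      using \<open>P w > 0\<close> by (intro mult_left_mono) auto
    then show ?thesis by simp
  qed simp
  have "(\<Sum>w\<in>S. P w * r w) \<le> sum P S"
  proof -
    let ?F = "\<lambda>(a, b, c). ?mac (a, c) * ?mbc (b, c) / (?mabc (a, b, c) * ?mc c)"
    let ?T = "A ` S \<times> B ` S \<times> C ` S"
    have "(\<Sum>w\<in>S. P w * r w) = (\<Sum>w\<in>S. P w * ?F (A w, B w, C w))"
      by (simp add: r_def)
    also have "\<dots> = (\<Sum>t\<in>?T. ?mabc t * ?F t)"
      by (rule sum_mass[symmetric]) (use assms in auto)
    \<comment> \<open>Only an inequality: triples of joint mass 0 contribute nothing on the left but
      may contribute on the right.\<close>
    also have "\<dots> \<le> (\<Sum>(a, b, c)\<in>?T. ?mac (a, c) * ?mbc (b, c) / ?mc c)"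
      by (intro sum_mono) (auto simp: mass_nonneg assms)
    also have "\<dots> = (\<Sum>a\<in>A ` S. \<Sum>b\<in>B ` S. \<Sum>c\<in>C ` S. ?mac (a, c) * ?mbc (b, c) / ?mc c)"
      by (simp add: sum.cartesian_product)
    also have "\<dots> = (\<Sum>c\<in>C ` S. (\<Sum>a\<in>A ` S. ?mac (a, c)) * (\<Sum>b\<in>B ` S. ?mbc (b, c)) / ?mc c)"
      unfolding sum_product sum_divide_distrib
      by (subst sum.swap[of _ "A ` S" "C ` S"]) (intro sum.cong sum.swap refl)
    also have "\<dots> = (\<Sum>c\<in>C ` S. ?mc c * ?mc c / ?mc c)"
      using assms(1) by (simp add: sum_mass_pair)
    also have "\<dots> = (\<Sum>c\<in>C ` S. ?mc c)"
      by (intro sum.cong) auto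
    also have "\<dots> = sum P S"
      using sum_mass[of S "C ` S" C P "\<lambda>_. 1"] assms by simp
    finally show ?thesis .
  qed
  then have "0 \<le> (\<Sum>w\<in>S. P w * (1 - r w) / ln 2)"
    by (simp add: sum_divide_distrib[symmetric] right_diff_distrib sum_subtractf)
  also have "\<dots> \<le> (\<Sum>w\<in>S. P w * log 2 (?abc w * ?c w / (?ac w * ?bc w)))"
    by (rule sum_mono) (rule pw)
  also have "\<dots> = cond_mi S P A B C"
    by (simp add: cond_mi_def mass_def)
  finally show ?thesis .
qed

text \<open>Follows from I(A; B | C) >= 0: as C is a function of B, tuples containing both B and C
  have the same fibres as those with B alone. The later rate bounds use the principle that
  conditioning reduces entropy in this form.\<close>

lemma cond_ent_antimono:
  assumes "finite S" "\<And>w. w \<in> S \<Longrightarrow> P w \<ge> 0"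
    and "\<And>w w'. w \<in> S \<Longrightarrow> w' \<in> S \<Longrightarrow> B w = B w' \<Longrightarrow> C w = C w'"
  shows "ent S P (\<lambda>w. (A w, B w)) - ent S P B \<le> ent S P (\<lambda>w. (A w, C w)) - ent S P C"
proof -
  have "ent S P (\<lambda>w. (B w, C w)) = ent S P B"
    by (rule ent_cong_fibers) (metis assms(3) prod.inject)
  moreover have "ent S P (\<lambda>w. (A w, B w, C w)) = ent S P (\<lambda>w. (A w, B w))"
    by (rule ent_cong_fibers) (metis assms(3) prod.inject)
  ultimately show ?thesis
    using cond_mi_nonneg[of S P A B C, OF assms(1,2)] cond_mi_eq_ent[of S P A B C, OF assms(1,2)] by simp
qed

lemma ent_const:
  assumes "sum P S = 1"
  shows "ent S P (\<lambda>_. c) = 0"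
  using assms by (simp add: ent_def mass_def)

lemma ent_subadditive:
  assumes "finite S" "\<And>w. w \<in> S \<Longrightarrow> P w \<ge> 0" "sum P S = 1"
  shows "ent S P (\<lambda>w. (A w, B w)) \<le> ent S P A + ent S P B"
  using cond_ent_antimono[of S P B "\<lambda>_. ()" A, OF assms(1,2)]
    ent_const[OF assms(3), of "()"] ent_cong_fibers[of S "\<lambda>w. (A w, ())" A P] by simp

lemma ent_le_log_card:
  assumes "finite S" "\<And>w. w \<in> S \<Longrightarrow> P w \<ge> 0" "sum P S = 1" "finite T" "A ` S \<subseteq> T"
  shows "ent S P A \<le> log 2 (card T)"
proof -
  let ?m = "mass S P A"
  have nn: "?m a \<ge> 0" for a by (rule mass_nonneg) (rule assms)
  have one: "(\<Sum>a\<in>T. ?m a) = 1"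
    using sum_mass[OF assms(1,4,5), of P "\<lambda>_. 1"] assms(3) by simp
  then have "T \<noteq> {}" by auto
  then have c: "card T > 0" using assms(4) by (simp add: card_gt_0_iff)
  \<comment> \<open>The tangent bound ln t <= t - 1 at the ratio of the uniform mass to
    \<open>?m a\<close>; the last term sums to 0 over \<open>T\<close>.\<close>
  have "eta (?m a) \<le> ?m a * log 2 (card T) + (1 / card T - ?m a) / ln 2" if "a \<in> T" for a
  proof (cases "?m a = 0")
    case False
    then have pos: "?m a > 0" using nn[of a] by simp
    have "ln (1 / (card T * ?m a)) \<le> 1 / (card T * ?m a) - 1"
      using pos c by (intro ln_le_minus_one) simp
    then have "?m a * ln (1 / (card T * ?m a)) \<le> ?m a * (1 / (card T * ?m a) - 1)"
      using pos by (intro mult_left_mono) auto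
    also have "\<dots> = 1 / card T - ?m a"
      using pos by (simp add: field_simps)
    also have "ln (1 / (card T * ?m a)) = - ln (card T) - ln (?m a)"
      using pos c by (simp add: ln_div ln_mult)
    finally have "?m a * (- ln (card T) - ln (?m a)) / ln 2 \<le> (1 / card T - ?m a) / ln 2"
      by (intro divide_right_mono) auto
    then show ?thesis
      by (simp add: eta_def log_def algebra_simps diff_divide_distrib)
  qed simp
  then have "(\<Sum>a\<in>T. eta (?m a)) \<le> (\<Sum>a\<in>T. ?m a * log 2 (card T) + (1 / card T - ?m a) / ln 2)"
    by (rule sum_mono)
  also have "\<dots> = log 2 (card T)"
    using one c by (simp add: sum.distrib sum_distrib_right[symmetric] sum_divide_distrib[symmetric] sum_subtractf)
  finally show ?thesis
    using ent_eq_sum_eta[OF assms(1,4,5), of P] by simp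
qed

section \<open>Independent sequences\<close>

lemma iid_expectation:
  fixes P g :: "'a \<Rightarrow> real"
  assumes "finite I" "finite S" "sum P S = 1" "i \<in> I"
  shows "(\<Sum>ws\<in>PiE I (\<lambda>_. S). (\<Prod>k\<in>I. P (ws k)) * g (ws i)) = (\<Sum>s\<in>S. P s * g s)"
proof -
  define h where "h = (\<lambda>k s. P s * (if k = i then g s else 1))"
  have "(\<Prod>k\<in>I. P (ws k)) * g (ws i) = (\<Prod>k\<in>I. h k (ws k))" for ws
    using assms by (simp add: h_def prod.distrib prod.delta)
  then have "(\<Sum>ws\<in>PiE I (\<lambda>_. S). (\<Prod>k\<in>I. P (ws k)) * g (ws i)) = (\<Prod>k\<in>I. \<Sum>s\<in>S. h k s)"
    using assms by (simp add: prod_sum_PiE)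
  also have "\<dots> = (\<Prod>k\<in>I. if k = i then (\<Sum>s\<in>S. P s * g s) else 1)"
    using assms by (intro prod.cong) (auto simp: h_def)
  finally show ?thesis
    using assms by (simp add: prod.delta)
qed

lemma iid_expectation2:
  fixes P f g :: "'a \<Rightarrow> real"
  assumes "finite I" "finite S" "sum P S = 1" "i \<in> I" "j \<in> I" "i \<noteq> j"
  shows "(\<Sum>ws\<in>PiE I (\<lambda>_. S). (\<Prod>k\<in>I. P (ws k)) * (f (ws i) * g (ws j))) =
    (\<Sum>s\<in>S. P s * f s) * (\<Sum>s\<in>S. P s * g s)"
proof -
  define h where "h = (\<lambda>k s. P s * ((if k = i then f s else 1) * (if k = j then g s else 1)))"
  have "(\<Prod>k\<in>I. P (ws k)) * (f (ws i) * g (ws j)) = (\<Prod>k\<in>I. h k (ws k))" for ws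
    using assms by (simp add: h_def prod.distrib prod.delta)
  then have "(\<Sum>ws\<in>PiE I (\<lambda>_. S). (\<Prod>k\<in>I. P (ws k)) * (f (ws i) * g (ws j))) = (\<Prod>k\<in>I. \<Sum>s\<in>S. h k s)"
    using assms by (simp add: prod_sum_PiE)
  also have "\<dots> = (\<Prod>k\<in>I. (if k = i then (\<Sum>s\<in>S. P s * f s) else 1) * (if k = j then (\<Sum>s\<in>S. P s * g s) else 1))"
    using assms by (intro prod.cong) (auto simp: h_def)
  finally show ?thesis
    using assms by (simp add: prod.delta prod.distrib)
qed

lemma iid_total:
  fixes P :: "'a \<Rightarrow> real"
  assumes "finite I" "finite S" "sum P S = 1"
  shows "(\<Sum>ws\<in>PiE I (\<lambda>_. S). \<Prod>k\<in>I. P (ws k)) = 1"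
  using prod_sum_PiE[of I "\<lambda>_. S" "\<lambda>_. P"] assms by simp

text \<open>Mixed terms vanish by independence and centring. The functions depend on the index, and
  \<open>J\<close> may be a proper subset, because in the binning estimate the coordinates are the
  values u, each with its own weight, and only the light ones are kept.\<close>

lemma iid_second_moment:
  fixes P :: "'a \<Rightarrow> real" and g :: "'i \<Rightarrow> 'a \<Rightarrow> real"
  assumes "finite I" "finite S" "sum P S = 1" "J \<subseteq> I" "\<And>i. i \<in> J \<Longrightarrow> (\<Sum>s\<in>S. P s * g i s) = 0"
  shows "(\<Sum>ws\<in>PiE I (\<lambda>_. S). (\<Prod>k\<in>I. P (ws k)) * (\<Sum>i\<in>J. g i (ws i))\<^sup>2) =
    (\<Sum>i\<in>J. \<Sum>s\<in>S. P s * (g i s)\<^sup>2)"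
proof -
  let ?W = "PiE I (\<lambda>_. S)" and ?P = "\<lambda>ws. \<Prod>k\<in>I. P (ws k)"
  have fJ: "finite J" using assms finite_subset by blast
  have "(\<Sum>ws\<in>?W. ?P ws * (\<Sum>i\<in>J. g i (ws i))\<^sup>2) = (\<Sum>ws\<in>?W. \<Sum>i\<in>J. \<Sum>j\<in>J. ?P ws * (g i (ws i) * g j (ws j)))"
    unfolding power2_eq_square sum_product by (simp add: sum_distrib_left)
  also have "\<dots> = (\<Sum>i\<in>J. \<Sum>j\<in>J. \<Sum>ws\<in>?W. ?P ws * (g i (ws i) * g j (ws j)))"
    by (subst sum.swap, intro sum.cong refl, rule sum.swap)
  also have "\<dots> = (\<Sum>i\<in>J. \<Sum>j\<in>J. if j = i then (\<Sum>s\<in>S. P s * (g i s)\<^sup>2) else 0)"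
  proof (intro sum.cong refl)
    fix i j assume ij: "i \<in> J" "j \<in> J"
    show "(\<Sum>ws\<in>?W. ?P ws * (g i (ws i) * g j (ws j))) = (if j = i then (\<Sum>s\<in>S. P s * (g i s)\<^sup>2) else 0)"
    proof (cases "j = i")
      case True
      then show ?thesis
        using iid_expectation[OF assms(1-3), of i "\<lambda>s. g i s * g i s"] ij assms(4)
        by (auto simp: power2_eq_square)
    next
      case False
      then show ?thesis
        using iid_expectation2[OF assms(1-3), of i j "g i" "g j"] ij assms(4,5) by auto
    qed
  qed
  also have "\<dots> = (\<Sum>i\<in>J. \<Sum>s\<in>S. P s * (g i s)\<^sup>2)"
    using fJ by simp
  finally show ?thesis .
qed

lemma iid_chebyshev:
  fixes P g :: "'a \<Rightarrow> real" and \<mu> \<delta> :: real and n :: nat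
  assumes "finite S" "\<And>s. s \<in> S \<Longrightarrow> P s \<ge> 0" "sum P S = 1" "\<delta> > 0" "n > 0"
  defines "\<mu> \<equiv> (\<Sum>s\<in>S. P s * g s)"
  shows "(\<Sum>ws\<in>PiE {..<n} (\<lambda>_. S). (\<Prod>k<n. P (ws k)) * of_bool (\<bar>(\<Sum>i<n. g (ws i)) - n * \<mu>\<bar> \<ge> n * \<delta>))
    \<le> (\<Sum>s\<in>S. P s * (g s - \<mu>)\<^sup>2) / \<delta>\<^sup>2 / n"
proof -
  let ?W = "PiE {..<n} (\<lambda>_. S)" and ?P = "\<lambda>ws. \<Prod>k<n. P (ws k)"
  have c: "(\<Sum>i<n. g (ws i) - \<mu>) = (\<Sum>i<n. g (ws i)) - n * \<mu>" for ws
    by (simp add: sum_subtractf)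
  have "(\<Sum>ws\<in>?W. ?P ws * of_bool (\<bar>(\<Sum>i<n. g (ws i)) - n * \<mu>\<bar> \<ge> n * \<delta>))
      \<le> (\<Sum>ws\<in>?W. ?P ws * ((\<Sum>i<n. g (ws i) - \<mu>)\<^sup>2 / (n * \<delta>)\<^sup>2))"
  proof (intro sum_mono mult_left_mono)
    fix ws assume ws: "ws \<in> ?W"
    then show "?P ws \<ge> 0"
      using assms(2) by (intro prod_nonneg) (auto simp: PiE_def Pi_def)
    have "(n * \<delta>)\<^sup>2 \<le> (\<Sum>i<n. g (ws i) - \<mu>)\<^sup>2" if "\<bar>(\<Sum>i<n. g (ws i)) - n * \<mu>\<bar> \<ge> n * \<delta>"
      using that assms(4) unfolding c by (simp add: abs_le_square_iff[symmetric])
    then show "of_bool (\<bar>(\<Sum>i<n. g (ws i)) - n * \<mu>\<bar> \<ge> n * \<delta>) \<le> (\<Sum>i<n. g (ws i) - \<mu>)\<^sup>2 / (n * \<delta>)\<^sup>2"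
      using assms(4,5) by (auto simp: of_bool_def)
  qed
  also have "\<dots> = (\<Sum>ws\<in>?W. ?P ws * (\<Sum>i<n. g (ws i) - \<mu>)\<^sup>2) / (n * \<delta>)\<^sup>2"
    by (simp add: sum_divide_distrib)
  also have "(\<Sum>ws\<in>?W. ?P ws * (\<Sum>i<n. g (ws i) - \<mu>)\<^sup>2) = (\<Sum>i<n. \<Sum>s\<in>S. P s * (g s - \<mu>)\<^sup>2)"
  proof (rule iid_second_moment)
    show "(\<Sum>s\<in>S. P s * (g s - \<mu>)) = 0"
      using assms(3) by (simp add: right_diff_distrib sum_subtractf sum_distrib_right[symmetric] \<mu>_def)
  qed (use assms in auto)
  finally show ?thesis
    using assms(4,5) by (simp add: power2_eq_square field_simps)
qed

lemma log_prod:
  fixes f :: "'a \<Rightarrow> real"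
  assumes "finite I" "\<And>i. i \<in> I \<Longrightarrow> f i > 0"
  shows "log b (\<Prod>i\<in>I. f i) = (\<Sum>i\<in>I. log b (f i))"
  using ln_prod[OF assms(1), of f] assms(2) by (fastforce simp: log_def sum_divide_distrib)

text \<open>The weak law of large numbers for log r. Here \<open>r\<close> is a function separate
  from the law \<open>P\<close>: it will be a conditional probability, and \<open>H\<close> the
  corresponding conditional entropy.\<close>

lemma iid_log_prod_deviation:
  fixes P r :: "'a \<Rightarrow> real" and H :: real
  assumes "finite S" "\<And>s. s \<in> S \<Longrightarrow> P s \<ge> 0" "sum P S = 1" "\<delta> > 0"
    and "\<And>s. s \<in> S \<Longrightarrow> P s > 0 \<Longrightarrow> r s > 0"
  defines "H \<equiv> - (\<Sum>s\<in>S. P s * log 2 (r s))"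
  shows "(\<lambda>n::nat. \<Sum>ws\<in>PiE {..<n} (\<lambda>_. S). (\<Prod>k<n. P (ws k)) *
      of_bool (\<not> (2 powr (- (real n * (H + \<delta>))) \<le> (\<Prod>i<n. r (ws i)) \<and> (\<Prod>i<n. r (ws i)) \<le> 2 powr (- (real n * (H - \<delta>))))))
    \<longlonglongrightarrow> 0" (is "?tail \<longlonglongrightarrow> 0")
proof (rule tendsto_sandwich[where f = "\<lambda>_. 0" and h = "\<lambda>n. (\<Sum>s\<in>S. P s * (log 2 (r s) - (- H))\<^sup>2) / \<delta>\<^sup>2 / real n"])
  have nn: "(\<Prod>k<n. P (ws k)) \<ge> 0" if "ws \<in> PiE {..<n} (\<lambda>_. S)" for n :: nat and ws
    using that assms(2) by (intro prod_nonneg) (auto simp: PiE_def Pi_def)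
  show "\<forall>\<^sub>F n in sequentially. 0 \<le> ?tail n"
    by (intro always_eventually allI sum_nonneg mult_nonneg_nonneg nn) auto
  show "\<forall>\<^sub>F n in sequentially. ?tail n \<le> (\<Sum>s\<in>S. P s * (log 2 (r s) - (- H))\<^sup>2) / \<delta>\<^sup>2 / n"
    using eventually_gt_at_top[of 0]
  proof eventually_elim
    case (elim n)
    have "?tail n \<le> (\<Sum>ws\<in>PiE {..<n} (\<lambda>_. S). (\<Prod>k<n. P (ws k)) *
        of_bool (\<bar>(\<Sum>i<n. log 2 (r (ws i))) - n * (- H)\<bar> \<ge> n * \<delta>))"
    proof (rule sum_mono)
      fix ws assume ws: "ws \<in> PiE {..<n} (\<lambda>_. S)"
      show "(\<Prod>k<n. P (ws k)) *
          of_bool (\<not> (2 powr (- (real n * (H + \<delta>))) \<le> (\<Prod>i<n. r (ws i)) \<and> (\<Prod>i<n. r (ws i)) \<le> 2 powr (- (real n * (H - \<delta>)))))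
        \<le> (\<Prod>k<n. P (ws k)) * of_bool (\<bar>(\<Sum>i<n. log 2 (r (ws i))) - n * (- H)\<bar> \<ge> n * \<delta>)"
      \<comment> \<open>Sequences of probability 0 may contain letters where \<open>r\<close> is not
        positive and its logarithm is meaningless; they carry no weight.\<close>
      proof (cases "(\<Prod>k<n. P (ws k)) = 0")
        case True
        show ?thesis unfolding True by simp
      next
        case False
        have pos: "r (ws i) > 0" if "i < n" for i
        proof -
          have "P (ws i) \<noteq> 0" using False that by auto
          moreover have "ws i \<in> S" using ws that by auto
          ultimately show ?thesis using assms(2,5) by (auto simp: order_less_le)
        qed
        have "log 2 (\<Prod>i<n. r (ws i)) = (\<Sum>i<n. log 2 (r (ws i)))"
          using pos by (intro log_prod) auto
        moreover have "(\<Prod>i<n. r (ws i)) > 0"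
          using pos by (intro prod_pos) auto
        ultimately have "(\<Prod>i<n. r (ws i)) = 2 powr (\<Sum>i<n. log 2 (r (ws i)))"
          using powr_log_cancel[of 2 "\<Prod>i<n. r (ws i)"] by simp
        then show ?thesis
          using nn[OF ws] by (intro mult_left_mono) (auto simp: algebra_simps)
      qed
    qed
    also have "\<dots> \<le> (\<Sum>s\<in>S. P s * (log 2 (r s) - (- H))\<^sup>2) / \<delta>\<^sup>2 / n"
      using iid_chebyshev[where S = S and P = P and \<delta> = \<delta> and n = n and g = "\<lambda>s. log 2 (r s)", OF assms(1-4) elim] by (simp add: H_def)
    finally show ?case .
  qed
  show "(\<lambda>n. (\<Sum>s\<in>S. P s * (log 2 (r s) - (- H))\<^sup>2) / \<delta>\<^sup>2 / real n) \<longlonglongrightarrow> 0"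
    by (rule lim_const_over_n)
qed simp

lemma sum_PiE_zip:
  "(\<Sum>as\<in>PiE I (\<lambda>_. A). \<Sum>bs\<in>PiE I (\<lambda>_. B). F (\<lambda>i\<in>I. (as i, bs i))) = (\<Sum>ws\<in>PiE I (\<lambda>_. A \<times> B). F ws)"
  unfolding sum.cartesian_product
  by (rule sum.reindex_bij_witness[of _ "\<lambda>ws. (\<lambda>i\<in>I. fst (ws i), \<lambda>i\<in>I. snd (ws i))" "\<lambda>(as, bs). \<lambda>i\<in>I. (as i, bs i)"])
    (auto simp: PiE_def Pi_def extensional_def fun_eq_iff mem_Times_iff)

lemma sum_PiE_zip3:
  "(\<Sum>as\<in>PiE I (\<lambda>_. A). \<Sum>bs\<in>PiE I (\<lambda>_. B). \<Sum>cs\<in>PiE I (\<lambda>_. C). F (\<lambda>i\<in>I. (as i, bs i, cs i)))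
    = (\<Sum>ws\<in>PiE I (\<lambda>_. A \<times> B \<times> C). F ws)"
proof -
  have "(\<Sum>bs\<in>PiE I (\<lambda>_. B). \<Sum>cs\<in>PiE I (\<lambda>_. C). F (\<lambda>i\<in>I. (as i, bs i, cs i)))
      = (\<Sum>ws\<in>PiE I (\<lambda>_. B \<times> C). F (\<lambda>i\<in>I. (as i, ws i)))" for as
    using sum_PiE_zip[where F = "\<lambda>ws. F (\<lambda>i\<in>I. (as i, ws i))" and A = B and B = C and I = I]
    by (simp cong: restrict_cong)
  then show ?thesis
    by (simp add: sum_PiE_zip)
qed

lemma sum_PiE_zip5:
  "(\<Sum>as\<in>PiE I (\<lambda>_. A). \<Sum>bs\<in>PiE I (\<lambda>_. B). \<Sum>cs\<in>PiE I (\<lambda>_. C). \<Sum>ds\<in>PiE I (\<lambda>_. D). \<Sum>es\<in>PiE I (\<lambda>_. E).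
      F (\<lambda>i\<in>I. (as i, bs i, cs i, ds i, es i)))
    = (\<Sum>ws\<in>PiE I (\<lambda>_. A \<times> B \<times> C \<times> D \<times> E). F ws)"
proof -
  have "(\<Sum>cs\<in>PiE I (\<lambda>_. C). \<Sum>ds\<in>PiE I (\<lambda>_. D). \<Sum>es\<in>PiE I (\<lambda>_. E). F (\<lambda>i\<in>I. (as i, bs i, cs i, ds i, es i)))
      = (\<Sum>ws\<in>PiE I (\<lambda>_. C \<times> D \<times> E). F (\<lambda>i\<in>I. (as i, bs i, ws i)))" for as bs
    using sum_PiE_zip3[where F = "\<lambda>ws. F (\<lambda>i\<in>I. (as i, bs i, ws i))" and A = C and B = D and C = E and I = I]
    by (simp cong: restrict_cong)
  then show ?thesis
    by (simp add: sum_PiE_zip3)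
qed

text \<open>The fibres of a coordinatewise map are products of fibres, so the logarithms of masses
  add up over the coordinates.\<close>

lemma ent_iid:
  fixes P :: "'a \<Rightarrow> real" and n :: nat
  assumes "finite S" "\<And>s. s \<in> S \<Longrightarrow> P s \<ge> 0" "sum P S = 1"
  shows "ent (PiE {..<n} (\<lambda>_. S)) (\<lambda>ws. \<Prod>k<n. P (ws k)) (\<lambda>ws. \<lambda>i\<in>{..<n}. A (ws i)) = n * ent S P A"
proof -
  let ?W = "PiE {..<n} (\<lambda>_. S)" and ?P = "\<lambda>ws. \<Prod>k<n. P (ws k)"
  have m: "mass ?W ?P (\<lambda>ws. \<lambda>i\<in>{..<n}. A (ws i)) (\<lambda>i\<in>{..<n}. A (ws i)) = (\<Prod>i<n. mass S P A (A (ws i)))" for ws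
  proof -
    have "{vs \<in> ?W. (\<lambda>i\<in>{..<n}. A (vs i)) = (\<lambda>i\<in>{..<n}. A (ws i))} = PiE {..<n} (\<lambda>i. {s \<in> S. A s = A (ws i)})"
      by (auto simp: PiE_def Pi_def fun_eq_iff restrict_def)
    then show ?thesis
      unfolding mass_def using assms(1) by (subst prod_sum_PiE) auto
  qed
  have "?P ws * log 2 (\<Prod>i<n. mass S P A (A (ws i))) = (\<Sum>i<n. ?P ws * log 2 (mass S P A (A (ws i))))"
    if ws: "ws \<in> ?W" for ws
  proof (cases "?P ws = 0")
    case True
    show ?thesis unfolding True by simp
  next
    case False
    have "mass S P A (A (ws i)) > 0" if "i < n" for i
    proof -
      have "P (ws i) \<noteq> 0" using False that by auto
      moreover have "ws i \<in> S" using ws that by auto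
      ultimately show ?thesis using assms(1,2) by (intro mass_pos) (auto simp: order_less_le)
    qed
    then show ?thesis
      by (subst log_prod) (auto simp: sum_distrib_left)
  qed
  then have "ent ?W ?P (\<lambda>ws. \<lambda>i\<in>{..<n}. A (ws i)) = - (\<Sum>ws\<in>?W. \<Sum>i<n. ?P ws * log 2 (mass S P A (A (ws i))))"
    unfolding ent_def m by simp
  also have "\<dots> = - (\<Sum>i<n. \<Sum>ws\<in>?W. ?P ws * log 2 (mass S P A (A (ws i))))"
    by (subst sum.swap) simp
  also have "\<dots> = - (\<Sum>i<n. \<Sum>s\<in>S. P s * log 2 (mass S P A (A s)))"
    using iid_expectation[OF finite_lessThan assms(1,3), where g = "\<lambda>s. log 2 (mass S P A (A s))"] by simp
  finally show ?thesis
    by (simp add: ent_def)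
qed

section \<open>Random binning\<close>

text \<open>The L1 distance between the law of the bin index under \<open>r\<close> and the uniform
  law on \<open>F\<close> bins.\<close>

definition bin_bias :: "'u set \<Rightarrow> nat \<Rightarrow> ('u \<Rightarrow> nat) \<Rightarrow> ('u \<Rightarrow> real) \<Rightarrow> real" where
  "bin_bias U F \<beta> r = (\<Sum>f<F. \<bar>(\<Sum>u\<in>{u\<in>U. \<beta> u = f}. r u) - 1 / F\<bar>)"

lemma exists_le_weighted_average:
  fixes w g :: "'a \<Rightarrow> real"
  assumes "finite I" "\<And>i. i \<in> I \<Longrightarrow> w i \<ge> 0" "sum w I = 1" "(\<Sum>i\<in>I. w i * g i) \<le> B"
  shows "\<exists>i\<in>I. g i \<le> B"
proof (rule ccontr)
  assume "\<not> ?thesis"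
  then have gt: "g i > B" if "i \<in> I" for i using that by force
  have "\<exists>i\<in>I. w i \<noteq> 0" using assms(3) by (metis sum.neutral zero_neq_one)
  then obtain i where i: "i \<in> I" "w i > 0" using assms(2) by (metis order_less_le)
  have "(\<Sum>i\<in>I. w i * B) < (\<Sum>i\<in>I. w i * g i)"
    using assms(1,2) gt i
    by (intro sum_strict_mono_ex1) (auto intro!: mult_left_mono intro: less_imp_le mult_strict_left_mono)
  then show False
    using assms(3,4) by (simp add: sum_distrib_right[symmetric])
qed

text \<open>For each f let the cheapest value in bin f be picked. Under a uniform f this costs no
  more than drawing u from \<open>q a\<close>, except that the bin of such a u is not exactly
  uniform; the discrepancy costs at most \<open>H a\<close> times the bias. Some f is as good as the
  average. A single f has to serve all a at once, since it is fixed before the observation.\<close>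

lemma bin_selection:
  fixes q :: "'a \<Rightarrow> 'u \<Rightarrow> real" and h :: "'a \<Rightarrow> nat \<Rightarrow> 'u \<Rightarrow> real" and H :: "'a \<Rightarrow> real"
  assumes "finite A" "finite U" "U \<noteq> {}" "F > 0" "\<beta> ` U \<subseteq> {..<F}"
    and q: "\<And>a u. a \<in> A \<Longrightarrow> u \<in> U \<Longrightarrow> q a u \<ge> 0"
    and h: "\<And>a f u. a \<in> A \<Longrightarrow> u \<in> U \<Longrightarrow> 0 \<le> h a f u \<and> h a f u \<le> H a"
  shows "\<exists>f<F. \<exists>c. (\<forall>a. c a \<in> U) \<and>
    (\<Sum>a\<in>A. h a f (c a)) \<le> (\<Sum>a\<in>A. \<Sum>u\<in>U. q a u * h a (\<beta> u) u) + (\<Sum>a\<in>A. H a * bin_bias U F \<beta> (q a))"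
proof -
  have "\<exists>u\<in>U. \<forall>u'\<in>U. \<beta> u' = f \<longrightarrow> h a f u \<le> h a f u'" for a f
  proof (cases "{u\<in>U. \<beta> u = f} = {}")
    \<comment> \<open>In an empty bin any value will do: the term 1 / F in the bias of that bin pays
      for it.\<close>
    case True
    then show ?thesis using assms(3) by auto
  next
    case False
    let ?B = "{u\<in>U. \<beta> u = f}"
    have "arg_min_on (h a f) ?B \<in> ?B" "\<forall>u'\<in>?B. h a f (arg_min_on (h a f) ?B) \<le> h a f u'"
      using arg_min_if_finite(1)[of ?B "h a f"] arg_min_least[of ?B _ "h a f"] False assms(2) by auto
    then show ?thesis by blast
  qed
  then obtain c where c: "\<And>a f. c f a \<in> U" "\<And>a f u'. u' \<in> U \<Longrightarrow> \<beta> u' = f \<Longrightarrow> h a f (c f a) \<le> h a f u'"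
    by metis
  let ?b = "\<lambda>a f. \<Sum>u\<in>{u\<in>U. \<beta> u = f}. q a u"
  \<comment> \<open>Split 1 / F into the mass of bin f under \<open>q a\<close> and the rest:
    minimality of \<open>c\<close> bounds the first part, \<open>H a\<close> the second.\<close>
  have step: "1 / F * h a f (c f a) \<le> (\<Sum>u\<in>{u\<in>U. \<beta> u = f}. q a u * h a (\<beta> u) u) + H a * \<bar>?b a f - 1 / F\<bar>"
    if a: "a \<in> A" for a f
  proof -
    have "?b a f * h a f (c f a) \<le> (\<Sum>u\<in>{u\<in>U. \<beta> u = f}. q a u * h a (\<beta> u) u)"
      unfolding sum_distrib_right using c q a by (intro sum_mono) (auto intro!: mult_left_mono)
    moreover have "(1 / F - ?b a f) * h a f (c f a) \<le> \<bar>?b a f - 1 / F\<bar> * H a"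
      using h[OF a c(1)] by (intro mult_mono) auto
    ultimately show ?thesis
      by (simp add: algebra_simps)
  qed
  have "(\<Sum>f<F. 1 / F * (\<Sum>a\<in>A. h a f (c f a))) = (\<Sum>a\<in>A. \<Sum>f<F. 1 / F * h a f (c f a))"
    unfolding sum_distrib_left by (rule sum.swap)
  also have "\<dots> \<le> (\<Sum>a\<in>A. \<Sum>f<F. (\<Sum>u\<in>{u\<in>U. \<beta> u = f}. q a u * h a (\<beta> u) u) + H a * \<bar>?b a f - 1 / F\<bar>)"
    by (intro sum_mono step)
  also have "\<dots> = (\<Sum>a\<in>A. \<Sum>u\<in>U. q a u * h a (\<beta> u) u) + (\<Sum>a\<in>A. H a * bin_bias U F \<beta> (q a))"
    unfolding sum.distrib bin_bias_def sum_distrib_left sum.group[OF assms(2) finite_lessThan assms(5)] ..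
  finally have "\<exists>f\<in>{..<F}. (\<Sum>a\<in>A. h a f (c f a)) \<le>
      (\<Sum>a\<in>A. \<Sum>u\<in>U. q a u * h a (\<beta> u) u) + (\<Sum>a\<in>A. H a * bin_bias U F \<beta> (q a))"
    using assms(4) by (intro exists_le_weighted_average[where w = "\<lambda>_. 1 / real F"]) auto
  then show ?thesis
    using c(1) by blast
qed

text \<open>The variance of |X| is nonnegative.\<close>

lemma weighted_abs_le_sqrt:
  fixes w X :: "'a \<Rightarrow> real"
  assumes "\<And>i. i \<in> I \<Longrightarrow> w i \<ge> 0" "sum w I = 1"
  shows "(\<Sum>i\<in>I. w i * \<bar>X i\<bar>) \<le> sqrt (\<Sum>i\<in>I. w i * (X i)\<^sup>2)"
proof -
  define m where "m = (\<Sum>i\<in>I. w i * \<bar>X i\<bar>)"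
  have "0 \<le> (\<Sum>i\<in>I. w i * (\<bar>X i\<bar> - m)\<^sup>2)"
    using assms by (intro sum_nonneg mult_nonneg_nonneg) auto
  also have "\<dots> = (\<Sum>i\<in>I. w i * (X i)\<^sup>2 - 2 * m * (w i * \<bar>X i\<bar>) + m\<^sup>2 * w i)"
    by (intro sum.cong) (auto simp: power2_diff algebra_simps)
  also have "\<dots> = (\<Sum>i\<in>I. w i * (X i)\<^sup>2) - m\<^sup>2"
    using assms(2) by (simp add: sum.distrib sum_subtractf sum_distrib_left[symmetric] m_def[symmetric] power2_eq_square)
  finally show ?thesis
    unfolding m_def by (intro real_le_rsqrt) simp
qed

text \<open>Split the values at \<open>\<tau>\<close>. The light part of a bin mass has variance at
  most \<open>\<tau>\<close> (F - 1) / F^2, and summing the standard deviations over the F bins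
  gives the square root. A heavy value may land anywhere, so its mass counts twice: once in the bin
  it falls into, once through its share 1 / F of the uniform law in every bin.\<close>

lemma expected_bin_bias:
  fixes q :: "'u \<Rightarrow> real" and Ms :: "'m set" and \<tau> :: real and F :: nat
  assumes "finite U" "finite Ms" "Ms \<noteq> {}" "F > 0" "\<tau> \<ge> 0"
    and q: "\<And>u. u \<in> U \<Longrightarrow> q u \<ge> 0" "sum q U = 1"
  defines "B \<equiv> Ms \<times> {..<F}"
  shows "(\<Sum>\<phi>\<in>PiE U (\<lambda>_. B). (\<Prod>k\<in>U. 1 / card B) * bin_bias U F (\<lambda>u. snd (\<phi> u)) q)
    \<le> 2 * (\<Sum>u\<in>U. q u * of_bool (q u > \<tau>)) + sqrt ((real F - 1) * \<tau>)"
proof -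
  let ?\<Phi> = "PiE U (\<lambda>_. B)" and ?w = "\<Prod>k\<in>U. 1 / real (card B)"
  define G where "G = {u\<in>U. q u \<le> \<tau>}"
  define bad where "bad = (\<Sum>u\<in>U. q u * of_bool (q u > \<tau>))"
  have finG: "finite G" "G \<subseteq> U" using assms(1) by (auto simp: G_def)
  have finB: "finite B" "card B = card Ms * F" "card B > 0" "card Ms > 0"
    using assms(2-4) by (auto simp: B_def card_gt_0_iff)
  have uni: "(\<Sum>b\<in>B. 1 / real (card B)) = 1" using finB by simp
  have tot: "(\<Sum>\<phi>\<in>?\<Phi>. ?w) = 1"
    using iid_total[OF assms(1) finB(1) uni] by simp
  have binsum: "(\<Sum>b\<in>B. 1 / card B * of_bool (snd b = f)) = 1 / F" if "f < F" for f
  proof -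
    have "{b\<in>B. snd b = f} = Ms \<times> {f}" using that by (auto simp: B_def)
    then have "(\<Sum>b\<in>B. of_bool (snd b = f)) = (card Ms :: real)"
      using finB(1) by (simp add: sum.If_cases of_bool_def Int_def card_cartesian_product)
    then show ?thesis
      using finB assms(4) by (simp add: sum_divide_distrib[symmetric])
  qed
  define X where "X = (\<lambda>(f :: nat) (\<phi> :: 'u \<Rightarrow> 'm \<times> nat). \<Sum>u\<in>G. q u * (of_bool (snd (\<phi> u) = f) - 1 / real F))"
  have mean: "(\<Sum>\<phi>\<in>?\<Phi>. ?w * \<bar>X f \<phi>\<bar>) \<le> sqrt ((real F - 1) * \<tau>) / F" if f: "f < F" for f
  proof -
    have "(\<Sum>\<phi>\<in>?\<Phi>. ?w * \<bar>X f \<phi>\<bar>) \<le> sqrt (\<Sum>\<phi>\<in>?\<Phi>. ?w * (X f \<phi>)\<^sup>2)"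
      by (rule weighted_abs_le_sqrt[OF _ tot]) simp
    also have "(\<Sum>\<phi>\<in>?\<Phi>. ?w * (X f \<phi>)\<^sup>2) = (\<Sum>u\<in>G. \<Sum>b\<in>B. 1 / card B * (q u * (of_bool (snd b = f) - 1 / real F))\<^sup>2)"
      unfolding X_def
    proof (rule iid_second_moment[OF assms(1) finB(1) uni finG(2)])
      fix u
      have "(\<Sum>b\<in>B. 1 / card B * (q u * (of_bool (snd b = f) - 1 / real F))) =
          (\<Sum>b\<in>B. q u * (1 / card B * of_bool (snd b = f)) - q u * (1 / F) * (1 / card B))"
        by (intro sum.cong) (auto simp: algebra_simps)
      also have "\<dots> = q u * (\<Sum>b\<in>B. 1 / card B * of_bool (snd b = f)) - q u * (1 / F) * (\<Sum>b\<in>B. 1 / card B)"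
        by (simp only: sum_subtractf sum_distrib_left)
      also have "\<dots> = 0"
        unfolding binsum[OF f] uni by simp
      finally show "(\<Sum>b\<in>B. 1 / card B * (q u * (of_bool (snd b = f) - 1 / real F))) = 0" .
    qed
    \<comment> \<open>The variance of an indicator of probability 1 / F is 1 / F - 1 / F^2.\<close>
    also have "\<dots> = (\<Sum>u\<in>G. (q u)\<^sup>2 * ((real F - 1) / F\<^sup>2))"
    proof (intro sum.cong refl)
      fix u
      have "(\<Sum>b\<in>B. 1 / card B * (q u * (of_bool (snd b = f) - 1 / real F))\<^sup>2) =
          (\<Sum>b\<in>B. (q u)\<^sup>2 * (1 - 2 / F) * (1 / card B * of_bool (snd b = f)) + (q u)\<^sup>2 * (1 / F\<^sup>2) * (1 / card B))"
        by (intro sum.cong) (auto simp: power2_eq_square algebra_simps)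
      also have "\<dots> = (q u)\<^sup>2 * (1 - 2 / F) * (\<Sum>b\<in>B. 1 / card B * of_bool (snd b = f)) + (q u)\<^sup>2 * (1 / F\<^sup>2) * (\<Sum>b\<in>B. 1 / card B)"
        by (simp only: sum.distrib sum_distrib_left)
      also have "\<dots> = (q u)\<^sup>2 * (1 - 2 / F) * (1 / F) + (q u)\<^sup>2 * (1 / F\<^sup>2)"
        unfolding binsum[OF f] uni by simp
      also have "\<dots> = (q u)\<^sup>2 * ((real F - 1) / F\<^sup>2)"
        using assms(4) by (simp add: field_simps power2_eq_square of_nat_diff)
      finally show "(\<Sum>b\<in>B. 1 / card B * (q u * (of_bool (snd b = f) - 1 / real F))\<^sup>2) = (q u)\<^sup>2 * ((real F - 1) / F\<^sup>2)" .
    qed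
    also have "\<dots> \<le> (\<Sum>u\<in>G. (q u * \<tau>) * ((real F - 1) / F\<^sup>2))"
      using q(1) assms(4) by (intro sum_mono mult_right_mono) (auto simp: G_def power2_eq_square mult_left_mono)
    also have "\<dots> = (\<Sum>u\<in>G. q u) * (\<tau> * ((real F - 1) / F\<^sup>2))"
      unfolding sum_distrib_right by (simp add: mult.assoc)
    also have "\<dots> \<le> 1 * (\<tau> * ((real F - 1) / F\<^sup>2))"
    proof (rule mult_right_mono)
      have "(\<Sum>u\<in>G. q u) \<le> (\<Sum>u\<in>U. q u)"
        using q(1) finG assms(1) by (intro sum_mono2) auto
      then show "(\<Sum>u\<in>G. q u) \<le> 1" using q(2) by simp
    qed (use assms(4,5) in auto)
    finally have "(\<Sum>\<phi>\<in>?\<Phi>. ?w * \<bar>X f \<phi>\<bar>) \<le> sqrt ((real F - 1) * \<tau> / F\<^sup>2)"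
      by (simp add: mult.commute)
    then show ?thesis
      using assms(4) by (simp add: real_sqrt_divide)
  qed
  have split: "bin_bias U F (\<lambda>u. snd (\<phi> u)) q \<le> (\<Sum>f<F. \<bar>X f \<phi>\<bar>) + 2 * bad" if \<phi>: "\<phi> \<in> ?\<Phi>" for \<phi>
  proof -
    have piece: "\<bar>(\<Sum>u\<in>{u\<in>U. snd (\<phi> u) = f}. q u) - 1 / F\<bar> \<le>
        \<bar>X f \<phi>\<bar> + ((\<Sum>u\<in>{u\<in>U. snd (\<phi> u) = f}. q u * of_bool (q u > \<tau>)) + bad / F)" for f
    proof -
      have "(\<Sum>u\<in>{u\<in>U. snd (\<phi> u) = f}. q u) - 1 / F = (\<Sum>u\<in>U. q u * of_bool (snd (\<phi> u) = f)) - (\<Sum>u\<in>U. q u) * (1 / F)"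
        using q(2) assms(1) by (simp add: sum.inter_filter of_bool_def if_distrib cong: if_cong)
      also have "\<dots> = (\<Sum>u\<in>U. q u * (of_bool (snd (\<phi> u) = f) - 1 / F))"
        by (simp add: sum_divide_distrib sum_subtractf right_diff_distrib)
      also have "\<dots> = X f \<phi> + (\<Sum>u\<in>U - G. q u * (of_bool (snd (\<phi> u) = f) - 1 / F))"
        unfolding X_def using sum.subset_diff[OF finG(2) assms(1)] by (simp add: add.commute)
      finally have 1: "(\<Sum>u\<in>{u\<in>U. snd (\<phi> u) = f}. q u) - 1 / F = X f \<phi> + (\<Sum>u\<in>U - G. q u * (of_bool (snd (\<phi> u) = f) - 1 / F))" .
      have "\<bar>\<Sum>u\<in>U - G. q u * (of_bool (snd (\<phi> u) = f) - 1 / F)\<bar> \<le> (\<Sum>u\<in>U - G. q u * of_bool (snd (\<phi> u) = f) + q u * (1 / F))"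
      proof (intro order_trans[OF sum_abs] sum_mono)
        fix u assume "u \<in> U - G"
        moreover have "\<bar>of_bool (snd (\<phi> u) = f) - 1 / real F\<bar> \<le> of_bool (snd (\<phi> u) = f) + 1 / real F"
          by (auto simp: abs_le_iff)
        ultimately show "\<bar>q u * (of_bool (snd (\<phi> u) = f) - 1 / F)\<bar> \<le> q u * of_bool (snd (\<phi> u) = f) + q u * (1 / F)"
          unfolding abs_mult distrib_left[symmetric] using q(1)[of u] by (intro mult_mono) auto
      qed
      also have "\<dots> = (\<Sum>u\<in>U. (q u * of_bool (snd (\<phi> u) = f) + q u * (1 / F)) * of_bool (q u > \<tau>))"
        using assms(1) by (intro sum.mono_neutral_cong_left) (auto simp: G_def)
      also have "\<dots> = (\<Sum>u\<in>{u\<in>U. snd (\<phi> u) = f}. q u * of_bool (q u > \<tau>)) + bad / F"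
        unfolding bad_def sum_divide_distrib sum.inter_filter[OF assms(1)] sum.distrib[symmetric]
        by (intro sum.cong) auto
      finally show ?thesis using 1 by linarith
    qed
    have "bin_bias U F (\<lambda>u. snd (\<phi> u)) q \<le>
        (\<Sum>f<F. \<bar>X f \<phi>\<bar> + ((\<Sum>u\<in>{u\<in>U. snd (\<phi> u) = f}. q u * of_bool (q u > \<tau>)) + bad / F))"
      unfolding bin_bias_def by (intro sum_mono piece)
    also have "\<dots> = (\<Sum>f<F. \<bar>X f \<phi>\<bar>) + (\<Sum>f<F. \<Sum>u\<in>{u\<in>U. snd (\<phi> u) = f}. q u * of_bool (q u > \<tau>)) + bad"
      using assms(4) by (simp add: sum.distrib)
    also have "(\<Sum>f<F. \<Sum>u\<in>{u\<in>U. snd (\<phi> u) = f}. q u * of_bool (q u > \<tau>)) = bad"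
      unfolding bad_def by (rule sum.group) (use \<phi> assms(1) in \<open>auto simp: B_def PiE_def Pi_def\<close>)
    finally show ?thesis by simp
  qed
  have "(\<Sum>\<phi>\<in>?\<Phi>. ?w * bin_bias U F (\<lambda>u. snd (\<phi> u)) q) \<le> (\<Sum>\<phi>\<in>?\<Phi>. ?w * ((\<Sum>f<F. \<bar>X f \<phi>\<bar>) + 2 * bad))"
    using split by (intro sum_mono mult_left_mono) (auto intro: prod_nonneg)
  also have "\<dots> = (\<Sum>\<phi>\<in>?\<Phi>. \<Sum>f<F. ?w * \<bar>X f \<phi>\<bar>) + (\<Sum>\<phi>\<in>?\<Phi>. ?w) * (2 * bad)"
    by (simp only: distrib_left sum.distrib sum_distrib_right sum_distrib_left)
  also have "\<dots> = (\<Sum>f<F. \<Sum>\<phi>\<in>?\<Phi>. ?w * \<bar>X f \<phi>\<bar>) + 2 * bad"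
    unfolding tot by (subst sum.swap) simp
  also have "\<dots> \<le> (\<Sum>f<F. sqrt ((real F - 1) * \<tau>) / F) + 2 * bad"
    using mean by (intro add_mono sum_mono) auto
  also have "\<dots> = 2 * bad + sqrt ((real F - 1) * \<tau>)"
    using assms(4) by simp
  finally show ?thesis by (simp add: bad_def)
qed

text \<open>\<open>SOME\<close> makes the decoder total: if no value passes the test, the output is
  arbitrary and may lie outside \<open>U\<close>. Hence costs are later bounded for all arguments,
  not only for those in \<open>U\<close>.\<close>

definition bin_decode :: "'u set \<Rightarrow> ('u \<Rightarrow> 'b \<Rightarrow> real) \<Rightarrow> real \<Rightarrow> ('u \<Rightarrow> 'm) \<Rightarrow> 'm \<Rightarrow> 'b \<Rightarrow> 'u" where
  "bin_decode U s \<theta> \<phi> m b = (SOME u. u \<in> U \<and> \<phi> u = m \<and> s u b \<ge> \<theta>)"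

text \<open>An error requires that the true u misses the threshold or that a rival above it carries
  the same label. Scores summing to at most 1 leave at most 1 / \<open>\<theta>\<close> rivals, and
  each collides with probability 1 / card B.\<close>

lemma expected_decode_error:
  fixes s :: "'u \<Rightarrow> 'b \<Rightarrow> real" and B :: "'m set" and \<theta> :: real
  assumes "finite U" "finite B" "B \<noteq> {}" "\<theta> > 0" "u \<in> U"
    and s: "\<And>u. u \<in> U \<Longrightarrow> s u b \<ge> 0" "(\<Sum>u\<in>U. s u b) \<le> 1"
  shows "(\<Sum>\<phi>\<in>PiE U (\<lambda>_. B). (\<Prod>k\<in>U. 1 / card B) * of_bool (bin_decode U s \<theta> \<phi> (\<phi> u) b \<noteq> u))
    \<le> of_bool (s u b < \<theta>) + 1 / (card B * \<theta>)"
proof -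
  let ?\<Phi> = "PiE U (\<lambda>_. B)" and ?w = "\<Prod>k\<in>U. 1 / real (card B)"
  define L where "L = {u'\<in>U. u' \<noteq> u \<and> s u' b \<ge> \<theta>}"
  have cB: "card B > 0" using assms(2,3) by (simp add: card_gt_0_iff)
  have uni: "(\<Sum>b\<in>B. 1 / real (card B)) = 1" using cB by simp
  have tot: "(\<Sum>\<phi>\<in>?\<Phi>. ?w) = 1"
    using iid_total[OF assms(1,2) uni] by simp
  have finL: "finite L" using assms(1) by (simp add: L_def)
  have "card L * \<theta> = (\<Sum>u'\<in>L. \<theta>)" by simp
  also have "\<dots> \<le> (\<Sum>u'\<in>L. s u' b)" by (intro sum_mono) (auto simp: L_def)
  also have "\<dots> \<le> (\<Sum>u\<in>U. s u b)" using s assms(1) by (intro sum_mono2) (auto simp: L_def)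
  finally have cL: "real (card L) \<le> 1 / \<theta>" using s(2) assms(4) by (simp add: field_simps)
  have coll: "(\<Sum>\<phi>\<in>?\<Phi>. ?w * of_bool (\<phi> u' = \<phi> u)) = 1 / card B" if "u' \<in> L" for u'
  proof -
    have u': "u' \<in> U" "u' \<noteq> u" using that by (auto simp: L_def)
    \<comment> \<open>Summing over the common label m turns a collision into products of functions
      of single coordinates, so that independence applies.\<close>
    have "(\<Sum>\<phi>\<in>?\<Phi>. ?w * of_bool (\<phi> u' = \<phi> u)) = (\<Sum>\<phi>\<in>?\<Phi>. \<Sum>m\<in>B. ?w * (of_bool (\<phi> u' = m) * of_bool (\<phi> u = m)))"
    proof (rule sum.cong[OF refl])
      fix \<phi> assume "\<phi> \<in> ?\<Phi>"
      then have "\<phi> u \<in> B" using assms(5) by auto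
      then have "(\<Sum>m\<in>B. of_bool (\<phi> u' = m) * of_bool (\<phi> u = m)) = (of_bool (\<phi> u' = \<phi> u) :: real)"
        using assms(2) by (subst sum.remove[of B "\<phi> u"]) (auto intro!: sum.neutral)
      then show "?w * of_bool (\<phi> u' = \<phi> u) = (\<Sum>m\<in>B. ?w * (of_bool (\<phi> u' = m) * of_bool (\<phi> u = m)))"
        by (simp add: sum_distrib_left[symmetric])
    qed
    also have "\<dots> = (\<Sum>m\<in>B. \<Sum>\<phi>\<in>?\<Phi>. ?w * (of_bool (\<phi> u' = m) * of_bool (\<phi> u = m)))"
      by (rule sum.swap)
    also have "\<dots> = (\<Sum>m\<in>B. (\<Sum>b\<in>B. 1 / card B * of_bool (b = m)) * (\<Sum>b\<in>B. 1 / card B * of_bool (b = m)))"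
      using u' assms(5) iid_expectation2[OF assms(1,2) uni, of u' u "\<lambda>b. of_bool (b = m)" "\<lambda>b. of_bool (b = m)" for m]
      by (intro sum.cong) auto
    also have "\<dots> = (\<Sum>m\<in>B. 1 / card B * (1 / card B))"
      using assms(2) by (intro sum.cong) (auto simp: sum_divide_distrib[symmetric] of_bool_def)
    also have "\<dots> = 1 / card B" using cB by simp
    finally show ?thesis .
  qed
  have err: "of_bool (bin_decode U s \<theta> \<phi> (\<phi> u) b \<noteq> u) \<le> of_bool (s u b < \<theta>) + (\<Sum>u'\<in>L. of_bool (\<phi> u' = \<phi> u) :: real)" for \<phi>
  proof (cases "bin_decode U s \<theta> \<phi> (\<phi> u) b \<noteq> u \<and> s u b \<ge> \<theta>")
    case True
    let ?u = "bin_decode U s \<theta> \<phi> (\<phi> u) b"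
    have "?u \<in> U \<and> \<phi> ?u = \<phi> u \<and> s ?u b \<ge> \<theta>"
      unfolding bin_decode_def by (rule someI[of _ u]) (use True assms(5) in auto)
    then have "?u \<in> L" "\<phi> ?u = \<phi> u" using True by (auto simp: L_def)
    then have "(1::real) \<le> (\<Sum>u'\<in>L. of_bool (\<phi> u' = \<phi> u))"
      using member_le_sum[of ?u L "\<lambda>u'. of_bool (\<phi> u' = \<phi> u) :: real"] finL by simp
    then show ?thesis by (simp add: of_bool_def)
  next
    case False
    then show ?thesis by (auto intro!: sum_nonneg add_nonneg_nonneg)
  qed
  have "(\<Sum>\<phi>\<in>?\<Phi>. ?w * of_bool (bin_decode U s \<theta> \<phi> (\<phi> u) b \<noteq> u)) \<le>
      (\<Sum>\<phi>\<in>?\<Phi>. ?w * (of_bool (s u b < \<theta>) + (\<Sum>u'\<in>L. of_bool (\<phi> u' = \<phi> u))))"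
    by (intro sum_mono mult_left_mono err) simp
  also have "\<dots> = (\<Sum>\<phi>\<in>?\<Phi>. ?w) * of_bool (s u b < \<theta>) + (\<Sum>u'\<in>L. \<Sum>\<phi>\<in>?\<Phi>. ?w * of_bool (\<phi> u' = \<phi> u))"
    by (subst sum.swap) (simp only: distrib_left sum.distrib sum_distrib_right sum_distrib_left)
  also have "\<dots> = of_bool (s u b < \<theta>) + card L * (1 / card B)"
    unfolding tot using coll by simp
  also have "\<dots> \<le> of_bool (s u b < \<theta>) + 1 / \<theta> * (1 / card B)"
    using cL by (intro add_left_mono mult_right_mono) auto
  finally show ?thesis by (simp add: mult.commute)
qed

lemma expected_average_decode_error:
  fixes s :: "'u \<Rightarrow> 'b \<Rightarrow> real" and B :: "'m set" and \<theta> :: real and w :: "'c \<Rightarrow> 'u \<Rightarrow> real"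
  assumes "finite U" "finite B" "B \<noteq> {}" "\<theta> > 0"
    and w: "\<And>c u. c \<in> C \<Longrightarrow> u \<in> U \<Longrightarrow> w c u \<ge> 0" "(\<Sum>c\<in>C. \<Sum>u\<in>U. w c u) = 1"
    and s: "\<And>u b. s u b \<ge> 0" "\<And>b. (\<Sum>u\<in>U. s u b) \<le> 1"
  shows "(\<Sum>\<phi>\<in>PiE U (\<lambda>_. B). (\<Prod>k\<in>U. 1 / card B) *
      (\<Sum>c\<in>C. \<Sum>u\<in>U. w c u * of_bool (bin_decode U s \<theta> \<phi> (\<phi> u) (b c) \<noteq> u)))
    \<le> (\<Sum>c\<in>C. \<Sum>u\<in>U. w c u * of_bool (s u (b c) < \<theta>)) + 1 / (card B * \<theta>)"
proof -
  let ?\<Phi> = "PiE U (\<lambda>_. B)" and ?w = "\<Prod>k\<in>U. 1 / real (card B)"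
  have "(\<Sum>\<phi>\<in>?\<Phi>. ?w * (\<Sum>c\<in>C. \<Sum>u\<in>U. w c u * of_bool (bin_decode U s \<theta> \<phi> (\<phi> u) (b c) \<noteq> u)))
      = (\<Sum>c\<in>C. \<Sum>u\<in>U. w c u * (\<Sum>\<phi>\<in>?\<Phi>. ?w * of_bool (bin_decode U s \<theta> \<phi> (\<phi> u) (b c) \<noteq> u)))"
    unfolding sum_distrib_left
    by (subst sum.swap, intro sum.cong refl, subst sum.swap, intro sum.cong refl) (simp only: ac_simps)
  also have "\<dots> \<le> (\<Sum>c\<in>C. \<Sum>u\<in>U. w c u * (of_bool (s u (b c) < \<theta>) + 1 / (card B * \<theta>)))"
    using assms by (intro sum_mono mult_left_mono expected_decode_error) auto
  also have "\<dots> = (\<Sum>c\<in>C. \<Sum>u\<in>U. w c u * of_bool (s u (b c) < \<theta>)) + 1 / (card B * \<theta>)"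
    unfolding distrib_left sum.distrib sum_distrib_right[symmetric] w(2) by simp
  finally show ?thesis .
qed

text \<open>Every value receives a random pair of a message and a bin index. Only the message is transmitted; the bin
  index is fixed in advance, and the observer of \<open>obs c\<close> picks a value in that bin.\<close>

lemma binning_code:
  fixes w :: "'c \<Rightarrow> real" and obs :: "'c \<Rightarrow> 'a" and q :: "'a \<Rightarrow> 'u \<Rightarrow> real"
    and s1 :: "'u \<Rightarrow> 'b1 \<Rightarrow> real" and s2 :: "'u \<Rightarrow> 'b2 \<Rightarrow> real"
    and k :: "'c \<Rightarrow> 'u \<Rightarrow> 'u \<Rightarrow> real" and Ms :: "'m set" and F :: nat and \<tau> \<theta> dm :: real
  assumes fin: "finite C" "finite U" "finite Ms" "Ms \<noteq> {}" "F > 0" "\<tau> \<ge> 0" "\<theta> > 0"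
    and w: "\<And>c. c \<in> C \<Longrightarrow> w c \<ge> 0" "sum w C = 1"
    and q: "\<And>a u. q a u \<ge> 0" "\<And>a. (\<Sum>u\<in>U. q a u) = 1"
    and s1: "\<And>u b. s1 u b \<ge> 0" "\<And>b. (\<Sum>u\<in>U. s1 u b) \<le> 1"
    and s2: "\<And>u b. s2 u b \<ge> 0" "\<And>b. (\<Sum>u\<in>U. s2 u b) \<le> 1"
    and k: "\<And>c u u'. 0 \<le> k c u u'" "\<And>c u u'. k c u u' \<le> dm"
  shows "\<exists>enc dec1 dec2. (\<forall>a. enc a \<in> Ms) \<and>
    (\<Sum>c\<in>C. w c * k c (dec1 (enc (obs c)) (b1 c)) (dec2 (enc (obs c)) (b2 c)))
    \<le> (\<Sum>c\<in>C. \<Sum>u\<in>U. w c * q (obs c) u * k c u u)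
      + dm * (2 * (\<Sum>c\<in>C. \<Sum>u\<in>U. w c * q (obs c) u * of_bool (q (obs c) u > \<tau>)) + sqrt ((real F - 1) * \<tau>)
        + (\<Sum>c\<in>C. \<Sum>u\<in>U. w c * q (obs c) u * of_bool (s1 u (b1 c) < \<theta>))
        + (\<Sum>c\<in>C. \<Sum>u\<in>U. w c * q (obs c) u * of_bool (s2 u (b2 c) < \<theta>))
        + 2 / (card Ms * F * \<theta>))"
proof -
  define B where "B = Ms \<times> {..<F}"
  let ?\<Phi> = "PiE U (\<lambda>_. B)" and ?w = "\<Prod>k\<in>U. 1 / real (card B)"
  have finB: "finite B" "B \<noteq> {}" "card B = card Ms * F" "card B > 0"
    using fin(3-5) by (auto simp: B_def card_gt_0_iff)
  have tot: "(\<Sum>\<phi>\<in>?\<Phi>. ?w) = 1"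
    using iid_total[OF fin(2) finB(1), of "\<lambda>_. 1 / real (card B)"] finB by simp
  have dm: "dm \<ge> 0" using k order_trans by blast
  have Une: "U \<noteq> {}" using q(2) by auto
  let ?D1 = "bin_decode U s1 \<theta>" and ?D2 = "bin_decode U s2 \<theta>"
  define err where "err = (\<lambda>\<phi> :: 'u \<Rightarrow> 'm \<times> nat. (\<Sum>c\<in>C. w c * bin_bias U F (\<lambda>u. snd (\<phi> u)) (q (obs c)))
    + (\<Sum>c\<in>C. \<Sum>u\<in>U. w c * q (obs c) u * of_bool (?D1 \<phi> (\<phi> u) (b1 c) \<noteq> u))
    + (\<Sum>c\<in>C. \<Sum>u\<in>U. w c * q (obs c) u * of_bool (?D2 \<phi> (\<phi> u) (b2 c) \<noteq> u)))"
  define bound where "bound = 2 * (\<Sum>c\<in>C. \<Sum>u\<in>U. w c * q (obs c) u * of_bool (q (obs c) u > \<tau>)) + sqrt ((real F - 1) * \<tau>)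
        + (\<Sum>c\<in>C. \<Sum>u\<in>U. w c * q (obs c) u * of_bool (s1 u (b1 c) < \<theta>))
        + (\<Sum>c\<in>C. \<Sum>u\<in>U. w c * q (obs c) u * of_bool (s2 u (b2 c) < \<theta>))
        + 2 / (card Ms * F * \<theta>)"
  have sum1: "(\<Sum>c\<in>C. \<Sum>u\<in>U. w c * q (obs c) u) = 1"
    using w(2) q(2) by (simp add: sum_distrib_left[symmetric])
  have wq: "w c * q (obs c) u \<ge> 0" if "c \<in> C" for c u
    using w(1) q(1) that by simp
  have bias_avg: "(\<Sum>\<phi>\<in>?\<Phi>. ?w * (\<Sum>c\<in>C. w c * bin_bias U F (\<lambda>u. snd (\<phi> u)) (q (obs c))))
      \<le> 2 * (\<Sum>c\<in>C. \<Sum>u\<in>U. w c * q (obs c) u * of_bool (q (obs c) u > \<tau>)) + sqrt ((real F - 1) * \<tau>)"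
  proof -
    have "(\<Sum>\<phi>\<in>?\<Phi>. ?w * (\<Sum>c\<in>C. w c * bin_bias U F (\<lambda>u. snd (\<phi> u)) (q (obs c))))
        = (\<Sum>c\<in>C. w c * (\<Sum>\<phi>\<in>?\<Phi>. ?w * bin_bias U F (\<lambda>u. snd (\<phi> u)) (q (obs c))))"
      unfolding sum_distrib_left by (subst sum.swap) (simp only: ac_simps)
    also have "\<dots> \<le> (\<Sum>c\<in>C. w c * (2 * (\<Sum>u\<in>U. q (obs c) u * of_bool (q (obs c) u > \<tau>)) + sqrt ((real F - 1) * \<tau>)))"
      unfolding B_def using fin w q by (intro sum_mono mult_left_mono expected_bin_bias) auto
    also have "\<dots> = 2 * (\<Sum>c\<in>C. \<Sum>u\<in>U. w c * q (obs c) u * of_bool (q (obs c) u > \<tau>)) + sqrt ((real F - 1) * \<tau>)"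
      unfolding distrib_left sum.distrib sum_distrib_right[symmetric] w(2) sum_distrib_left
      by (simp add: mult.assoc mult.left_commute)
    finally show ?thesis .
  qed
  have two: "2 / (card Ms * F * \<theta>) = 1 / (card Ms * F * \<theta>) + 1 / (card Ms * F * \<theta>)"
    by simp
  \<comment> \<open>All three defects are averaged in one sum, so that a single labelling is good
    for the bin bias and for both decoders at once.\<close>
  have "(\<Sum>\<phi>\<in>?\<Phi>. ?w * err \<phi>) \<le> bound"
    using expected_average_decode_error[where s = s1 and b = b1, OF fin(2) finB(1,2) fin(7) wq sum1 s1]
      expected_average_decode_error[where s = s2 and b = b2, OF fin(2) finB(1,2) fin(7) wq sum1 s2] bias_avg
    unfolding err_def bound_def distrib_left sum.distrib finB(3) two by linarith
  then obtain \<phi> where \<phi>: "\<phi> \<in> ?\<Phi>" "err \<phi> \<le> bound"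
    using exists_le_weighted_average[of ?\<Phi> "\<lambda>_. ?w" err bound] tot fin(2) finB(1)
    by (auto simp: finite_PiE)
  \<comment> \<open>The cost, over all situations with observation a, of picking u while the
    decoders assume bin f. It is the cost of honestly labelling u when f is the bin of u.\<close>
  define h where "h = (\<lambda>a f u. \<Sum>c\<in>{c\<in>C. obs c = a}. w c * k c (?D1 \<phi> (fst (\<phi> u), f) (b1 c)) (?D2 \<phi> (fst (\<phi> u), f) (b2 c)))"
  define H where "H = (\<lambda>a. \<Sum>c\<in>{c\<in>C. obs c = a}. w c * dm)"
  have "0 \<le> h a f u \<and> h a f u \<le> H a" for a f u
    unfolding h_def H_def using w k by (auto intro!: sum_nonneg sum_mono mult_left_mono)
  moreover have "(\<lambda>u. snd (\<phi> u)) ` U \<subseteq> {..<F}"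
    using \<phi>(1) by (auto simp: B_def PiE_def Pi_def)
  ultimately obtain f c0 where fc: "f < F" "\<forall>a. c0 a \<in> U"
    "(\<Sum>a\<in>obs ` C. h a f (c0 a)) \<le> (\<Sum>a\<in>obs ` C. \<Sum>u\<in>U. q a u * h a (snd (\<phi> u)) u)
      + (\<Sum>a\<in>obs ` C. H a * bin_bias U F (\<lambda>u. snd (\<phi> u)) (q a))"
    using bin_selection[of "obs ` C" U F "\<lambda>u. snd (\<phi> u)" q h H] fin Une q by auto
  have grp: "(\<Sum>a\<in>obs ` C. \<Sum>c\<in>{c\<in>C. obs c = a}. G (obs c) c) = (\<Sum>c\<in>C. G (obs c) c)" for G :: "'a \<Rightarrow> 'c \<Rightarrow> real"
    by (rule sum.group) (use fin in auto)
  have grp': "(\<Sum>a\<in>obs ` C. \<Sum>c\<in>{c\<in>C. obs c = a}. G a c) = (\<Sum>c\<in>C. G (obs c) c)" for G :: "'a \<Rightarrow> 'c \<Rightarrow> real"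
    unfolding grp[symmetric] by (intro sum.cong) auto
  define enc where "enc = (\<lambda>a. fst (\<phi> (c0 a)))"
  define dec1 where "dec1 = (\<lambda>m b. ?D1 \<phi> (m, f) b)"
  define dec2 where "dec2 = (\<lambda>m b. ?D2 \<phi> (m, f) b)"
  have encM: "enc a \<in> Ms" for a
    using \<phi>(1) fc(2) by (auto simp: enc_def B_def PiE_def Pi_def mem_Times_iff)
  have hsum: "(\<Sum>c\<in>C. w c * k c (dec1 (enc (obs c)) (b1 c)) (dec2 (enc (obs c)) (b2 c))) = (\<Sum>a\<in>obs ` C. h a f (c0 a))"
    unfolding h_def grp' by (simp add: dec1_def dec2_def enc_def)
  have "(\<Sum>c\<in>C. w c * k c (dec1 (enc (obs c)) (b1 c)) (dec2 (enc (obs c)) (b2 c)))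
      \<le> (\<Sum>c\<in>C. \<Sum>u\<in>U. w c * q (obs c) u * k c (?D1 \<phi> (\<phi> u) (b1 c)) (?D2 \<phi> (\<phi> u) (b2 c)))
        + (\<Sum>c\<in>C. dm * (w c * bin_bias U F (\<lambda>u. snd (\<phi> u)) (q (obs c))))"
  proof -
    have "(\<Sum>a\<in>obs ` C. \<Sum>u\<in>U. q a u * h a (snd (\<phi> u)) u)
        = (\<Sum>a\<in>obs ` C. \<Sum>c\<in>{c\<in>C. obs c = a}. \<Sum>u\<in>U. w c * q a u * k c (?D1 \<phi> (\<phi> u) (b1 c)) (?D2 \<phi> (\<phi> u) (b2 c)))"
      unfolding h_def sum_distrib_left
      by (intro sum.cong refl, subst sum.swap) (simp add: mult.assoc mult.left_commute)
    moreover have "(\<Sum>a\<in>obs ` C. H a * bin_bias U F (\<lambda>u. snd (\<phi> u)) (q a))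
        = (\<Sum>a\<in>obs ` C. \<Sum>c\<in>{c\<in>C. obs c = a}. dm * (w c * bin_bias U F (\<lambda>u. snd (\<phi> u)) (q a)))"
      unfolding H_def sum_distrib_right by (simp add: mult.assoc mult.left_commute)
    ultimately show ?thesis
      using fc(3) unfolding hsum grp' by simp
  qed
  also have "(\<Sum>c\<in>C. \<Sum>u\<in>U. w c * q (obs c) u * k c (?D1 \<phi> (\<phi> u) (b1 c)) (?D2 \<phi> (\<phi> u) (b2 c)))
      \<le> (\<Sum>c\<in>C. \<Sum>u\<in>U. w c * q (obs c) u * k c u u
          + dm * (w c * q (obs c) u * of_bool (?D1 \<phi> (\<phi> u) (b1 c) \<noteq> u))
          + dm * (w c * q (obs c) u * of_bool (?D2 \<phi> (\<phi> u) (b2 c) \<noteq> u)))"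
  proof (intro sum_mono)
    fix c u assume "c \<in> C" "u \<in> U"
    let ?u1 = "?D1 \<phi> (\<phi> u) (b1 c)" and ?u2 = "?D2 \<phi> (\<phi> u) (b2 c)"
    have "k c ?u1 ?u2 \<le> k c u u + dm * of_bool (?u1 \<noteq> u) + dm * of_bool (?u2 \<noteq> u)"
      using k[of c ?u1 ?u2] k[of c u u] dm by (auto simp: of_bool_def)
    then have "w c * q (obs c) u * k c ?u1 ?u2 \<le> w c * q (obs c) u * (k c u u + dm * of_bool (?u1 \<noteq> u) + dm * of_bool (?u2 \<noteq> u))"
      using w q \<open>c \<in> C\<close> by (intro mult_left_mono) auto
    then show "w c * q (obs c) u * k c ?u1 ?u2 \<le> w c * q (obs c) u * k c u u
          + dm * (w c * q (obs c) u * of_bool (?u1 \<noteq> u)) + dm * (w c * q (obs c) u * of_bool (?u2 \<noteq> u))"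
      by (simp add: algebra_simps)
  qed
  also have "(\<Sum>c\<in>C. \<Sum>u\<in>U. w c * q (obs c) u * k c u u
          + dm * (w c * q (obs c) u * of_bool (?D1 \<phi> (\<phi> u) (b1 c) \<noteq> u))
          + dm * (w c * q (obs c) u * of_bool (?D2 \<phi> (\<phi> u) (b2 c) \<noteq> u)))
        + (\<Sum>c\<in>C. dm * (w c * bin_bias U F (\<lambda>u. snd (\<phi> u)) (q (obs c))))
      = (\<Sum>c\<in>C. \<Sum>u\<in>U. w c * q (obs c) u * k c u u) + dm * err \<phi>"
    unfolding err_def by (simp add: sum.distrib sum_distrib_left distrib_left)
  also have "dm * err \<phi> \<le> dm * bound"
    using dm \<phi>(2) by (rule mult_left_mono[rotated])
  finally have "(\<Sum>c\<in>C. w c * k c (dec1 (enc (obs c)) (b1 c)) (dec2 (enc (obs c)) (b2 c)))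
      \<le> (\<Sum>c\<in>C. \<Sum>u\<in>U. w c * q (obs c) u * k c u u) + dm * bound"
    by simp
  then show ?thesis
    unfolding bound_def using encM by blast
qed

text \<open>Two layers of \<open>binning_code\<close>. The V layer is built first, for an ideal U
  known to encoder and decoder. The U layer then takes the distortion of that finished code as its
  cost, with separate copies of U recovered from X at the encoder and from Z at the decoder. V is
  decoded in one place only, so the two decoders of its layer get the same score; hence the factor 2
  at \<open>sv\<close>.\<close>

lemma one_shot_code:
  fixes p :: "'x \<Rightarrow> 'y \<Rightarrow> 'z \<Rightarrow> real" and q :: "'y \<Rightarrow> 'u \<Rightarrow> real" and r :: "'x \<Rightarrow> 'u \<Rightarrow> 'v \<Rightarrow> real"
    and sx :: "'u \<Rightarrow> 'x \<Rightarrow> real" and sz :: "'u \<Rightarrow> 'z \<Rightarrow> real" and sv :: "'v \<Rightarrow> 'z \<times> 'u \<Rightarrow> real"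
    and \<rho> :: "'x \<Rightarrow> 'w \<Rightarrow> real" and rec :: "'u \<Rightarrow> 'v \<Rightarrow> 'z \<Rightarrow> 'w"
    and F F' :: nat and \<tau> \<tau>' \<theta> \<theta>' dm :: real
  assumes fin: "finite X" "finite Y" "finite Z" "finite U" "finite V"
    and M: "finite Ms" "Ms \<noteq> {}" "finite Ms'" "Ms' \<noteq> {}" "F > 0" "F' > 0"
    and par: "\<tau> \<ge> 0" "\<tau>' \<ge> 0" "\<theta> > 0" "\<theta>' > 0"
    and p: "\<And>x y z. p x y z \<ge> 0" "(\<Sum>x\<in>X. \<Sum>y\<in>Y. \<Sum>z\<in>Z. p x y z) = 1"
    and q: "\<And>y u. q y u \<ge> 0" "\<And>y. (\<Sum>u\<in>U. q y u) = 1"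
    and r: "\<And>x u v. r x u v \<ge> 0" "\<And>x u. (\<Sum>v\<in>V. r x u v) = 1"
    and sx: "\<And>u x. sx u x \<ge> 0" "\<And>x. (\<Sum>u\<in>U. sx u x) \<le> 1"
    and sz: "\<And>u z. sz u z \<ge> 0" "\<And>z. (\<Sum>u\<in>U. sz u z) \<le> 1"
    and sv: "\<And>v b. sv v b \<ge> 0" "\<And>b. (\<Sum>v\<in>V. sv v b) \<le> 1"
    and \<rho>: "\<And>x a. 0 \<le> \<rho> x a" "\<And>x a. \<rho> x a \<le> dm"
  defines "E \<equiv> (\<lambda>G. \<Sum>x\<in>X. \<Sum>y\<in>Y. \<Sum>z\<in>Z. \<Sum>u\<in>U. \<Sum>v\<in>V. p x y z * q y u * r x u v * G x y z u v)"
  shows "\<exists>f1 f g. (\<forall>y. f1 y \<in> Ms) \<and> (\<forall>x t. f x t \<in> Ms') \<and>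
    (\<Sum>x\<in>X. \<Sum>y\<in>Y. \<Sum>z\<in>Z. p x y z * \<rho> x (g (f x (f1 y)) (f1 y) z))
    \<le> E (\<lambda>x y z u v. \<rho> x (rec u v z))
      + dm * (2 * E (\<lambda>x y z u v. of_bool (q y u > \<tau>)) + sqrt ((real F - 1) * \<tau>)
        + E (\<lambda>x y z u v. of_bool (sx u x < \<theta>)) + E (\<lambda>x y z u v. of_bool (sz u z < \<theta>)) + 2 / (card Ms * F * \<theta>)
        + (2 * E (\<lambda>x y z u v. of_bool (r x u v > \<tau>')) + sqrt ((real F' - 1) * \<tau>')
        + 2 * E (\<lambda>x y z u v. of_bool (sv v (z, u) < \<theta>')) + 2 / (card Ms' * F' * \<theta>')))"
proof -
  let ?C4 = "X \<times> Y \<times> Z \<times> U" and ?C3 = "X \<times> Y \<times> Z"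
  define w4 where "w4 = (\<lambda>(x, y, z, u). p x y z * q y u)"
  define w3 where "w3 = (\<lambda>(x, y, z). p x y z)"
  have E4: "(\<Sum>c\<in>?C4. \<Sum>v\<in>V. w4 c * (case c of (x, y, z, u) \<Rightarrow> r x u v * G x y z u v)) = E G" for G
    unfolding E_def by (simp add: sum_Times w4_def mult.assoc case_prod_unfold)
  have E3: "E (\<lambda>x y z u v. G x y z u) = (\<Sum>c\<in>?C3. \<Sum>u\<in>U. w3 c * (case c of (x, y, z) \<Rightarrow> q y u * G x y z u))" for G
  proof -
    have "(\<Sum>v\<in>V. p x y z * q y u * r x u v * G x y z u) = p x y z * q y u * G x y z u" for x y z u
      using r(2)[of x u] by (simp add: sum_distrib_right[symmetric] sum_distrib_left[symmetric])
    then show ?thesis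
      unfolding E_def by (simp add: sum_Times w3_def mult.assoc case_prod_unfold)
  qed
  have w3: "w3 c \<ge> 0" "sum w3 ?C3 = 1" for c
    using p by (auto simp: w3_def sum_Times case_prod_unfold)
  have w4: "w4 c \<ge> 0" "sum w4 ?C4 = 1" for c
    using p q by (auto simp: w4_def sum_Times sum_distrib_left[symmetric] case_prod_unfold)
  define k4 where "k4 = (\<lambda>(x, y::'y, z, u) (v1::'v) v2. \<rho> x (rec u v2 z))"
  note code4 = binning_code[where C = "?C4" and U = V and Ms = Ms' and F = F' and \<tau> = \<tau>' and \<theta> = \<theta>'
      and w = w4 and q = "\<lambda>(x, u). r x u" and ?s1.0 = sv and ?s2.0 = sv and k = k4 and dm = dm
      and obs = "\<lambda>(x, y, z, u). (x, u)" and ?b1.0 = "\<lambda>(x, y, z, u). (z, u)" and ?b2.0 = "\<lambda>(x, y, z, u). (z, u)"]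
  obtain enc' dec' where V: "\<forall>a. enc' a \<in> Ms'"
    "(\<Sum>c\<in>?C4. w4 c * (case c of (x, y, z, u) \<Rightarrow> \<rho> x (rec u (dec' (enc' (x, u)) (z, u)) z)))
    \<le> E (\<lambda>x y z u v. \<rho> x (rec u v z))
      + dm * (2 * E (\<lambda>x y z u v. of_bool (r x u v > \<tau>')) + sqrt ((real F' - 1) * \<tau>')
        + E (\<lambda>x y z u v. of_bool (sv v (z, u) < \<theta>')) + E (\<lambda>x y z u v. of_bool (sv v (z, u) < \<theta>'))
        + 2 / (card Ms' * F' * \<theta>'))"
    using code4 fin M par w4 r sv \<rho> unfolding E4[symmetric]
    by (auto simp: case_prod_unfold mult.assoc k4_def)
  \<comment> \<open>\<open>u1\<close> is the encoder's copy of U and determines the message;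
    \<open>u2\<close> is the decoder's copy, used to decode V and to reconstruct.\<close>
  define k where "k = (\<lambda>(x, y::'y, z) u1 u2. \<rho> x (rec u2 (dec' (enc' (x, u1)) (z, u2)) z))"
  note code3 = binning_code[where C = "?C3" and U = U and Ms = Ms and F = F and \<tau> = \<tau> and \<theta> = \<theta>
      and w = w3 and q = q and ?s1.0 = sx and ?s2.0 = sz and k = k and dm = dm
      and obs = "\<lambda>c. fst (snd c)" and ?b1.0 = fst and ?b2.0 = "\<lambda>c. snd (snd c)"]
  obtain enc dec1 dec2 where U: "\<forall>a. enc a \<in> Ms"
    "(\<Sum>c\<in>?C3. w3 c * k c (dec1 (enc (fst (snd c))) (fst c)) (dec2 (enc (fst (snd c))) (snd (snd c))))
    \<le> (\<Sum>c\<in>?C3. \<Sum>u\<in>U. w3 c * q (fst (snd c)) u * k c u u)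
      + dm * (2 * E (\<lambda>x y z u v. of_bool (q y u > \<tau>)) + sqrt ((real F - 1) * \<tau>)
        + E (\<lambda>x y z u v. of_bool (sx u x < \<theta>)) + E (\<lambda>x y z u v. of_bool (sz u z < \<theta>))
        + 2 / (card Ms * F * \<theta>))"
    using code3 fin M par w3 q sx sz \<rho> unfolding E3
    by (auto simp: case_prod_unfold mult.assoc k_def)
  \<comment> \<open>When both copies are correct, the U layer costs exactly what the V layer costs
    with an ideal U.\<close>
  have mid: "(\<Sum>c\<in>?C3. \<Sum>u\<in>U. w3 c * q (fst (snd c)) u * k c u u)
      = (\<Sum>c\<in>?C4. w4 c * (case c of (x, y, z, u) \<Rightarrow> \<rho> x (rec u (dec' (enc' (x, u)) (z, u)) z)))"
    by (simp add: sum_Times w3_def w4_def k_def case_prod_unfold)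
  have fin_eq: "(\<Sum>c\<in>?C3. w3 c * k c (dec1 (enc (fst (snd c))) (fst c)) (dec2 (enc (fst (snd c))) (snd (snd c))))
      = (\<Sum>x\<in>X. \<Sum>y\<in>Y. \<Sum>z\<in>Z. p x y z * \<rho> x (rec (dec2 (enc y) z) (dec' (enc' (x, dec1 (enc y) x)) (z, dec2 (enc y) z)) z))"
    by (simp add: sum_Times w3_def k_def case_prod_unfold)
  show ?thesis
  proof (rule exI[of _ enc], rule exI[of _ "\<lambda>x t. enc' (x, dec1 t x)"],
      rule exI[of _ "\<lambda>t' t z. rec (dec2 t z) (dec' t' (z, dec2 t z)) z"], intro conjI)
    show "(\<Sum>x\<in>X. \<Sum>y\<in>Y. \<Sum>z\<in>Z. p x y z * \<rho> x (rec (dec2 (enc y) z) (dec' (enc' (x, dec1 (enc y) x)) (z, dec2 (enc y) z)) z))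
    \<le> E (\<lambda>x y z u v. \<rho> x (rec u v z))
      + dm * (2 * E (\<lambda>x y z u v. of_bool (q y u > \<tau>)) + sqrt ((real F - 1) * \<tau>)
        + E (\<lambda>x y z u v. of_bool (sx u x < \<theta>)) + E (\<lambda>x y z u v. of_bool (sz u z < \<theta>)) + 2 / (card Ms * F * \<theta>)
        + (2 * E (\<lambda>x y z u v. of_bool (r x u v > \<tau>')) + sqrt ((real F' - 1) * \<tau>')
        + 2 * E (\<lambda>x y z u v. of_bool (sv v (z, u) < \<theta>')) + 2 / (card Ms' * F' * \<theta>')))"
      using U(2) V(2) unfolding mid fin_eq by (simp add: algebra_simps)
  qed (use U(1) V(1) in auto)
qed

section \<open>Achievability\<close>

definition cprob :: "'w set \<Rightarrow> ('w \<Rightarrow> real) \<Rightarrow> ('w \<Rightarrow> 'a) \<Rightarrow> ('w \<Rightarrow> 'c) \<Rightarrow> 'a \<Rightarrow> 'c \<Rightarrow> real" where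
  "cprob S P A C a c = mass S P (\<lambda>w. (A w, C w)) (a, c) / mass S P C c"

lemma cprob_nonneg: "(\<And>w. w \<in> S \<Longrightarrow> P w \<ge> 0) \<Longrightarrow> cprob S P A C a c \<ge> 0"
  unfolding cprob_def by (intro divide_nonneg_nonneg mass_nonneg)

text \<open>At a value c of mass 0 the quotients are 0, so the sum is 0 there rather than 1.\<close>

lemma sum_cprob_le_1:
  assumes "finite S" "finite T" "A ` S \<subseteq> T"
  shows "(\<Sum>a\<in>T. cprob S P A C a c) \<le> 1"
  unfolding cprob_def sum_divide_distrib[symmetric] sum_mass_pair[OF assms] by simp

lemma cprob_pos:
  assumes "finite S" "\<And>w. w \<in> S \<Longrightarrow> P w \<ge> 0" "w \<in> S" "P w > 0"
  shows "cprob S P A C (A w) (C w) > 0"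
  unfolding cprob_def
  using mass_pos[of S P w "\<lambda>w. (A w, C w)", OF assms] mass_pos[of S P w C, OF assms] by simp

lemma card_msgs_ge:
  assumes "R \<ge> 0"
  shows "real (card (msgs n R)) \<ge> 2 powr (real n * R) / 2" "msgs n R \<noteq> {}"
proof -
  have ge: "2 powr (real n * R) \<ge> 1" using assms by (simp add: ge_one_powr_ge_zero)
  have "real (card (msgs n R)) = \<lfloor>2 powr (real n * R)\<rfloor>"
    using ge by (simp add: msgs_def of_nat_nat)
  moreover have "real_of_int \<lfloor>2 powr (real n * R)\<rfloor> \<ge> 1"
    using ge by simp
  ultimately show c: "real (card (msgs n R)) \<ge> 2 powr (real n * R) / 2"
    by linarith
  have "real (card (msgs n R)) > 0"
    using c ge by linarith
  then show "msgs n R \<noteq> {}" by auto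
qed

lemma finite_msgs [simp]: "finite (msgs n R)"
  by (simp add: msgs_def)

text \<open>The slack of 4 \<open>\<delta>\<close> is spent as follows: the exponent of the number
  of bins stays 2 \<open>\<delta>\<close> below H, the threshold lies a factor with exponent
  \<open>\<delta>\<close> below the typical score, and the last \<open>\<delta>\<close> makes the
  error decay. Adding 1 keeps \<open>F\<close> positive whatever the sign of H - 2
  \<open>\<delta>\<close>, at no cost, because the bias bound contains F - 1.\<close>

lemma binning_rate_bounds:
  fixes n :: nat and H H' \<delta> R :: real
  assumes "R \<ge> 0" "R \<ge> H' - H + 4 * \<delta>"
  defines "F \<equiv> nat \<lfloor>2 powr (n * (H - 2 * \<delta>))\<rfloor> + 1"
  shows "sqrt ((real F - 1) * 2 powr (- (n * (H - \<delta>)))) \<le> sqrt (2 powr (- (n * \<delta>)))"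
    and "2 / (card (msgs n R) * F * 2 powr (- (n * (H' + \<delta>)))) \<le> 4 * 2 powr (- (n * \<delta>))"
proof -
  have F: "real F - 1 \<le> 2 powr (n * (H - 2 * \<delta>))" "real F \<ge> 2 powr (n * (H - 2 * \<delta>))"
    by (auto simp: F_def of_nat_nat) linarith
  have "(real F - 1) * 2 powr (- (n * (H - \<delta>))) \<le> 2 powr (n * (H - 2 * \<delta>)) * 2 powr (- (n * (H - \<delta>)))"
    using F by (intro mult_right_mono) auto
  also have "\<dots> = 2 powr (- (n * \<delta>))"
    by (simp add: powr_add[symmetric] algebra_simps)
  finally show "sqrt ((real F - 1) * 2 powr (- (n * (H - \<delta>)))) \<le> sqrt (2 powr (- (n * \<delta>)))"
    by simp
  have "2 powr (n * \<delta>) / 2 \<le> 2 powr (n * (R + (H - 2 * \<delta>) - (H' + \<delta>))) / 2"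
    using assms(2) by (intro divide_right_mono powr_mono mult_left_mono) auto
  also have "\<dots> = 2 powr (n * R) / 2 * 2 powr (n * (H - 2 * \<delta>)) * 2 powr (- (n * (H' + \<delta>)))"
    by (simp add: powr_add[symmetric] algebra_simps)
  also have "\<dots> \<le> card (msgs n R) * F * 2 powr (- (n * (H' + \<delta>)))"
    unfolding of_nat_mult using F card_msgs_ge[OF assms(1), of n] by (intro mult_right_mono mult_mono) auto
  finally have ge: "2 powr (n * \<delta>) / 2 \<le> card (msgs n R) * F * 2 powr (- (n * (H' + \<delta>)))" .
  have pos: "card (msgs n R) * F * 2 powr (- (n * (H' + \<delta>))) > 0"
    by (rule order_less_le_trans[OF _ ge]) simp
  have "2 / (card (msgs n R) * F * 2 powr (- (n * (H' + \<delta>)))) \<le> 2 / (2 powr (n * \<delta>) / 2)"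
    by (rule divide_left_mono[OF ge]) (simp, rule mult_pos_pos[OF pos], simp)
  also have "\<dots> = 4 * 2 powr (- (n * \<delta>))"
    unfolding powr_minus_divide by simp
  finally show "2 / (card (msgs n R) * F * 2 powr (- (n * (H' + \<delta>)))) \<le> 4 * 2 powr (- (n * \<delta>))" .
qed

section \<open>The source, test channels and their single-letter informations\<close>

locale source =
  fixes pZY :: "'z::finite \<Rightarrow> 'y::finite \<Rightarrow> real" and pXgZ :: "'z \<Rightarrow> 'x::finite \<Rightarrow> real"
  assumes pZY_nonneg: "pZY z y \<ge> 0" and pZY_sum: "(\<Sum>z\<in>UNIV. \<Sum>y\<in>UNIV. pZY z y) = 1"
    and pXgZ_nonneg: "pXgZ z x \<ge> 0" and pXgZ_sum: "(\<Sum>x\<in>UNIV. pXgZ z x) = 1"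

context source
begin

definition p3 :: "'x \<times> 'y \<times> 'z \<Rightarrow> real" where "p3 = (\<lambda>(x, y, z). pZY z y * pXgZ z x)"

lemma p3_nonneg: "p3 q \<ge> 0"
  by (cases q) (simp add: p3_def pZY_nonneg pXgZ_nonneg)

lemma sum_p3: "sum p3 UNIV = 1"
proof -
  have "sum p3 UNIV = (\<Sum>x\<in>UNIV. \<Sum>y\<in>UNIV. \<Sum>z\<in>UNIV. pZY z y * pXgZ z x)"
    unfolding UNIV_Times_UNIV[symmetric] sum_Times by (simp add: p3_def)
  also have "\<dots> = (\<Sum>z\<in>UNIV. \<Sum>y\<in>UNIV. \<Sum>x\<in>UNIV. pZY z y * pXgZ z x)"
    by (subst sum.swap[of _ UNIV UNIV], subst sum.swap[of _ "UNIV::'z set"], intro sum.cong refl, rule sum.swap)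
  finally show ?thesis
    by (simp add: sum_distrib_left[symmetric] pXgZ_sum pZY_sum)
qed

end

locale test_channel = source pZY pXgZ
  for pZY :: "'z::finite \<Rightarrow> 'y::finite \<Rightarrow> real" and pXgZ :: "'z \<Rightarrow> 'x::finite \<Rightarrow> real" +
  fixes SU SV :: "nat set" and qU :: "'y \<Rightarrow> nat \<Rightarrow> real" and qV :: "'x \<Rightarrow> nat \<Rightarrow> nat \<Rightarrow> real"
  assumes fin: "finite SU" "finite SV"
    and qU_nonneg: "qU y u \<ge> 0" and qU_sum: "(\<Sum>u\<in>SU. qU y u) = 1"
    and qV_nonneg: "qV x u v \<ge> 0" and qV_sum: "(\<Sum>v\<in>SV. qV x u v) = 1"
begin

abbreviation S :: "('x \<times> 'y \<times> 'z \<times> nat \<times> nat) set" where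
  "S \<equiv> UNIV \<times> UNIV \<times> UNIV \<times> SU \<times> SV"

abbreviation P :: "'x \<times> 'y \<times> 'z \<times> nat \<times> nat \<Rightarrow> real" where
  "P \<equiv> joint5 pZY pXgZ qU qV"

abbreviation cX :: "'x \<times> 'y \<times> 'z \<times> nat \<times> nat \<Rightarrow> 'x" where "cX \<equiv> \<lambda>(x, y, z, u, v). x"
abbreviation cY :: "'x \<times> 'y \<times> 'z \<times> nat \<times> nat \<Rightarrow> 'y" where "cY \<equiv> \<lambda>(x, y, z, u, v). y"
abbreviation cZ :: "'x \<times> 'y \<times> 'z \<times> nat \<times> nat \<Rightarrow> 'z" where "cZ \<equiv> \<lambda>(x, y, z, u, v). z"
abbreviation cU :: "'x \<times> 'y \<times> 'z \<times> nat \<times> nat \<Rightarrow> nat" where "cU \<equiv> \<lambda>(x, y, z, u, v). u"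
abbreviation cV :: "'x \<times> 'y \<times> 'z \<times> nat \<times> nat \<Rightarrow> nat" where "cV \<equiv> \<lambda>(x, y, z, u, v). v"
abbreviation cUZ :: "'x \<times> 'y \<times> 'z \<times> nat \<times> nat \<Rightarrow> nat \<times> 'z" where "cUZ \<equiv> \<lambda>(x, y, z, u, v). (u, z)"

lemma finite_S: "finite S"
  using fin by simp

lemma P_nonneg: "P w \<ge> 0"
  by (cases w) (simp add: joint5_def pZY_nonneg pXgZ_nonneg qU_nonneg qV_nonneg)

lemma sum_P: "sum P S = 1"
proof -
  have "sum P S = (\<Sum>x\<in>UNIV. \<Sum>y\<in>UNIV. \<Sum>z\<in>UNIV. pZY z y * pXgZ z x)"
    by (simp add: sum_Times joint5_def sum_distrib_left[symmetric] qU_sum qV_sum)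
  also have "\<dots> = sum p3 UNIV"
    unfolding UNIV_Times_UNIV[symmetric] sum_Times by (simp add: p3_def)
  finally show ?thesis by (simp add: sum_p3)
qed

text \<open>U is drawn from Y alone, so given (Y, X) it still has the law \<open>qU\<close>: the
  Markov chain U - Y - X.\<close>

lemma mass_UYX:
  assumes "u \<in> SU"
  shows "mass S P (\<lambda>w. (cU w, cY w, cX w)) (u, y, x) = qU y u * mass S P (\<lambda>w. (cY w, cX w)) (y, x)"
proof -
  have "mass S P (\<lambda>w. (cU w, cY w, cX w)) (u, y, x) = (\<Sum>(z, v)\<in>UNIV \<times> SV. P (x, y, z, u, v))"
    unfolding mass_def using assms
    by (intro sum.reindex_bij_witness[of _ "\<lambda>(z, v). (x, y, z, u, v)" "\<lambda>(x, y, z, u, v). (z, v)"]) auto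
  moreover have "mass S P (\<lambda>w. (cY w, cX w)) (y, x) = (\<Sum>(z, u, v)\<in>UNIV \<times> SU \<times> SV. P (x, y, z, u, v))"
    unfolding mass_def
    by (intro sum.reindex_bij_witness[of _ "\<lambda>(z, u, v). (x, y, z, u, v)" "\<lambda>(x, y, z, u, v). (z, u, v)"]) auto
  ultimately show ?thesis
    by (simp add: sum_Times joint5_def sum_distrib_left[symmetric] qU_sum qV_sum sum_distrib_right[symmetric])
qed

text \<open>The Markov chain U - Z - X: \<open>pXgZ\<close> depends on z only and can be taken out
  of the sum over y. Here Y - Z - X enters the direct part. Written without quotients because masses
  may vanish.\<close>

lemma mass_UZX:
  assumes "u \<in> SU"
  shows "mass S P (\<lambda>w. (cU w, cZ w, cX w)) (u, z, x) * mass S P cZ z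
    = mass S P (\<lambda>w. (cU w, cZ w)) (u, z) * mass S P (\<lambda>w. (cZ w, cX w)) (z, x)"
proof -
  have "mass S P (\<lambda>w. (cU w, cZ w, cX w)) (u, z, x) = (\<Sum>(y, v)\<in>UNIV \<times> SV. P (x, y, z, u, v))"
    unfolding mass_def using assms
    by (intro sum.reindex_bij_witness[of _ "\<lambda>(y, v). (x, y, z, u, v)" "\<lambda>(x, y, z, u, v). (y, v)"]) auto
  also have "\<dots> = pXgZ z x * (\<Sum>y\<in>UNIV. pZY z y * qU y u)"
    by (simp add: sum_Times joint5_def sum_distrib_left[symmetric] qV_sum) (simp add: sum_distrib_left ac_simps)
  finally have 1: "mass S P (\<lambda>w. (cU w, cZ w, cX w)) (u, z, x) = pXgZ z x * (\<Sum>y\<in>UNIV. pZY z y * qU y u)" .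
  have "mass S P cZ z = (\<Sum>(y, x, u, v)\<in>UNIV \<times> UNIV \<times> SU \<times> SV. P (x, y, z, u, v))"
    unfolding mass_def
    by (intro sum.reindex_bij_witness[of _ "\<lambda>(y, x, u, v). (x, y, z, u, v)" "\<lambda>(x, y, z, u, v). (y, x, u, v)"]) auto
  also have "\<dots> = (\<Sum>y\<in>UNIV. pZY z y)"
    by (simp add: sum_Times joint5_def sum_distrib_left[symmetric] qU_sum qV_sum pXgZ_sum)
  finally have 2: "mass S P cZ z = (\<Sum>y\<in>UNIV. pZY z y)" .
  have "mass S P (\<lambda>w. (cU w, cZ w)) (u, z) = (\<Sum>(y, x, v)\<in>UNIV \<times> UNIV \<times> SV. P (x, y, z, u, v))"
    unfolding mass_def using assms
    by (intro sum.reindex_bij_witness[of _ "\<lambda>(y, x, v). (x, y, z, u, v)" "\<lambda>(x, y, z, u, v). (y, x, v)"]) auto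
  also have "\<dots> = (\<Sum>y\<in>UNIV. pZY z y * qU y u)"
    by (simp add: sum_Times joint5_def sum_distrib_left[symmetric] qV_sum)
      (simp add: sum_distrib_left[symmetric] sum_distrib_right[symmetric] pXgZ_sum)
  finally have 3: "mass S P (\<lambda>w. (cU w, cZ w)) (u, z) = (\<Sum>y\<in>UNIV. pZY z y * qU y u)" .
  have "mass S P (\<lambda>w. (cZ w, cX w)) (z, x) = (\<Sum>(y, u, v)\<in>UNIV \<times> SU \<times> SV. P (x, y, z, u, v))"
    unfolding mass_def
    by (intro sum.reindex_bij_witness[of _ "\<lambda>(y, u, v). (x, y, z, u, v)" "\<lambda>(x, y, z, u, v). (y, u, v)"]) auto
  also have "\<dots> = (\<Sum>y\<in>UNIV. pZY z y) * pXgZ z x"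
    by (simp add: sum_Times joint5_def sum_distrib_left[symmetric] qU_sum qV_sum sum_distrib_right[symmetric])
  finally have 4: "mass S P (\<lambda>w. (cZ w, cX w)) (z, x) = (\<Sum>y\<in>UNIV. pZY z y) * pXgZ z x" .
  show ?thesis unfolding 1 2 3 4 by simp
qed

lemma mass_XVUZ:
  assumes "u \<in> SU" "v \<in> SV"
  shows "mass S P (\<lambda>w. (cX w, cV w, cUZ w)) (x, v, u, z) = qV x u v * mass S P (\<lambda>w. (cX w, cUZ w)) (x, u, z)"
proof -
  have "mass S P (\<lambda>w. (cX w, cV w, cUZ w)) (x, v, u, z) = (\<Sum>y\<in>UNIV. P (x, y, z, u, v))"
    unfolding mass_def using assms
    by (intro sum.reindex_bij_witness[of _ "\<lambda>y. (x, y, z, u, v)" "\<lambda>(x, y, z, u, v). y"]) auto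
  moreover have "mass S P (\<lambda>w. (cX w, cUZ w)) (x, u, z) = (\<Sum>(y, v)\<in>UNIV \<times> SV. P (x, y, z, u, v))"
    unfolding mass_def using assms
    by (intro sum.reindex_bij_witness[of _ "\<lambda>(y, v). (x, y, z, u, v)" "\<lambda>(x, y, z, u, v). (y, v)"]) auto
  ultimately show ?thesis
    by (simp add: sum_Times joint5_def sum_distrib_left[symmetric] qV_sum sum_distrib_right[symmetric])
qed

text \<open>The five constants are H(U | Y), H(U | X), H(U | Z), H(V | X, U) and H(V | U, Z). Where
  a channel is given it replaces the quotient of masses, because \<open>one_shot_code\<close>
  compares the channel itself with its threshold.\<close>

definition HUY :: real where "HUY = - (\<Sum>w\<in>S. P w * log 2 (qU (cY w) (cU w)))"
definition HUX :: real where "HUX = - (\<Sum>w\<in>S. P w * log 2 (cprob S P cU cX (cU w) (cX w)))"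
definition HUZ :: real where "HUZ = - (\<Sum>w\<in>S. P w * log 2 (cprob S P cU cZ (cU w) (cZ w)))"
definition HVXU :: real where "HVXU = - (\<Sum>w\<in>S. P w * log 2 (qV (cX w) (cU w) (cV w)))"
definition HVUZ :: real where "HVUZ = - (\<Sum>w\<in>S. P w * log 2 (cprob S P cV cUZ (cV w) (cUZ w)))"

text \<open>Lets \<open>r\<close> stand for the law of A given (B, C) wherever \<open>P\<close> is
  positive, so that the informations become differences of the entropies above.\<close>

lemma cond_mi_eq_log_ratio:
  assumes "\<And>w. w \<in> S \<Longrightarrow> P w > 0 \<Longrightarrow>
      mass S P (\<lambda>w. (A w, B w, C w)) (A w, B w, C w) / mass S P (\<lambda>w. (B w, C w)) (B w, C w) = r w"
  shows "cond_mi S P A B C = - (\<Sum>w\<in>S. P w * log 2 (cprob S P A C (A w) (C w))) + (\<Sum>w\<in>S. P w * log 2 (r w))"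
proof -
  have "cond_mi S P A B C = (\<Sum>w\<in>S. P w * log 2 (r w) - P w * log 2 (cprob S P A C (A w) (C w)))"
    unfolding cond_mi_def
  proof (rule sum.cong[OF refl])
    fix w assume w: "w \<in> S"
    let ?abc = "mass S P (\<lambda>w. (A w, B w, C w)) (A w, B w, C w)" and ?ac = "mass S P (\<lambda>w. (A w, C w)) (A w, C w)"
    let ?bc = "mass S P (\<lambda>w. (B w, C w)) (B w, C w)" and ?c = "mass S P C (C w)"
    have "P w * log 2 (?abc * ?c / (?ac * ?bc)) = P w * log 2 (r w) - P w * log 2 (cprob S P A C (A w) (C w))"
    proof (cases "P w = 0")
      case False
      then have "P w > 0" using P_nonneg[of w] by simp
      note pos = mass_pos[of S P w, OF finite_S P_nonneg w this]
      have "?abc > 0" "?ac > 0" "?bc > 0" "?c > 0"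
        using pos[of "\<lambda>w. (A w, B w, C w)"] pos[of "\<lambda>w. (A w, C w)"] pos[of "\<lambda>w. (B w, C w)"] pos[of C] by auto
      then show ?thesis
        unfolding assms[OF w \<open>P w > 0\<close>, symmetric] cprob_def
        by (simp add: log_mult log_divide algebra_simps)
    qed simp
    then show "P w * log 2
         ((\<Sum>w'\<in>{w'\<in>S. A w' = A w \<and> B w' = B w \<and> C w' = C w}. P w') * (\<Sum>w'\<in>{w'\<in>S. C w' = C w}. P w') /
          ((\<Sum>w'\<in>{w'\<in>S. A w' = A w \<and> C w' = C w}. P w') * (\<Sum>w'\<in>{w'\<in>S. B w' = B w \<and> C w' = C w}. P w')))
        = P w * log 2 (r w) - P w * log 2 (cprob S P A C (A w) (C w))"
      by (simp add: mass_def)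
  qed
  then show ?thesis by (simp add: sum_subtractf)
qed

lemma cond_mi_UYX: "cond_mi S P cU cY cX = HUX - HUY"
proof -
  have "cond_mi S P cU cY cX = - (\<Sum>w\<in>S. P w * log 2 (cprob S P cU cX (cU w) (cX w)))
      + (\<Sum>w\<in>S. P w * log 2 (qU (cY w) (cU w)))"
  proof (rule cond_mi_eq_log_ratio)
    fix w assume w: "w \<in> S" "P w > 0"
    obtain x y z u v where xyz: "w = (x, y, z, u, v)" by (cases w)
    have "mass S P (\<lambda>w. (cY w, cX w)) (y, x) > 0"
      using mass_pos[of S P w "\<lambda>w. (cY w, cX w)", OF finite_S P_nonneg w] by (simp add: xyz)
    then show "mass S P (\<lambda>w. (cU w, cY w, cX w)) (cU w, cY w, cX w) / mass S P (\<lambda>w. (cY w, cX w)) (cY w, cX w)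
        = qU (cY w) (cU w)"
      using mass_UYX[of u y x] w by (simp add: xyz)
  qed
  then show ?thesis by (simp add: HUX_def HUY_def)
qed

text \<open>Given Z, U is independent of X, so H(U | X) - H(U | Z) is I(U; Z | X), which is
  nonnegative. Hence labels sized for the encoder, which sees X, also suffice for the decoder, which
  sees Z.\<close>

lemma HUZ_le_HUX: "HUZ \<le> HUX"
proof -
  have "cond_mi S P cU cZ cX = - (\<Sum>w\<in>S. P w * log 2 (cprob S P cU cX (cU w) (cX w)))
      + (\<Sum>w\<in>S. P w * log 2 (cprob S P cU cZ (cU w) (cZ w)))"
  proof (rule cond_mi_eq_log_ratio)
    fix w assume w: "w \<in> S" "P w > 0"
    obtain x y z u v where xyz: "w = (x, y, z, u, v)" by (cases w)
    have "mass S P (\<lambda>w. (cZ w, cX w)) (z, x) > 0" "mass S P cZ z > 0"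
      using mass_pos[of S P w "\<lambda>w. (cZ w, cX w)", OF finite_S P_nonneg w]
        mass_pos[of S P w cZ, OF finite_S P_nonneg w] by (simp_all add: xyz)
    then show "mass S P (\<lambda>w. (cU w, cZ w, cX w)) (cU w, cZ w, cX w) / mass S P (\<lambda>w. (cZ w, cX w)) (cZ w, cX w)
        = cprob S P cU cZ (cU w) (cZ w)"
      using mass_UZX[of u z x] w by (simp add: xyz cprob_def field_simps)
  qed
  then show ?thesis
    using cond_mi_nonneg[of S P cU cZ cX, OF finite_S P_nonneg] by (simp add: HUX_def HUZ_def)
qed

lemma cond_mi_commute: "cond_mi T Q A B C = cond_mi T Q B A C"
  unfolding cond_mi_def by (simp add: conj_commute conj_left_commute mult.commute)

lemma cond_mi_XVUZ: "cond_mi S P cX cV cUZ = HVUZ - HVXU"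
proof -
  have "cond_mi S P cV cX cUZ = - (\<Sum>w\<in>S. P w * log 2 (cprob S P cV cUZ (cV w) (cUZ w)))
      + (\<Sum>w\<in>S. P w * log 2 (qV (cX w) (cU w) (cV w)))"
  proof (rule cond_mi_eq_log_ratio)
    fix w assume w: "w \<in> S" "P w > 0"
    obtain x y z u v where xyz: "w = (x, y, z, u, v)" by (cases w)
    have "mass S P (\<lambda>w. (cX w, cUZ w)) (x, u, z) > 0"
      using mass_pos[of S P w "\<lambda>w. (cX w, cUZ w)", OF finite_S P_nonneg w] by (simp add: xyz)
    moreover have "mass S P (\<lambda>w. (cV w, cX w, cUZ w)) (v, x, u, z) = mass S P (\<lambda>w. (cX w, cV w, cUZ w)) (x, v, u, z)"
      unfolding mass_def by (intro sum.cong) auto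
    ultimately show "mass S P (\<lambda>w. (cV w, cX w, cUZ w)) (cV w, cX w, cUZ w) / mass S P (\<lambda>w. (cX w, cUZ w)) (cX w, cUZ w)
        = qV (cX w) (cU w) (cV w)"
      using mass_XVUZ[of u v x z] w by (simp add: xyz)
  qed
  then show ?thesis
    by (subst cond_mi_commute) (simp add: HVUZ_def HVXU_def)
qed

end

section \<open>Block codes from a test channel\<close>

context test_channel
begin

lemma sum_cprob_U: "(\<Sum>u\<in>SU. cprob S P cU C u c) \<le> 1"
  by (rule sum_cprob_le_1) (use fin in auto)

lemma sum_cprob_V: "(\<Sum>v\<in>SV. cprob S P cV C v c) \<le> 1"
  by (rule sum_cprob_le_1) (use fin in auto)

text \<open>\<open>one_shot_code\<close> on sequences, with product laws as scores.
  \<open>T H r\<close> is the probability that the product of \<open>r\<close> leaves the typical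
  window around 2^(-n H). It bounds each threshold event; what remains is controlled by the choice
  of the numbers of bins.\<close>

lemma block_code:
  fixes d :: "'x \<Rightarrow> 'xh \<Rightarrow> real" and xhat :: "nat \<Rightarrow> nat \<Rightarrow> 'z \<Rightarrow> 'xh" and n :: nat and R R1 \<delta> dm :: real
  assumes n: "n > 0" and R: "R \<ge> 0" "R \<ge> HVUZ - HVXU + 4 * \<delta>" and R1: "R1 \<ge> 0" "R1 \<ge> HUX - HUY + 4 * \<delta>"
    and d: "\<And>x a. 0 \<le> d x a" "\<And>x a. d x a \<le> dm"
  defines "T \<equiv> (\<lambda>H r. \<Sum>ws\<in>PiE {..<n} (\<lambda>_. S). (\<Prod>k<n. P (ws k)) *
      of_bool (\<not> (2 powr (- (real n * (H + \<delta>))) \<le> (\<Prod>i<n. r (ws i)) \<and> (\<Prod>i<n. r (ws i)) \<le> 2 powr (- (real n * (H - \<delta>))))))"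
  shows "\<exists>f1 f g. (\<forall>ys. f1 ys \<in> msgs n R1) \<and> (\<forall>xs t. f xs t \<in> msgs n R) \<and>
    (\<Sum>xs\<in>Seq n. \<Sum>ys\<in>Seq n. \<Sum>zs\<in>Seq n. (\<Prod>i<n. pZY (zs i) (ys i) * pXgZ (zs i) (xs i)) *
        ((1 / real n) * (\<Sum>i<n. d (xs i) (g (f xs (f1 ys)) (f1 ys) zs i))))
    \<le> (\<Sum>w\<in>S. P w * (case w of (x, y, z, u, v) \<Rightarrow> d x (xhat u v z)))
      + dm * (2 * T HUY (\<lambda>w. qU (cY w) (cU w)) + T HUX (\<lambda>w. cprob S P cU cX (cU w) (cX w))
        + T HUZ (\<lambda>w. cprob S P cU cZ (cU w) (cZ w)) + 2 * T HVXU (\<lambda>w. qV (cX w) (cU w) (cV w))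
        + 2 * T HVUZ (\<lambda>w. cprob S P cV cUZ (cV w) (cUZ w))
        + 2 * sqrt (2 powr (- (n * \<delta>))) + 8 * 2 powr (- (n * \<delta>)))"
proof -
  let ?U = "PiE {..<n} (\<lambda>_. SU)" and ?V = "PiE {..<n} (\<lambda>_. SV)"
  define p where "p = (\<lambda>(xs :: nat \<Rightarrow> 'x) (ys :: nat \<Rightarrow> 'y) (zs :: nat \<Rightarrow> 'z). \<Prod>i<n. pZY (zs i) (ys i) * pXgZ (zs i) (xs i))"
  define q where "q = (\<lambda>ys us. \<Prod>i<n. qU (ys i) (us i))"
  define r where "r = (\<lambda>xs us vs. \<Prod>i<n. qV (xs i) (us i) (vs i))"
  define sx where "sx = (\<lambda>us xs. \<Prod>i<n. cprob S P cU cX (us i) (xs i))"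
  define sz where "sz = (\<lambda>us zs. \<Prod>i<n. cprob S P cU cZ (us i) (zs i))"
  \<comment> \<open>The pair is swapped: the score in \<open>one_shot_code\<close> takes (z, u),
    while \<open>cUZ\<close> yields (u, z).\<close>
  define sv where "sv = (\<lambda>vs (zs, us). \<Prod>i<n. cprob S P cV cUZ (vs i) (us i, zs i))"
  define \<rho> where "\<rho> = (\<lambda>xs as. (1 / real n) * (\<Sum>i<n. d (xs i) (as i)))"
  define rec where "rec = (\<lambda>us vs zs (i::nat). xhat (us i) (vs i) (zs i))"
  define F where "F = nat \<lfloor>2 powr (n * (HUY - 2 * \<delta>))\<rfloor> + 1"
  define F' where "F' = nat \<lfloor>2 powr (n * (HVXU - 2 * \<delta>))\<rfloor> + 1"
  define E where "E = (\<lambda>G. \<Sum>xs\<in>Seq n. \<Sum>ys\<in>Seq n. \<Sum>zs\<in>Seq n. \<Sum>us\<in>?U. \<Sum>vs\<in>?V.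
      p xs ys zs * q ys us * r xs us vs * (G xs ys zs us vs :: real))"
  have dm: "dm \<ge> 0" using d order_trans by blast
  have E_zip: "E (\<lambda>xs ys zs us vs. G (\<lambda>i\<in>{..<n}. (xs i, ys i, zs i, us i, vs i))) =
      (\<Sum>ws\<in>PiE {..<n} (\<lambda>_. S). (\<Prod>k<n. P (ws k)) * G ws)" for G
  proof -
    have "p xs ys zs * q ys us * r xs us vs = (\<Prod>k<n. P ((\<lambda>i\<in>{..<n}. (xs i, ys i, zs i, us i, vs i)) k))" for xs ys zs us vs
      by (simp add: p_def q_def r_def joint5_def prod.distrib)
    then show ?thesis
      unfolding E_def by (simp only: sum_PiE_zip5[where F = "\<lambda>ws. (\<Prod>k<n. P (ws k)) * G ws"])
  qed
  have P_prod: "(\<Prod>k<n. P (ws k)) \<ge> 0" for ws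
    using P_nonneg by (intro prod_nonneg) auto
  have bound: "E (\<lambda>xs ys zs us vs. of_bool (A (\<Prod>i<n. s (xs i, ys i, zs i, us i, vs i)))) \<le> T H s"
    if A: "\<And>t. A t \<Longrightarrow> \<not> (2 powr (- (real n * (H + \<delta>))) \<le> t \<and> t \<le> 2 powr (- (real n * (H - \<delta>))))" for A s H
  proof -
    have "E (\<lambda>xs ys zs us vs. of_bool (A (\<Prod>i<n. s (xs i, ys i, zs i, us i, vs i)))) =
        (\<Sum>ws\<in>PiE {..<n} (\<lambda>_. S). (\<Prod>k<n. P (ws k)) * of_bool (A (\<Prod>i<n. s (ws i))))"
      using E_zip[of "\<lambda>ws. of_bool (A (\<Prod>i<n. s (ws i)))"] by simp
    also have "\<dots> \<le> T H s"
      unfolding T_def using A by (intro sum_mono mult_left_mono P_prod) (auto simp: of_bool_def)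
    finally show ?thesis .
  qed
  have fin_seqs: "finite (Seq n :: (nat \<Rightarrow> 'x) set)" "finite (Seq n :: (nat \<Rightarrow> 'y) set)" "finite (Seq n :: (nat \<Rightarrow> 'z) set)"
    "finite ?U" "finite ?V"
    using fin by (auto intro!: finite_PiE)
  have sum_p: "(\<Sum>xs\<in>Seq n. \<Sum>ys\<in>Seq n. \<Sum>zs\<in>Seq n. p xs ys zs) = 1"
  proof -
    have "(\<Sum>xs\<in>Seq n. \<Sum>ys\<in>Seq n. \<Sum>zs\<in>Seq n. p xs ys zs) = (\<Sum>ws\<in>PiE {..<n} (\<lambda>_. UNIV \<times> UNIV \<times> UNIV). \<Prod>k<n. p3 (ws k))"
      unfolding p_def sum_PiE_zip3[symmetric] by (simp add: p3_def)
    also have "\<dots> = 1"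
      by (rule iid_total) (simp_all add: sum_p3)
    finally show ?thesis .
  qed
  have sum_q: "(\<Sum>us\<in>?U. q ys us) = 1" for ys
    unfolding q_def using fin qU_sum by (subst prod_sum_PiE[symmetric]) auto
  have sum_r: "(\<Sum>vs\<in>?V. r xs us vs) = 1" for xs us
    unfolding r_def using fin qV_sum by (subst prod_sum_PiE[symmetric]) auto
  have sum_sx: "(\<Sum>us\<in>?U. sx us xs) \<le> 1" for xs
    unfolding sx_def using fin
    by (subst prod_sum_PiE[symmetric]) (auto intro!: prod_le_1 sum_nonneg cprob_nonneg P_nonneg sum_cprob_U)
  have sum_sz: "(\<Sum>us\<in>?U. sz us zs) \<le> 1" for zs
    unfolding sz_def using fin
    by (subst prod_sum_PiE[symmetric]) (auto intro!: prod_le_1 sum_nonneg cprob_nonneg P_nonneg sum_cprob_U)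
  have sum_sv: "(\<Sum>vs\<in>?V. sv vs b) \<le> 1" for b
    unfolding sv_def using fin
    by (cases b, simp, subst prod_sum_PiE[symmetric]) (auto intro!: prod_le_1 sum_nonneg cprob_nonneg P_nonneg sum_cprob_V)
  have le_dm: "\<rho> xs as \<le> dm" for xs as
  proof -
    have "(\<Sum>i<n. d (xs i) (as i)) \<le> (\<Sum>i<n. dm)" using d by (intro sum_mono) auto
    then show ?thesis using n by (simp add: \<rho>_def field_simps)
  qed
  have p_nonneg: "p xs ys zs \<ge> 0" for xs ys zs
    unfolding p_def by (intro prod_nonneg mult_nonneg_nonneg ballI pZY_nonneg pXgZ_nonneg)
  have q_nonneg: "q ys us \<ge> 0" for ys us
    unfolding q_def by (intro prod_nonneg ballI qU_nonneg)
  have r_nonneg: "r xs us vs \<ge> 0" for xs us vs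
    unfolding r_def by (intro prod_nonneg ballI qV_nonneg)
  have sx_nonneg: "sx us xs \<ge> 0" for us xs
    unfolding sx_def by (intro prod_nonneg ballI cprob_nonneg P_nonneg)
  have sz_nonneg: "sz us zs \<ge> 0" for us zs
    unfolding sz_def by (intro prod_nonneg ballI cprob_nonneg P_nonneg)
  have sv_nonneg: "sv vs b \<ge> 0" for vs b
    unfolding sv_def by (cases b) (auto intro!: prod_nonneg cprob_nonneg P_nonneg)
  have rho_nonneg: "\<rho> xs as \<ge> 0" for xs as
    unfolding \<rho>_def using d by (intro mult_nonneg_nonneg sum_nonneg) auto
  have msgs_ne: "msgs n R1 \<noteq> {}" "msgs n R \<noteq> {}"
    by (intro card_msgs_ge R R1)+
  have params_pos: "F > 0" "F' > 0" "2 powr t \<ge> (0::real)" "2 powr t > (0::real)" for t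
    by (simp_all add: F_def F'_def)
  have ex: "\<exists>f1 f g. (\<forall>y. f1 y \<in> msgs n R1) \<and> (\<forall>x t. f x t \<in> msgs n R) \<and>
    (\<Sum>x\<in>Seq n. \<Sum>y\<in>Seq n. \<Sum>z\<in>Seq n. p x y z * \<rho> x (g (f x (f1 y)) (f1 y) z))
    \<le> E (\<lambda>x y z u v. \<rho> x (rec u v z))
      + dm * (2 * E (\<lambda>x y z u v. of_bool (q y u > 2 powr (- (n * (HUY - \<delta>))))) + sqrt ((real F - 1) * 2 powr (- (n * (HUY - \<delta>))))
        + E (\<lambda>x y z u v. of_bool (sx u x < 2 powr (- (n * (HUX + \<delta>)))))
        + E (\<lambda>x y z u v. of_bool (sz u z < 2 powr (- (n * (HUX + \<delta>))))) + 2 / (card (msgs n R1) * F * 2 powr (- (n * (HUX + \<delta>))))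
        + (2 * E (\<lambda>x y z u v. of_bool (r x u v > 2 powr (- (n * (HVXU - \<delta>))))) + sqrt ((real F' - 1) * 2 powr (- (n * (HVXU - \<delta>))))
        + 2 * E (\<lambda>x y z u v. of_bool (sv v (z, u) < 2 powr (- (n * (HVUZ + \<delta>))))) + 2 / (card (msgs n R) * F' * 2 powr (- (n * (HVUZ + \<delta>))))))"
    unfolding E_def
    by (rule one_shot_code[where p = p and q = q and r = r and sx = sx and sz = sz and sv = sv and \<rho> = \<rho> and rec = rec
          and X = "Seq n" and Y = "Seq n" and Z = "Seq n" and U = ?U and V = ?V and F = F and F' = F' and dm = dm
          and Ms = "msgs n R1" and Ms' = "msgs n R" and \<tau> = "2 powr (- (n * (HUY - \<delta>)))" and \<theta> = "2 powr (- (n * (HUX + \<delta>)))"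
          and \<tau>' = "2 powr (- (n * (HVXU - \<delta>)))" and \<theta>' = "2 powr (- (n * (HVUZ + \<delta>)))"])
      (fact params_pos fin_seqs sum_p sum_q sum_r sum_sx sum_sz sum_sv le_dm p_nonneg q_nonneg r_nonneg sx_nonneg sz_nonneg sv_nonneg rho_nonneg msgs_ne finite_msgs)+
  have ED: "E (\<lambda>x y z u v. \<rho> x (rec u v z)) = (\<Sum>w\<in>S. P w * (case w of (x, y, z, u, v) \<Rightarrow> d x (xhat u v z)))"
  proof -
    let ?g = "\<lambda>(x, y, z, u, v). d x (xhat u v z)"
    have "E (\<lambda>x y z u v. \<rho> x (rec u v z)) = (\<Sum>ws\<in>PiE {..<n} (\<lambda>_. S). (\<Prod>k<n. P (ws k)) * ((1 / real n) * (\<Sum>i<n. ?g (ws i))))"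
      using E_zip[of "\<lambda>ws. (1 / real n) * (\<Sum>i<n. ?g (ws i))"] by (simp add: \<rho>_def rec_def)
    also have "\<dots> = (1 / real n) * (\<Sum>i<n. \<Sum>ws\<in>PiE {..<n} (\<lambda>_. S). (\<Prod>k<n. P (ws k)) * ?g (ws i))"
      unfolding sum_distrib_left by (subst sum.swap) (simp only: ac_simps)
    also have "\<dots> = (1 / real n) * (\<Sum>i<n. \<Sum>w\<in>S. P w * ?g w)"
      using iid_expectation[OF finite_lessThan finite_S sum_P, of _ n ?g] by simp
    finally show ?thesis using n by simp
  qed
  have bq: "E (\<lambda>x y z u v. of_bool (q y u > 2 powr (- (n * (HUY - \<delta>))))) \<le> T HUY (\<lambda>w. qU (cY w) (cU w))"
    unfolding q_def using bound[of "\<lambda>t. t > 2 powr (- (n * (HUY - \<delta>)))" HUY "\<lambda>w. qU (cY w) (cU w)"] by simp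
  have bsx: "E (\<lambda>x y z u v. of_bool (sx u x < 2 powr (- (n * (HUX + \<delta>))))) \<le> T HUX (\<lambda>w. cprob S P cU cX (cU w) (cX w))"
    unfolding sx_def using bound[of "\<lambda>t. t < 2 powr (- (n * (HUX + \<delta>)))" HUX "\<lambda>w. cprob S P cU cX (cU w) (cX w)"] by simp
  \<comment> \<open>The threshold is set by \<open>HUX\<close>. As \<open>HUZ\<close> is not larger,
    it lies at or below the lower end of the typical window for Z.\<close>
  have bsz: "E (\<lambda>x y z u v. of_bool (sz u z < 2 powr (- (n * (HUX + \<delta>))))) \<le> T HUZ (\<lambda>w. cprob S P cU cZ (cU w) (cZ w))"
  proof -
    have "2 powr (- (n * (HUX + \<delta>))) \<le> 2 powr (- (n * (HUZ + \<delta>)))"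
      using HUZ_le_HUX by (intro powr_mono) (auto intro: mult_left_mono)
    then have "\<not> (2 powr (- (real n * (HUZ + \<delta>))) \<le> t \<and> t \<le> 2 powr (- (real n * (HUZ - \<delta>))))"
      if "t < 2 powr (- (n * (HUX + \<delta>)))" for t
      using that by linarith
    from bound[OF this, where s = "\<lambda>w. cprob S P cU cZ (cU w) (cZ w)"] show ?thesis
      unfolding sz_def by simp
  qed
  have br: "E (\<lambda>x y z u v. of_bool (r x u v > 2 powr (- (n * (HVXU - \<delta>))))) \<le> T HVXU (\<lambda>w. qV (cX w) (cU w) (cV w))"
    unfolding r_def using bound[of "\<lambda>t. t > 2 powr (- (n * (HVXU - \<delta>)))" HVXU "\<lambda>w. qV (cX w) (cU w) (cV w)"] by simp
  have bsv: "E (\<lambda>x y z u v. of_bool (sv v (z, u) < 2 powr (- (n * (HVUZ + \<delta>))))) \<le> T HVUZ (\<lambda>w. cprob S P cV cUZ (cV w) (cUZ w))"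
    unfolding sv_def using bound[of "\<lambda>t. t < 2 powr (- (n * (HVUZ + \<delta>)))" HVUZ "\<lambda>w. cprob S P cV cUZ (cV w) (cUZ w)"] by simp
  note rate = binning_rate_bounds[OF R1, of n, folded F_def] binning_rate_bounds[OF R, of n, folded F'_def]
  obtain f1 f g where code: "\<forall>y. f1 y \<in> msgs n R1" "\<forall>x t. f x t \<in> msgs n R"
    "(\<Sum>x\<in>Seq n. \<Sum>y\<in>Seq n. \<Sum>z\<in>Seq n. p x y z * \<rho> x (g (f x (f1 y)) (f1 y) z))
    \<le> (\<Sum>w\<in>S. P w * (case w of (x, y, z, u, v) \<Rightarrow> d x (xhat u v z)))
      + dm * (2 * E (\<lambda>x y z u v. of_bool (q y u > 2 powr (- (n * (HUY - \<delta>))))) + sqrt ((real F - 1) * 2 powr (- (n * (HUY - \<delta>))))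
        + E (\<lambda>x y z u v. of_bool (sx u x < 2 powr (- (n * (HUX + \<delta>)))))
        + E (\<lambda>x y z u v. of_bool (sz u z < 2 powr (- (n * (HUX + \<delta>))))) + 2 / (card (msgs n R1) * F * 2 powr (- (n * (HUX + \<delta>))))
        + (2 * E (\<lambda>x y z u v. of_bool (r x u v > 2 powr (- (n * (HVXU - \<delta>))))) + sqrt ((real F' - 1) * 2 powr (- (n * (HVXU - \<delta>))))
        + 2 * E (\<lambda>x y z u v. of_bool (sv v (z, u) < 2 powr (- (n * (HVUZ + \<delta>))))) + 2 / (card (msgs n R) * F' * 2 powr (- (n * (HVUZ + \<delta>))))))"
    (is "_ \<le> ?D + dm * ?err")
    using ex unfolding ED by (elim exE conjE) (rule that)
  have "?err \<le> 2 * T HUY (\<lambda>w. qU (cY w) (cU w)) + T HUX (\<lambda>w. cprob S P cU cX (cU w) (cX w))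
        + T HUZ (\<lambda>w. cprob S P cU cZ (cU w) (cZ w)) + 2 * T HVXU (\<lambda>w. qV (cX w) (cU w) (cV w))
        + 2 * T HVUZ (\<lambda>w. cprob S P cV cUZ (cV w) (cUZ w))
        + 2 * sqrt (2 powr (- (n * \<delta>))) + 8 * 2 powr (- (n * \<delta>))" (is "_ \<le> ?bd")
    using rate bq bsx bsz br bsv by linarith
  then have "dm * ?err \<le> dm * ?bd"
    using dm by (rule mult_left_mono)
  then have "(\<Sum>x\<in>Seq n. \<Sum>y\<in>Seq n. \<Sum>z\<in>Seq n. p x y z * \<rho> x (g (f x (f1 y)) (f1 y) z)) \<le> ?D + dm * ?bd"
    using code(3) by linarith
  then show ?thesis
    using code(1,2) unfolding p_def \<rho>_def by (intro exI[of _ f1] exI[of _ f] exI[of _ g] conjI)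
qed

end

context source
begin

lemma achievability:
  fixes d :: "'x \<Rightarrow> 'xh::finite \<Rightarrow> real" and R R1 D \<delta> :: real
  assumes d: "\<And>x a. d x a \<ge> 0" and sl: "(R, R1) \<in> sl_region pZY pXgZ d D" and \<delta>: "\<delta> > 0"
  shows "achievable pZY pXgZ d D (R + 4 * \<delta>) (R1 + 4 * \<delta>)"
proof -
  from sl obtain SU SV qU qV xhat where ch: "finite SU" "finite SV" "\<forall>y u. qU y u \<ge> 0" "\<forall>y. (\<Sum>u\<in>SU. qU y u) = 1"
      "\<forall>x u v. qV x u v \<ge> 0" "\<forall>x u. (\<Sum>v\<in>SV. qV x u v) = 1"
    and rates: "R1 \<ge> cond_mi (UNIV \<times> UNIV \<times> UNIV \<times> SU \<times> SV) (joint5 pZY pXgZ qU qV)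
        (\<lambda>(x,y,z,u,v). u) (\<lambda>(x,y,z,u,v). y) (\<lambda>(x,y,z,u,v). x)"
      "R \<ge> cond_mi (UNIV \<times> UNIV \<times> UNIV \<times> SU \<times> SV) (joint5 pZY pXgZ qU qV)
        (\<lambda>(x,y,z,u,v). x) (\<lambda>(x,y,z,u,v). v) (\<lambda>(x,y,z,u,v). (u, z))"
    and dist: "(\<Sum>w\<in>UNIV \<times> UNIV \<times> UNIV \<times> SU \<times> SV. joint5 pZY pXgZ qU qV w *
        (case w of (x,y,z,u,v) \<Rightarrow> d x (xhat u v z))) \<le> D"
    unfolding sl_region_def Let_def by blast
  interpret test_channel pZY pXgZ SU SV qU qV
    by unfold_locales (use ch in auto)
  \<comment> \<open>Informations are nonnegative, hence so are the rates; this keeps the message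
    sets nonempty.\<close>
  have R: "R \<ge> HVUZ - HVXU" "R \<ge> 0" and R1: "R1 \<ge> HUX - HUY" "R1 \<ge> 0"
    using rates cond_mi_UYX cond_mi_XVUZ cond_mi_nonneg[of S P cU cY cX, OF finite_S P_nonneg]
      cond_mi_nonneg[of S P cX cV cUZ, OF finite_S P_nonneg] by linarith+
  define dm where "dm = (\<Sum>x\<in>UNIV. \<Sum>a\<in>UNIV. d x a)"
  have dm: "d x a \<le> dm" for x a
  proof -
    have "d x a \<le> (\<Sum>a\<in>UNIV. d x a)" using d by (intro member_le_sum) auto
    also have "\<dots> \<le> dm" unfolding dm_def using d by (intro member_le_sum[of x]) (auto intro: sum_nonneg)
    finally show ?thesis .
  qed
  define T where "T = (\<lambda>H r (n::nat). \<Sum>ws\<in>PiE {..<n} (\<lambda>_. S). (\<Prod>k<n. P (ws k)) *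
      of_bool (\<not> (2 powr (- (real n * (H + \<delta>))) \<le> (\<Prod>i<n. r (ws i)) \<and> (\<Prod>i<n. r (ws i)) \<le> 2 powr (- (real n * (H - \<delta>))))))"
  define err where "err = (\<lambda>n. dm * (2 * T HUY (\<lambda>w. qU (cY w) (cU w)) n + T HUX (\<lambda>w. cprob S P cU cX (cU w) (cX w)) n
        + T HUZ (\<lambda>w. cprob S P cU cZ (cU w) (cZ w)) n + 2 * T HVXU (\<lambda>w. qV (cX w) (cU w) (cV w)) n
        + 2 * T HVUZ (\<lambda>w. cprob S P cV cUZ (cV w) (cUZ w)) n
        + 2 * sqrt (2 powr (- (real n * \<delta>))) + 8 * 2 powr (- (real n * \<delta>))))"
  note dev = iid_log_prod_deviation[of S P \<delta>, OF finite_S P_nonneg sum_P \<delta>]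
  note cpos = cprob_pos[of S P, OF finite_S P_nonneg]
  have posU: "qU (cY w) (cU w) > 0" and posV: "qV (cX w) (cU w) (cV w) > 0" if "P w > 0" for w
    using that qU_nonneg qV_nonneg pZY_nonneg pXgZ_nonneg
    by (cases w, auto simp: joint5_def zero_less_mult_iff order_less_le)+
  have pw: "(\<lambda>n. 2 powr (- (real n * \<delta>))) \<longlonglongrightarrow> 0"
    using \<delta> by real_asymp
  have "err \<longlonglongrightarrow> dm * (2 * 0 + 0 + 0 + 2 * 0 + 2 * 0 + 2 * sqrt 0 + 8 * 0)"
    unfolding err_def T_def HUY_def HUX_def HUZ_def HVXU_def HVUZ_def
    by (intro tendsto_intros dev pw posU posV cpos)
  then have "err \<longlonglongrightarrow> 0" by simp
  show ?thesis
    unfolding achievable_def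
  proof (intro allI impI)
    fix \<epsilon> :: real assume "\<epsilon> > 0"
    with \<open>err \<longlonglongrightarrow> 0\<close> have "\<forall>\<^sub>F n in sequentially. err n < \<epsilon>"
      by (rule order_tendstoD)
    then obtain N where N: "\<And>n. n \<ge> N \<Longrightarrow> err n < \<epsilon>"
      unfolding eventually_sequentially by blast
    show "\<exists>N. \<forall>n\<ge>N. \<exists>(f1 :: (nat \<Rightarrow> 'y) \<Rightarrow> nat) (f :: (nat \<Rightarrow> 'x) \<Rightarrow> nat \<Rightarrow> nat) (g :: nat \<Rightarrow> nat \<Rightarrow> (nat \<Rightarrow> 'z) \<Rightarrow> nat \<Rightarrow> 'xh).
       (\<forall>ys\<in>Seq n. f1 ys \<in> msgs n (R1 + 4 * \<delta>)) \<and>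
       (\<forall>xs\<in>Seq n. \<forall>t1\<in>msgs n (R1 + 4 * \<delta>). f xs t1 \<in> msgs n (R + 4 * \<delta>)) \<and>
       (\<Sum>xs\<in>Seq n. \<Sum>ys\<in>Seq n. \<Sum>zs\<in>Seq n.
          (\<Prod>i<n. pZY (zs i) (ys i) * pXgZ (zs i) (xs i)) *
          ((1 / real n) * (\<Sum>i<n. d (xs i) (g (f xs (f1 ys)) (f1 ys) zs i)))) \<le> D + \<epsilon>"
    \<comment> \<open>\<open>Suc N\<close> instead of \<open>N\<close> excludes block length
      0.\<close>
    proof (rule exI[of _ "Suc N"], intro allI impI)
      fix n assume n: "n \<ge> Suc N"
      have "\<exists>f1 f g. (\<forall>ys. f1 ys \<in> msgs n (R1 + 4 * \<delta>)) \<and> (\<forall>xs t. f xs t \<in> msgs n (R + 4 * \<delta>)) \<and>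
        (\<Sum>xs\<in>Seq n. \<Sum>ys\<in>Seq n. \<Sum>zs\<in>Seq n. (\<Prod>i<n. pZY (zs i) (ys i) * pXgZ (zs i) (xs i)) *
            ((1 / real n) * (\<Sum>i<n. d (xs i) (g (f xs (f1 ys)) (f1 ys) zs i))))
        \<le> (\<Sum>w\<in>S. P w * (case w of (x, y, z, u, v) \<Rightarrow> d x (xhat u v z))) + err n"
        unfolding err_def T_def
        by (rule block_code) (use n R R1 \<delta> d dm in auto)
      then obtain f1 f g where code: "\<forall>ys. f1 ys \<in> msgs n (R1 + 4 * \<delta>)" "\<forall>xs t. f xs t \<in> msgs n (R + 4 * \<delta>)"
        "(\<Sum>xs\<in>Seq n. \<Sum>ys\<in>Seq n. \<Sum>zs\<in>Seq n. (\<Prod>i<n. pZY (zs i) (ys i) * pXgZ (zs i) (xs i)) *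
            ((1 / real n) * (\<Sum>i<n. d (xs i) (g (f xs (f1 ys)) (f1 ys) zs i))))
        \<le> (\<Sum>w\<in>S. P w * (case w of (x, y, z, u, v) \<Rightarrow> d x (xhat u v z))) + err n"
        by blast
      have "err n < \<epsilon>" using N n by simp
      then show "\<exists>f1 f g. (\<forall>ys\<in>Seq n. f1 ys \<in> msgs n (R1 + 4 * \<delta>)) \<and>
         (\<forall>xs\<in>Seq n. \<forall>t1\<in>msgs n (R1 + 4 * \<delta>). f xs t1 \<in> msgs n (R + 4 * \<delta>)) \<and>
         (\<Sum>xs\<in>Seq n. \<Sum>ys\<in>Seq n. \<Sum>zs\<in>Seq n.
            (\<Prod>i<n. pZY (zs i) (ys i) * pXgZ (zs i) (xs i)) *
            ((1 / real n) * (\<Sum>i<n. d (xs i) (g (f xs (f1 ys)) (f1 ys) zs i)))) \<le> D + \<epsilon>"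
        using code dist by (intro exI[of _ f1] exI[of _ f] exI[of _ g] conjI) auto
    qed
  qed
qed

end

section \<open>Profiles of test channels\<close>

text \<open>The following functionals of an unnormalised measure are homogeneous of degree one, so that mixing over
  the values of \<open>U\<close> becomes addition.\<close>

definition entYZ_X :: "('x \<times> 'y \<times> 'z \<times> 'v \<Rightarrow> real) \<Rightarrow> real" where
  "entYZ_X m = ent UNIV m (\<lambda>(x, y, z, v). ((y, z), x)) - ent UNIV m (\<lambda>(x, y, z, v). x)"

definition miXV_Z :: "('x \<times> 'y \<times> 'z \<times> 'v \<Rightarrow> real) \<Rightarrow> real" where
  "miXV_Z m = ent UNIV m (\<lambda>(x, y, z, v). (x, z)) + ent UNIV m (\<lambda>(x, y, z, v). (v, z))
    - ent UNIV m (\<lambda>(x, y, z, v). (x, v, z)) - ent UNIV m (\<lambda>(x, y, z, v). z)"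

definition exp_dist :: "('x \<Rightarrow> 'xh \<Rightarrow> real) \<Rightarrow> ('x \<times> 'y \<times> 'z \<times> ('z \<Rightarrow> 'xh) \<Rightarrow> real) \<Rightarrow> real" where
  "exp_dist d m = (\<Sum>(x, y, z, v)\<in>UNIV. m (x, y, z, v) * d x (v z))"

lemma ent_scale_diff:
  fixes m :: "'w::finite \<Rightarrow> real"
  assumes "\<And>w. m w \<ge> 0" "c \<ge> 0"
  shows "ent UNIV (\<lambda>w. c * m w) A - ent UNIV (\<lambda>w. c * m w) B = c * (ent UNIV m A - ent UNIV m B)"
proof (cases "c = 0")
  case False
  then show ?thesis
    using assms ent_scale[of UNIV m c A] ent_scale[of UNIV m c B] by (simp add: algebra_simps)
qed (simp add: ent_def)

lemma homogeneous:
  fixes m :: "'x::finite \<times> 'y::finite \<times> 'z::finite \<times> 'v::finite \<Rightarrow> real"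
  assumes "\<And>w. m w \<ge> 0" "c \<ge> 0"
  shows "entYZ_X (\<lambda>w. c * m w) = c * entYZ_X m" "miXV_Z (\<lambda>w. c * m w) = c * miXV_Z m"
proof -
  note sd = ent_scale_diff[of m c, OF assms]
  show "entYZ_X (\<lambda>w. c * m w) = c * entYZ_X m"
    unfolding entYZ_X_def by (rule sd)
  show "miXV_Z (\<lambda>w. c * m w) = c * miXV_Z m"
    unfolding miXV_Z_def
    using sd[of "\<lambda>(x, y, z, v). (x, z)" "\<lambda>(x, y, z, v). (x, v, z)"] sd[of "\<lambda>(x, y, z, v). (v, z)" "\<lambda>(x, y, z, v). z"]
    by (simp add: algebra_simps)
qed

lemma exp_dist_scale: "exp_dist d (\<lambda>w. c * m w) = c * exp_dist d m"
  by (simp add: exp_dist_def sum_distrib_left case_prod_unfold mult.assoc)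

text \<open>\<open>M u\<close> is the unnormalised law of Q on the event U = u. It is used twice:
  for a test channel built from a mixture, and for a block code at a fixed time.\<close>

lemma ent_pair_eq_sum_fibers:
  fixes Q :: "'w \<Rightarrow> 'q::finite"
  assumes "finite \<Omega>" "finite K" "U ` \<Omega> \<subseteq> K"
    and "\<And>q u. u \<in> K \<Longrightarrow> mass \<Omega> Pr (\<lambda>w. (Q w, U w)) (q, u) = M u q"
  shows "ent \<Omega> Pr (\<lambda>w. (A (Q w), U w)) = (\<Sum>u\<in>K. ent UNIV (M u) A)"
proof -
  have "ent \<Omega> Pr (\<lambda>w. (A (Q w), U w)) = ent \<Omega> Pr (\<lambda>w. (\<lambda>(q, u). (A q, u)) (Q w, U w))"
    by simp
  also have "\<dots> = ent (UNIV \<times> K) (\<lambda>(q, u). M u q) (\<lambda>(q, u). (A q, u))"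
    by (rule ent_comp) (use assms in auto)
  also have "\<dots> = (\<Sum>u\<in>K. ent UNIV (M u) A)"
    using ent_fiber[of UNIV K "\<lambda>(q, u). M u q" A] assms(2) by simp
  finally show ?thesis .
qed

text \<open>One value u of U is described by the law \<open>\<pi>\<close> of Y given u and by the
  channel \<open>W\<close> from X to V at that u. Vectors take the place of functions for the sake
  of the Euclidean topology.\<close>

definition weight_set :: "((real^'y) \<times> (real^('x::finite \<times> 'v::finite))) set" where
  "weight_set = {(\<pi>, W). (\<forall>y. 0 \<le> \<pi> $ y) \<and> (\<Sum>y\<in>UNIV. \<pi> $ y) = 1 \<and>
     (\<forall>x v. 0 \<le> W $ (x, v)) \<and> (\<forall>x. (\<Sum>v\<in>UNIV. W $ (x, v)) = 1)}"

lemma compact_weight_set: "compact (weight_set :: ((real^'y::finite) \<times> (real^('x::finite \<times> 'v::finite))) set)"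
proof -
  let ?B = "cbox 0 (\<chi> i. 1) \<times> cbox 0 (\<chi> i. 1) :: ((real^'y) \<times> (real^('x \<times> 'v))) set"
  let ?C = "(\<Inter>y. {p :: (real^'y) \<times> (real^('x \<times> 'v)). 0 \<le> fst p $ y}) \<inter> {p. (\<Sum>y\<in>UNIV. fst p $ y) = 1}
     \<inter> (\<Inter>i. {p. 0 \<le> snd p $ i}) \<inter> (\<Inter>x. {p. (\<Sum>v\<in>UNIV. snd p $ (x, v)) = 1})"
  have le1: "f i \<le> 1" if "\<And>j. 0 \<le> f j" "sum f UNIV = 1" for f :: "'a::finite \<Rightarrow> real" and i
    using member_le_sum[of i UNIV f] that by auto
  \<comment> \<open>The unit boxes are implied by the other constraints; they exhibit
    boundedness.\<close>
  have "weight_set = ?B \<inter> ?C"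
  proof (intro set_eqI)
    fix p :: "(real^'y) \<times> (real^('x \<times> 'v))"
    have "fst p $ y \<le> 1" "snd p $ (x, v) \<le> 1" if "p \<in> weight_set" for x y v
      using that le1[of "\<lambda>y. fst p $ y" y] le1[of "\<lambda>v. snd p $ (x, v)" v]
      by (auto simp: weight_set_def case_prod_unfold)
    then show "p \<in> weight_set \<longleftrightarrow> p \<in> ?B \<inter> ?C"
      by (auto simp: weight_set_def case_prod_unfold mem_box_cart mem_Times_iff)
  qed
  moreover have "compact ?B"
    by (intro compact_Times compact_cbox)
  moreover have "closed ?C"
    by (intro closed_Int closed_INT ballI closed_Collect_le closed_Collect_eq continuous_intros)
  ultimately show ?thesis
    using compact_Int_closed by metis
qed

section \<open>Profiles of the source and their convex hull\<close>

context source
begin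

definition pY :: "'y \<Rightarrow> real" where "pY y = (\<Sum>z\<in>UNIV. pZY z y)"

text \<open>The channel from \<open>Y\<close> to \<open>(Z, X)\<close> is that of the source, and zero where \<open>pY y = 0\<close>.\<close>

definition law :: "real^'y \<Rightarrow> real^('x \<times> 'v::finite) \<Rightarrow> 'x \<times> 'y \<times> 'z \<times> 'v \<Rightarrow> real" where
  "law \<pi> W = (\<lambda>(x, y, z, v). \<pi> $ y * (pZY z y / pY y * pXgZ z x) * W $ (x, v))"

text \<open>Every component is homogeneous in \<open>\<pi>\<close> for fixed \<open>W\<close>, so
  weights of a mixture can be moved into \<open>\<pi>\<close>. The first component remembers the law
  of Y, which the mixture has to match.\<close>

definition profile :: "('x \<Rightarrow> 'xh \<Rightarrow> real) \<Rightarrow> (real^'y) \<times> (real^('x \<times> ('z \<Rightarrow> 'xh::finite))) \<Rightarrow> (real^'y) \<times> real \<times> real \<times> real" where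
  "profile d = (\<lambda>(\<pi>, W). (\<pi>, entYZ_X (law \<pi> W), miXV_Z (law \<pi> W), exp_dist d (law \<pi> W)))"

definition profile_hull :: "('x \<Rightarrow> 'xh::finite \<Rightarrow> real) \<Rightarrow> ((real^'y) \<times> real \<times> real \<times> real) set" where
  "profile_hull d = convex hull (profile d ` weight_set)"

lemma pY_nonneg: "pY y \<ge> 0"
  by (simp add: pY_def pZY_nonneg sum_nonneg)

lemma pZY_zero: "pY y = 0 \<Longrightarrow> pZY z y = 0"
  unfolding pY_def using pZY_nonneg by (simp add: sum_nonneg_eq_0_iff)

lemma sum_pY: "(\<Sum>y\<in>UNIV. pY y) = 1"
  unfolding pY_def by (subst sum.swap) (rule pZY_sum)

lemma law_nonneg: "(\<And>y. 0 \<le> \<pi> $ y) \<Longrightarrow> (\<And>i. 0 \<le> W $ i) \<Longrightarrow> law \<pi> W w \<ge> 0"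
  by (cases w) (simp add: law_def pZY_nonneg pXgZ_nonneg pY_nonneg)

lemma law_scale: "law (c *\<^sub>R \<pi>) W = (\<lambda>w. c * law \<pi> W w)"
  by (auto simp: law_def fun_eq_iff mult.assoc)

text \<open>The masses are polynomial in \<open>(\<pi>, W)\<close>, as the quotient by
  \<open>pY\<close> is a constant of the source; \<open>eta\<close> is continuous on the nonnegative
  reals.\<close>

lemma continuous_on_ent_law:
  "continuous_on weight_set (\<lambda>p. ent UNIV (law (fst p) (snd p :: real^('x \<times> 'v::finite))) A)"
proof -
  have "ent UNIV (law (fst p) (snd p)) A = (\<Sum>a\<in>range A. eta (mass UNIV (law (fst p) (snd p)) A a))"
    for p :: "(real^'y) \<times> (real^('x \<times> 'v))"
    by (rule ent_eq_sum_eta) auto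
  moreover have "continuous_on weight_set (\<lambda>p. eta (mass UNIV (law (fst p) (snd p :: real^('x \<times> 'v))) A a))" for a
  proof (rule continuous_on_compose2[OF continuous_on_eta])
    show "continuous_on weight_set (\<lambda>p. mass UNIV (law (fst p) (snd p :: real^('x \<times> 'v))) A a)"
      unfolding mass_def law_def case_prod_unfold by (intro continuous_intros)
    show "(\<lambda>p. mass UNIV (law (fst p) (snd p :: real^('x \<times> 'v))) A a) ` weight_set \<subseteq> {0..}"
      by (auto simp: weight_set_def intro!: mass_nonneg law_nonneg)
  qed
  ultimately show ?thesis
    by (simp add: continuous_on_sum)
qed

lemma compact_hull: "compact (profile_hull d)"
proof -
  have "continuous_on weight_set (\<lambda>p. exp_dist d (law (fst p) (snd p)))"
    unfolding exp_dist_def law_def by (simp add: case_prod_unfold divide_inverse) (intro continuous_intros)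
  then have "continuous_on weight_set (profile d)"
    unfolding profile_def case_prod_unfold entYZ_X_def miXV_Z_def
    by (intro continuous_on_Pair continuous_on_diff continuous_on_add continuous_on_ent_law continuous_on_fst continuous_on_id)
  then show ?thesis
    unfolding profile_hull_def by (intro compact_convex_hull compact_continuous_image compact_weight_set)
qed

lemma profile_scale:
  assumes "\<And>y. 0 \<le> \<pi> $ y" "\<And>i. 0 \<le> W $ i" "c \<ge> 0"
  shows "profile d (c *\<^sub>R \<pi>, W) = c *\<^sub>R profile d (\<pi>, W)"
  using homogeneous[of "law \<pi> W" c, OF law_nonneg[OF assms(1,2)] assms(3)]
  by (simp add: profile_def law_scale exp_dist_scale)

text \<open>By homogeneity each term is its total mass times the profile of the normalised law, and
  the total masses are the weights of a convex combination. Terms of mass 0 cannot be normalised,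
  but their profiles vanish.\<close>

lemma sum_profile_in_hull:
  fixes W :: "'k \<Rightarrow> real^('x \<times> ('z \<Rightarrow> 'xh::finite))"
  assumes "finite K" "\<And>k y. k \<in> K \<Longrightarrow> 0 \<le> \<pi> k $ y" "(\<Sum>k\<in>K. \<Sum>y\<in>UNIV. \<pi> k $ y) = 1"
    and W: "\<And>k i. k \<in> K \<Longrightarrow> 0 \<le> W k $ i" "\<And>k x. k \<in> K \<Longrightarrow> (\<Sum>v\<in>UNIV. W k $ (x, v)) = 1"
  shows "(\<Sum>k\<in>K. profile d (\<pi> k, W k)) \<in> profile_hull d"
proof -
  define l where "l = (\<lambda>k. \<Sum>y\<in>UNIV. \<pi> k $ y)"
  define K' where "K' = {k\<in>K. l k > 0}"
  have l_nonneg: "l k \<ge> 0" if "k \<in> K" for k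
    unfolding l_def using assms(2) that by (intro sum_nonneg) auto
  have scale: "profile d (\<pi> k, W k) = l k *\<^sub>R profile d (inverse (l k) *\<^sub>R \<pi> k, W k)" if "k \<in> K'" for k
    using that profile_scale[of "inverse (l k) *\<^sub>R \<pi> k" "W k" "l k" d] assms(2) W by (auto simp: K'_def)
  have zero: "profile d (\<pi> k, W k) = 0" if "k \<in> K - K'" for k
  proof -
    have "l k = 0" using that l_nonneg[of k] by (auto simp: K'_def)
    then have "\<pi> k $ y = 0" for y
      using that assms(2)[of k] sum_nonneg_eq_0_iff[of UNIV "\<lambda>y. \<pi> k $ y"] by (auto simp: l_def)
    then have "\<pi> k = 0 *\<^sub>R \<pi> k" by (simp add: vec_eq_iff)
    then show ?thesis
      using profile_scale[of "\<pi> k" "W k" 0 d] assms(2) W that by simp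
  qed
  have "(\<Sum>k\<in>K. profile d (\<pi> k, W k)) = (\<Sum>k\<in>K'. profile d (\<pi> k, W k))"
    using assms(1) zero by (intro sum.mono_neutral_right) (auto simp: K'_def)
  also have "\<dots> = (\<Sum>k\<in>K'. l k *\<^sub>R profile d (inverse (l k) *\<^sub>R \<pi> k, W k))"
    using scale by (rule sum.cong[OF refl])
  also have "\<dots> \<in> profile_hull d"
    unfolding profile_hull_def
  proof (rule convex_sum)
    show "finite K'" using assms(1) by (simp add: K'_def)
    have "(\<Sum>k\<in>K'. l k) = (\<Sum>k\<in>K. l k)"
      using assms(1) l_nonneg by (intro sum.mono_neutral_left) (auto simp: K'_def order_less_le)
    then show "(\<Sum>k\<in>K'. l k) = 1" using assms(3) by (simp add: l_def)
    fix k assume k: "k \<in> K'"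
    then show "0 \<le> l k" by (simp add: K'_def)
    have "(inverse (l k) *\<^sub>R \<pi> k, W k) \<in> weight_set"
      using k assms(2) W by (auto simp: weight_set_def K'_def l_def sum_distrib_left[symmetric])
    then show "profile d (inverse (l k) *\<^sub>R \<pi> k, W k) \<in> convex hull (profile d ` weight_set)"
      by (intro hull_inc) auto
  qed (rule convex_convex_hull)
  finally show ?thesis .
qed


text \<open>A convex combination of profiles is realised by letting \<open>U\<close> be its index.\<close>

lemma sl_region_of_profile_hull:
  fixes d :: "'x \<Rightarrow> 'xh::finite \<Rightarrow> real"
  assumes hull: "(\<chi> y. pY y, a, b, c) \<in> profile_hull d"
    and R1: "R1 \<ge> ent UNIV p3 (\<lambda>(x, y, z). ((y, z), x)) - ent UNIV p3 (\<lambda>(x, y, z). x) - a"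
    and R: "R \<ge> b" and D: "c \<le> D"
  shows "(R, R1) \<in> sl_region pZY pXgZ d D"
proof -
  obtain A l where A: "finite A" "A \<subseteq> profile d ` weight_set" "\<forall>s\<in>A. 0 \<le> l s" "sum l A = 1"
    "(\<Sum>s\<in>A. l s *\<^sub>R s) = (\<chi> y. pY y, a, b, c)"
    using hull unfolding profile_hull_def convex_hull_explicit by blast
  define N where "N = card A"
  \<comment> \<open>The auxiliary alphabets in \<open>sl_region\<close> are sets of naturals:
    \<open>h\<close> numbers the points of the combination, \<open>e\<close> the functions from Z to
    reconstructions.\<close>
  obtain h where h: "bij_betw h {..<N} A"
    using ex_bij_betw_nat_finite[OF A(1)] by (auto simp: N_def atLeast0LessThan)
  define N' where "N' = CARD('z \<Rightarrow> 'xh)"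
  obtain e :: "nat \<Rightarrow> 'z \<Rightarrow> 'xh" where e: "bij_betw e {..<N'} UNIV"
    using ex_bij_betw_nat_finite[of "UNIV :: ('z \<Rightarrow> 'xh) set"] by (auto simp: N'_def atLeast0LessThan)
  have "N > 0" using A(1,4) by (auto simp: N_def card_gt_0_iff)
  \<comment> \<open>Indices from \<open>N\<close> on repeat the point with index 0, because the
    channel to V has to be normalised for every natural u.\<close>
  have "\<exists>p\<in>weight_set. profile d p = h (if k < N then k else 0)" for k
  proof -
    have "h (if k < N then k else 0) \<in> A" using h \<open>N > 0\<close> by (auto simp: bij_betw_def)
    then show ?thesis using A(2) by (metis imageE subsetD)
  qed
  then obtain \<theta> where \<theta>: "\<And>k. \<theta> k \<in> weight_set" "\<And>k. k < N \<Longrightarrow> profile d (\<theta> k) = h k"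
    by (metis (mono_tags, lifting))
  define \<pi> where "\<pi> = (\<lambda>k. fst (\<theta> k))"
  define W where "W = (\<lambda>k. snd (\<theta> k))"
  define m where "m = (\<lambda>k. if k < N then l (h k) else 0)"
  have w: "0 \<le> \<pi> k $ y" "(\<Sum>y\<in>UNIV. \<pi> k $ y) = 1" "0 \<le> W k $ i" "(\<Sum>v\<in>UNIV. W k $ (x, v)) = 1" for k y i x
    using \<theta>(1)[of k] by (cases i, auto simp: weight_set_def \<pi>_def W_def case_prod_unfold)+
  have m: "m k \<ge> 0" for k
    using A(3) h by (auto simp: m_def bij_betw_def)
  have "(\<Sum>k<N. m k *\<^sub>R profile d (\<pi> k, W k)) = (\<Sum>k<N. l (h k) *\<^sub>R h k)"
    using \<theta>(2) by (intro sum.cong) (auto simp: m_def \<pi>_def W_def)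
  also have "\<dots> = (\<Sum>s\<in>A. l s *\<^sub>R s)"
    by (rule sum.reindex_bij_betw[OF h])
  finally have mix: "(\<Sum>k<N. m k *\<^sub>R profile d (\<pi> k, W k)) = (\<chi> y. pY y, a, b, c)"
    using A(5) by simp
  have mix_pY: "(\<Sum>k<N. m k * \<pi> k $ y) = pY y" for y
    using arg_cong[OF mix, of "\<lambda>p. fst p $ y"] by (simp add: profile_def fst_sum)
  have mix_a: "(\<Sum>k<N. m k * entYZ_X (law (\<pi> k) (W k))) = a"
    using arg_cong[OF mix, of "\<lambda>p. fst (snd p)"] by (simp add: profile_def fst_sum snd_sum)
  have mix_b: "(\<Sum>k<N. m k * miXV_Z (law (\<pi> k) (W k))) = b"
    using arg_cong[OF mix, of "\<lambda>p. fst (snd (snd p))"] by (simp add: profile_def fst_sum snd_sum)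
  have mix_c: "(\<Sum>k<N. m k * exp_dist d (law (\<pi> k) (W k))) = c"
    using arg_cong[OF mix, of "\<lambda>p. snd (snd (snd p))"] by (simp add: profile_def fst_sum snd_sum)
  \<comment> \<open>Bayes' rule: the weight of u times the law of Y given u, over the law of Y.
    Where \<open>pY y = 0\<close> the point mass at 0 keeps the channel normalised.\<close>
  define qU where "qU = (\<lambda>y u. if pY y = 0 then of_bool (u = 0) else m u * \<pi> u $ y / pY y)"
  define qV where "qV = (\<lambda>x u v. W u $ (x, e v))"
  interpret T: test_channel pZY pXgZ "{..<N}" "{..<N'}" qU qV
  proof
    show "qU y u \<ge> 0" for y u
      using m w pY_nonneg by (simp add: qU_def)
    show "(\<Sum>u<N. qU y u) = 1" for y
    proof (cases "pY y = 0")
      case True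
      then show ?thesis using \<open>N > 0\<close> by (simp add: qU_def of_bool_def)
    next
      case False
      then show ?thesis by (simp add: qU_def sum_divide_distrib[symmetric] mix_pY)
    qed
    show "qV x u v \<ge> 0" for x u v by (simp add: qV_def w)
    show "(\<Sum>v<N'. qV x u v) = 1" for x u
      unfolding qV_def using sum.reindex_bij_betw[OF e, of "\<lambda>v. W u $ (x, v)"] w(4) by simp
  qed auto
  let ?S = "T.S" and ?P = "T.P"
  define Q where "Q = (\<lambda>(x, y, z, u::nat, v). (x :: 'x, y :: 'y, z :: 'z, e v))"
  define M where "M = (\<lambda>u q. m u * law (\<pi> u) (W u) q)"
  have massQ: "mass ?S ?P (\<lambda>w. (Q w, T.cU w)) (q, u) = M u q" if u: "u \<in> {..<N}" for q u
  proof -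
    obtain x y z v where q: "q = (x, y, z, v)" by (cases q)
    obtain j where j: "j < N'" "e j = v" using e by (metis UNIV_I bij_betw_iff_bijections lessThan_iff)
    have "{w \<in> ?S. (Q w, T.cU w) = (q, u)} = {(x, y, z, u, j)}"
      using j u e by (auto simp: Q_def q bij_betw_def inj_on_def)
    then have "mass ?S ?P (\<lambda>w. (Q w, T.cU w)) (q, u) = ?P (x, y, z, u, j)"
      by (simp add: mass_def)
    also have "\<dots> = M u q"
      using pZY_zero[of y z] j by (auto simp: joint5_def M_def law_def q qU_def qV_def)
    finally show ?thesis .
  qed
  have M_nonneg: "law (\<pi> u) (W u) q \<ge> 0" for u q
    by (rule law_nonneg) (use w in auto)
  have fib: "ent ?S ?P (\<lambda>w. (A (Q w), T.cU w)) = (\<Sum>u<N. ent UNIV (M u) A)" for A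
    by (rule ent_pair_eq_sum_fibers[OF T.finite_S _ _ massQ]) auto
  have a_eq: "a = ent ?S ?P (\<lambda>w. (((T.cY w, T.cZ w), T.cX w), T.cU w)) - ent ?S ?P (\<lambda>w. (T.cX w, T.cU w))"
  proof -
    have "a = (\<Sum>u<N. entYZ_X (M u))"
      unfolding mix_a[symmetric] M_def by (intro sum.cong refl homogeneous(1)[symmetric] M_nonneg m)
    also have "\<dots> = ent ?S ?P (\<lambda>w. ((\<lambda>(x, y, z, v). ((y, z), x)) (Q w), T.cU w)) - ent ?S ?P (\<lambda>w. ((\<lambda>(x, y, z, v). x) (Q w), T.cU w))"
      unfolding fib entYZ_X_def sum_subtractf ..
    finally show ?thesis by (simp add: Q_def case_prod_unfold)
  qed
  have b_eq: "b = ent ?S ?P (\<lambda>w. ((T.cX w, T.cZ w), T.cU w)) + ent ?S ?P (\<lambda>w. ((e (T.cV w), T.cZ w), T.cU w))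
      - ent ?S ?P (\<lambda>w. ((T.cX w, e (T.cV w), T.cZ w), T.cU w)) - ent ?S ?P (\<lambda>w. (T.cZ w, T.cU w))"
  proof -
    have "b = (\<Sum>u<N. miXV_Z (M u))"
      unfolding mix_b[symmetric] M_def by (intro sum.cong refl homogeneous(2)[symmetric] M_nonneg m)
    also have "\<dots> = ent ?S ?P (\<lambda>w. ((\<lambda>(x, y, z, v). (x, z)) (Q w), T.cU w)) + ent ?S ?P (\<lambda>w. ((\<lambda>(x, y, z, v). (v, z)) (Q w), T.cU w))
      - ent ?S ?P (\<lambda>w. ((\<lambda>(x, y, z, v). (x, v, z)) (Q w), T.cU w)) - ent ?S ?P (\<lambda>w. ((\<lambda>(x, y, z, v). z) (Q w), T.cU w))"
      unfolding fib miXV_Z_def sum_subtractf sum.distrib ..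
    finally show ?thesis by (simp add: Q_def case_prod_unfold)
  qed
  have e_inj: "e v = e v' \<longleftrightarrow> v = v'" if "v < N'" "v' < N'" for v v'
    using e that by (auto simp: bij_betw_def inj_on_def)
  have rate: "cond_mi ?S ?P T.cX T.cV T.cUZ = b"
    unfolding b_eq cond_mi_eq_ent[of ?S ?P, OF T.finite_S T.P_nonneg]
    by (intro arg_cong2[where f = minus] arg_cong2[where f = plus] ent_cong_fibers) (auto simp: e_inj)
  have p3_mass: "mass ?S ?P (\<lambda>(x, y, z, u, v). (x, y, z)) q = p3 q" for q
  proof -
    obtain x y z where q: "q = (x, y, z)" by (cases q)
    have "mass ?S ?P (\<lambda>(x, y, z, u, v). (x, y, z)) q = (\<Sum>(u, v)\<in>{..<N} \<times> {..<N'}. ?P (x, y, z, u, v))"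
      unfolding mass_def q
      by (intro sum.reindex_bij_witness[of _ "\<lambda>(u, v). (x, y, z, u, v)" "\<lambda>(x, y, z, u, v). (u, v)"]) auto
    then show ?thesis
      by (simp add: sum_Times joint5_def sum_distrib_left[symmetric] T.qU_sum T.qV_sum p3_def q)
  qed
  have p3_ent: "ent ?S ?P (\<lambda>w. A ((\<lambda>(x, y, z, u, v). (x, y, z)) w)) = ent UNIV p3 A" for A
    by (rule ent_comp) (use T.finite_S p3_mass in auto)
  \<comment> \<open>The right-hand side is I(U; Y, Z | X); dropping Z can only lower it.\<close>
  have rate1: "cond_mi ?S ?P T.cU T.cY T.cX \<le> ent UNIV p3 (\<lambda>(x, y, z). ((y, z), x)) - ent UNIV p3 (\<lambda>(x, y, z). x) - a"
  proof -
    have "ent ?S ?P (\<lambda>w. (T.cZ w, T.cU w, T.cY w, T.cX w)) - ent ?S ?P (\<lambda>w. (T.cU w, T.cY w, T.cX w))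
        \<le> ent ?S ?P (\<lambda>w. (T.cZ w, T.cY w, T.cX w)) - ent ?S ?P (\<lambda>w. (T.cY w, T.cX w))"
      by (rule cond_ent_antimono[of ?S ?P, OF T.finite_S T.P_nonneg]) auto
    moreover have "ent ?S ?P (\<lambda>w. (T.cZ w, T.cU w, T.cY w, T.cX w)) = ent ?S ?P (\<lambda>w. (((T.cY w, T.cZ w), T.cX w), T.cU w))"
      by (rule ent_cong_fibers) auto
    moreover have "ent ?S ?P (\<lambda>w. (T.cU w, T.cX w)) = ent ?S ?P (\<lambda>w. (T.cX w, T.cU w))"
      by (rule ent_cong_fibers) auto
    moreover have "ent ?S ?P (\<lambda>w. (T.cZ w, T.cY w, T.cX w)) = ent UNIV p3 (\<lambda>(x, y, z). ((y, z), x))"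
      unfolding p3_ent[symmetric] by (rule ent_cong_fibers) auto
    moreover have "ent ?S ?P T.cX = ent UNIV p3 (\<lambda>(x, y, z). x)"
      unfolding p3_ent[symmetric] by (rule ent_cong_fibers) auto
    ultimately show ?thesis
      unfolding a_eq cond_mi_eq_ent[of ?S ?P, OF T.finite_S T.P_nonneg] by linarith
  qed
  have "(\<Sum>w\<in>?S. ?P w * (case w of (x, y, z, u, v) \<Rightarrow> d x (e v z))) = (\<Sum>w\<in>?S. ?P w * (case (Q w, T.cU w) of ((x, y, z, v), u) \<Rightarrow> d x (v z)))"
    by (intro sum.cong) (auto simp: Q_def)
  also have "\<dots> = (\<Sum>(q, u)\<in>UNIV \<times> {..<N}. mass ?S ?P (\<lambda>w. (Q w, T.cU w)) (q, u) * (case q of (x, y, z, v) \<Rightarrow> d x (v z)))"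
    unfolding case_prod_unfold using T.finite_S
    by (subst sum_mass[symmetric, of ?S "UNIV \<times> {..<N}"]) (auto simp: case_prod_unfold)
  also have "\<dots> = (\<Sum>q\<in>UNIV. \<Sum>u<N. M u q * (case q of (x, y, z, v) \<Rightarrow> d x (v z)))"
    unfolding sum_Times using massQ by simp
  also have "\<dots> = (\<Sum>u<N. \<Sum>q\<in>UNIV. M u q * (case q of (x, y, z, v) \<Rightarrow> d x (v z)))"
    by (rule sum.swap)
  also have "\<dots> = c"
    unfolding mix_c[symmetric] M_def exp_dist_def sum_distrib_left
    by (simp add: case_prod_unfold mult.assoc)
  finally have "(\<Sum>w\<in>?S. ?P w * (case w of (x, y, z, u, v) \<Rightarrow> d x (e v z))) = c" .
  then have "(\<Sum>w\<in>?S. ?P w * (case w of (x, y, z, u, v) \<Rightarrow> d x (e v z))) \<le> D"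
    using D by simp
  then show ?thesis
    unfolding sl_region_def Let_def mem_Collect_eq case_prod_conv
    apply -
    apply (rule exI[of _ "{..<N}"])
    apply (rule exI[of _ "{..<N'}"])
    apply (rule exI[of _ qU])
    apply (rule exI[of _ qV])
    apply (rule exI[of _ "\<lambda>u v z. e v z"])
    using R R1 rate rate1 T.qU_nonneg T.qU_sum T.qV_nonneg T.qV_sum by simp
qed

end

section \<open>Converse\<close>

definition glue :: "nat \<Rightarrow> (nat \<Rightarrow> 'a) \<Rightarrow> 'a \<Rightarrow> (nat \<Rightarrow> 'a) \<Rightarrow> nat \<Rightarrow> 'a" where
  "glue i l a r = (\<lambda>j. if j < i then l j else if j = i then a else r j)"

abbreviation pre :: "nat \<Rightarrow> (nat \<Rightarrow> 'a) set" where "pre i \<equiv> PiE {..<i} (\<lambda>_. UNIV)"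
abbreviation suf :: "nat \<Rightarrow> nat \<Rightarrow> (nat \<Rightarrow> 'a) set" where "suf i n \<equiv> PiE {Suc i..<n} (\<lambda>_. UNIV)"

lemma glue_in_Seq: "i < n \<Longrightarrow> l \<in> pre i \<Longrightarrow> r \<in> suf i n \<Longrightarrow> glue i l a r \<in> Seq n"
  by (auto simp: PiE_def extensional_def glue_def)

lemma restrict_glue [simp]:
  "l \<in> pre i \<Longrightarrow> restrict (glue i l a r) {..<i} = l"
  "r \<in> suf i n \<Longrightarrow> restrict (glue i l a r) {Suc i..<n} = r"
  "glue i l a r i = a"
  by (auto simp: PiE_def extensional_def glue_def fun_eq_iff)

lemma glue_restrict [simp]: "xs \<in> Seq n \<Longrightarrow> i < n \<Longrightarrow> glue i (restrict xs {..<i}) (xs i) (restrict xs {Suc i..<n}) = xs"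
  by (auto simp: PiE_def extensional_def glue_def fun_eq_iff)

lemma restrict_in_pre_suf [simp]: "restrict xs {..<i} \<in> pre i" "restrict xs {Suc i..<n} \<in> suf i n"
  by auto

lemma finite_pre_suf [simp]: "finite (pre i :: (nat \<Rightarrow> 'a::finite) set)" "finite (suf i n :: (nat \<Rightarrow> 'a) set)"
  by (auto intro!: finite_PiE)

lemma sum_Seq_glue:
  fixes h :: "(nat \<Rightarrow> 'a::finite) \<Rightarrow> 'b::comm_monoid_add"
  assumes "i < n"
  shows "(\<Sum>xs\<in>Seq n. h xs) = (\<Sum>l\<in>pre i. \<Sum>(a, r)\<in>UNIV \<times> suf i n. h (glue i l a r))"
  unfolding sum.cartesian_product
proof (rule sum.reindex_bij_witness[of _ "\<lambda>(l, a, r). glue i l a r" "\<lambda>xs. (restrict xs {..<i}, xs i, restrict xs {Suc i..<n})"])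
  fix p :: "(nat \<Rightarrow> 'a) \<times> 'a \<times> (nat \<Rightarrow> 'a)" assume p: "p \<in> pre i \<times> UNIV \<times> suf i n"
  obtain l a r where lar: "p = (l, a, r)" by (cases p)
  show "(case p of (l, a, r) \<Rightarrow> glue i l a r) \<in> Seq n"
    using p glue_in_Seq[OF assms, of l r a] by (simp add: lar)
  show "(restrict (case p of (l, a, r) \<Rightarrow> glue i l a r) {..<i}, (case p of (l, a, r) \<Rightarrow> glue i l a r) i,
      restrict (case p of (l, a, r) \<Rightarrow> glue i l a r) {Suc i..<n}) = p"
    using p by (simp add: lar)
qed (use assms in auto)

lemma prod_lessThan_split:
  fixes F :: "nat \<Rightarrow> real"
  assumes "i < n"
  shows "(\<Prod>j<n. F j) = (\<Prod>j<i. F j) * F i * (\<Prod>j\<in>{Suc i..<n}. F j)"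
proof -
  have "{..<n} = {..<i} \<union> insert i {Suc i..<n}" using assms by auto
  then have "(\<Prod>j<n. F j) = prod F ({..<i} \<union> insert i {Suc i..<n})"
    by (rule arg_cong)
  also have "\<dots> = (\<Prod>j<i. F j) * prod F (insert i {Suc i..<n})"
    by (rule prod.union_disjoint) auto
  finally show ?thesis by (simp add: mult.assoc)
qed

lemma finite_type_minimizer:
  fixes F :: "'a::finite \<Rightarrow> real"
  shows "\<exists>a. \<forall>b. F a \<le> F b"
  using arg_min_least[of UNIV _ F] by auto

text \<open>A rule \<open>\<gamma>\<close> that sees only \<open>\<tau> a\<close> is constant on
  each group, so group by group the best constant answer cannot lose against it.\<close>

lemma groupwise_minimum_le:
  fixes c :: "'a \<Rightarrow> 'h \<Rightarrow> real"
  assumes "finite A" "\<And>t h. (\<Sum>a\<in>{a\<in>A. \<tau> a = t}. c a (best t)) \<le> (\<Sum>a\<in>{a\<in>A. \<tau> a = t}. c a h)"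
  shows "(\<Sum>a\<in>A. c a (best (\<tau> a))) \<le> (\<Sum>a\<in>A. c a (\<gamma> (\<tau> a)))"
proof -
  have "(\<Sum>a\<in>A. c a (best (\<tau> a))) = (\<Sum>t\<in>\<tau> ` A. \<Sum>a\<in>{a\<in>A. \<tau> a = t}. c a (best (\<tau> a)))"
    by (rule sum.group[symmetric]) (use assms in auto)
  also have "\<dots> = (\<Sum>t\<in>\<tau> ` A. \<Sum>a\<in>{a\<in>A. \<tau> a = t}. c a (best t))"
    by (intro sum.cong) auto
  also have "\<dots> \<le> (\<Sum>t\<in>\<tau> ` A. \<Sum>a\<in>{a\<in>A. \<tau> a = t}. c a (\<gamma> t))"
    by (intro sum_mono assms)
  also have "\<dots> = (\<Sum>t\<in>\<tau> ` A. \<Sum>a\<in>{a\<in>A. \<tau> a = t}. c a (\<gamma> (\<tau> a)))"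
    by (intro sum.cong) auto
  also have "\<dots> = (\<Sum>a\<in>A. c a (\<gamma> (\<tau> a)))"
    by (rule sum.group) (use assms in auto)
  finally show ?thesis .
qed

section \<open>A block code and the auxiliary variables extracted from it\<close>

locale coding_scheme = source pZY pXgZ
  for pZY :: "'z::finite \<Rightarrow> 'y::finite \<Rightarrow> real" and pXgZ :: "'z \<Rightarrow> 'x::finite \<Rightarrow> real" +
  fixes d :: "'x \<Rightarrow> 'xh::finite \<Rightarrow> real" and n :: nat and R R1 :: real
    and f1 :: "(nat \<Rightarrow> 'y) \<Rightarrow> nat" and f :: "(nat \<Rightarrow> 'x) \<Rightarrow> nat \<Rightarrow> nat"
    and g :: "nat \<Rightarrow> nat \<Rightarrow> (nat \<Rightarrow> 'z) \<Rightarrow> nat \<Rightarrow> 'xh"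
  assumes n_pos: "n > 0"
    and f1_msgs: "ys \<in> Seq n \<Longrightarrow> f1 ys \<in> msgs n R1"
    and f_msgs: "xs \<in> Seq n \<Longrightarrow> t \<in> msgs n R1 \<Longrightarrow> f xs t \<in> msgs n R"
begin

definition \<Omega> :: "((nat \<Rightarrow> 'x) \<times> (nat \<Rightarrow> 'y) \<times> (nat \<Rightarrow> 'z)) set" where
  "\<Omega> = Seq n \<times> Seq n \<times> Seq n"

definition Pr :: "(nat \<Rightarrow> 'x) \<times> (nat \<Rightarrow> 'y) \<times> (nat \<Rightarrow> 'z) \<Rightarrow> real" where
  "Pr = (\<lambda>(xs, ys, zs). \<Prod>i<n. pZY (zs i) (ys i) * pXgZ (zs i) (xs i))"

abbreviation Xs :: "(nat \<Rightarrow> 'x) \<times> (nat \<Rightarrow> 'y) \<times> (nat \<Rightarrow> 'z) \<Rightarrow> nat \<Rightarrow> 'x" where "Xs \<equiv> fst"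
abbreviation Ys :: "(nat \<Rightarrow> 'x) \<times> (nat \<Rightarrow> 'y) \<times> (nat \<Rightarrow> 'z) \<Rightarrow> nat \<Rightarrow> 'y" where "Ys \<equiv> \<lambda>\<omega>. fst (snd \<omega>)"
abbreviation Zs :: "(nat \<Rightarrow> 'x) \<times> (nat \<Rightarrow> 'y) \<times> (nat \<Rightarrow> 'z) \<Rightarrow> nat \<Rightarrow> 'z" where "Zs \<equiv> \<lambda>\<omega>. snd (snd \<omega>)"

definition T1 :: "(nat \<Rightarrow> 'x) \<times> (nat \<Rightarrow> 'y) \<times> (nat \<Rightarrow> 'z) \<Rightarrow> nat" where
  "T1 \<omega> = f1 (Ys \<omega>)"

definition T :: "(nat \<Rightarrow> 'x) \<times> (nat \<Rightarrow> 'y) \<times> (nat \<Rightarrow> 'z) \<Rightarrow> nat" where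
  "T \<omega> = f (Xs \<omega>) (T1 \<omega>)"

text \<open>Later letters of Z rather than of X are included so that V depends on Y and Z only
  through \<open>X\<^sub>i\<close> and \<open>U\<^sub>i\<close>: given the later Z, the later X are
  independent of all Y by the chain Y - Z - X, and they are all that T depends on beyond
  \<open>X\<^sub>i\<close> and \<open>U\<^sub>i\<close>.\<close>

definition Ui :: "nat \<Rightarrow> (nat \<Rightarrow> 'x) \<times> (nat \<Rightarrow> 'y) \<times> (nat \<Rightarrow> 'z) \<Rightarrow> nat \<times> (nat \<Rightarrow> 'x) \<times> (nat \<Rightarrow> 'z)" where
  "Ui i \<omega> = (T1 \<omega>, restrict (Xs \<omega>) {..<i}, restrict (Zs \<omega>) {Suc i..<n})"

definition UK :: "nat \<Rightarrow> (nat \<times> (nat \<Rightarrow> 'x) \<times> (nat \<Rightarrow> 'z)) set" where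
  "UK i = msgs n R1 \<times> pre i \<times> suf i n"

text \<open>The cost of answering \<open>h\<close> at time \<open>i\<close> when \<open>Z\<^sub>i = z\<close>, the encoder has sent \<open>t\<close> and \<open>U\<^sub>i = u\<close>.
  Given \<open>(T, U\<^sub>i, Z\<^sub>i)\<close> the earlier \<open>Z\<^sub>j\<close> are independent of \<open>X\<^sub>i\<close>, so a minimiser does at least as well as
  the original decoder, and it depends on \<open>(T, U\<^sub>i, Z\<^sub>i)\<close> only.\<close>

definition answer_cost :: "nat \<Rightarrow> nat \<Rightarrow> nat \<times> (nat \<Rightarrow> 'x) \<times> (nat \<Rightarrow> 'z) \<Rightarrow> 'z \<Rightarrow> 'xh \<Rightarrow> real" where
  "answer_cost i t u z h = (case u of (t1, a, b) \<Rightarrow>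
     \<Sum>p\<in>{p\<in>UNIV \<times> suf i n. f (glue i a (fst p) (snd p)) t1 = t}.
       pXgZ z (fst p) * (\<Prod>j\<in>{Suc i..<n}. pXgZ (b j) (snd p j)) * d (fst p) h)"

definition vsel :: "nat \<Rightarrow> nat \<Rightarrow> nat \<times> (nat \<Rightarrow> 'x) \<times> (nat \<Rightarrow> 'z) \<Rightarrow> 'z \<Rightarrow> 'xh" where
  "vsel i t u z = (SOME h. \<forall>h'. answer_cost i t u z h \<le> answer_cost i t u z h')"

definition Vi :: "nat \<Rightarrow> (nat \<Rightarrow> 'x) \<times> (nat \<Rightarrow> 'y) \<times> (nat \<Rightarrow> 'z) \<Rightarrow> 'z \<Rightarrow> 'xh" where
  "Vi i \<omega> = vsel i (T \<omega>) (Ui i \<omega>)"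

definition Qi :: "nat \<Rightarrow> (nat \<Rightarrow> 'x) \<times> (nat \<Rightarrow> 'y) \<times> (nat \<Rightarrow> 'z) \<Rightarrow> 'x \<times> 'y \<times> 'z \<times> ('z \<Rightarrow> 'xh)" where
  "Qi i \<omega> = (Xs \<omega> i, Ys \<omega> i, Zs \<omega> i, Vi i \<omega>)"

text \<open>The probability of \<open>U\<^sub>i = u\<close> given \<open>Y\<^sub>i = y\<close>, as
  an explicit sum over earlier and later Y and earlier Z. Having no quotient, it makes sense also
  where y has probability 0.\<close>

definition kap :: "nat \<Rightarrow> 'y \<Rightarrow> nat \<times> (nat \<Rightarrow> 'x) \<times> (nat \<Rightarrow> 'z) \<Rightarrow> real" where
  "kap i y u = (case u of (t1, a, b) \<Rightarrow> \<Sum>(yl, yr, zl)\<in>pre i \<times> suf i n \<times> pre i.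
     (\<Prod>j<i. pZY (zl j) (yl j) * pXgZ (zl j) (a j)) * (\<Prod>j\<in>{Suc i..<n}. pZY (b j) (yr j)) * of_bool (f1 (glue i yl y yr) = t1))"

text \<open>The probability of \<open>V\<^sub>i = v\<close> given \<open>X\<^sub>i = x\<close> and
  \<open>U\<^sub>i = u\<close>: only the later X remain random.\<close>

definition Wi :: "nat \<Rightarrow> nat \<times> (nat \<Rightarrow> 'x) \<times> (nat \<Rightarrow> 'z) \<Rightarrow> 'x \<Rightarrow> ('z \<Rightarrow> 'xh) \<Rightarrow> real" where
  "Wi i u x v = (case u of (t1, a, b) \<Rightarrow> \<Sum>xr\<in>suf i n.
     (\<Prod>j\<in>{Suc i..<n}. pXgZ (b j) (xr j)) * of_bool (vsel i (f (glue i a x xr) t1) u = v))"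

lemma finite_\<Omega>: "finite \<Omega>"
  by (auto simp: \<Omega>_def intro!: finite_PiE)

lemma Pr_nonneg: "Pr \<omega> \<ge> 0"
  by (cases \<omega>) (auto simp: Pr_def intro!: prod_nonneg mult_nonneg_nonneg pZY_nonneg pXgZ_nonneg)

lemma finite_UK: "finite (UK i)"
  by (auto simp: UK_def)

lemma Ui_in_UK: "Ui i ` \<Omega> \<subseteq> UK i"
  by (rule image_subsetI) (simp add: Ui_def UK_def \<Omega>_def T1_def f1_msgs mem_Times_iff)

lemma kap_nonneg: "kap i y u \<ge> 0"
  unfolding kap_def
  by (auto split: prod.splits intro!: sum_nonneg mult_nonneg_nonneg prod_nonneg pZY_nonneg pXgZ_nonneg)

lemma Wi_nonneg: "Wi i u x v \<ge> 0"
  unfolding Wi_def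
  by (auto split: prod.splits intro!: sum_nonneg mult_nonneg_nonneg prod_nonneg pXgZ_nonneg)

lemma sum_Wi: "(\<Sum>v\<in>UNIV. Wi i u x v) = 1"
proof -
  obtain t1 a b where u: "u = (t1, a, b)" by (cases u)
  have "(\<Sum>v\<in>UNIV. Wi i u x v) = (\<Sum>xr\<in>suf i n. \<Sum>v\<in>UNIV. (\<Prod>j\<in>{Suc i..<n}. pXgZ (b j) (xr j)) * of_bool (vsel i (f (glue i a x xr) t1) u = v))"
    unfolding Wi_def u prod.case by (rule sum.swap)
  also have "\<dots> = (\<Sum>xr\<in>suf i n. \<Prod>j\<in>{Suc i..<n}. pXgZ (b j) (xr j))"
    by (simp add: sum_distrib_left[symmetric] of_bool_def)
  also have "\<dots> = (\<Prod>j\<in>{Suc i..<n}. \<Sum>x\<in>UNIV. pXgZ (b j) x)"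
    by (subst prod_sum_PiE) auto
  finally show ?thesis by (simp add: pXgZ_sum)
qed

text \<open>Once u fixes the earlier X and the later Z, the condition on \<open>T1\<close> involves
  only the other Y and the earlier Z, while the condition on V involves only the later X. The weight
  splits along the same blocks, so the sum factorises. The product form expresses both Markov
  conditions of the single-letter law.\<close>

lemma mass_QU:
  assumes i: "i < n" and u: "u \<in> UK i"
  shows "mass \<Omega> Pr (\<lambda>\<omega>. (Qi i \<omega>, Ui i \<omega>)) ((x, y, z, v), u) = pZY z y * pXgZ z x * kap i y u * Wi i u x v"
proof -
  obtain t1 a b where u_eq: "u = (t1, a, b)" and ab: "a \<in> pre i" "b \<in> suf i n"
    using u by (auto simp: UK_def)
  define w1 where "w1 = (\<lambda>(yl, yr, zl). (\<Prod>j<i. pZY (zl j) (yl j) * pXgZ (zl j) (a j)) * (\<Prod>j\<in>{Suc i..<n}. pZY (b j) (yr j)))"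
  define w2 where "w2 = (\<lambda>xr. \<Prod>j\<in>{Suc i..<n}. pXgZ (b j) (xr j))"
  let ?D1 = "pre i \<times> suf i n \<times> pre i :: ((nat \<Rightarrow> 'y) \<times> (nat \<Rightarrow> 'y) \<times> (nat \<Rightarrow> 'z)) set"
  let ?D2 = "suf i n :: (nat \<Rightarrow> 'x) set"
  let ?E1 = "\<lambda>(yl, yr, zl). f1 (glue i yl y yr) = t1"
  let ?E2 = "\<lambda>xr. vsel i (f (glue i a x xr) t1) u = v"
  have weight: "Pr (glue i a x xr, glue i yl y yr, glue i zl z b) = pZY z y * pXgZ z x * (w1 (yl, yr, zl) * w2 xr)" for xr yl yr zl
  proof -
    have "Pr (glue i a x xr, glue i yl y yr, glue i zl z b) =
        (\<Prod>j<i. pZY (zl j) (yl j) * pXgZ (zl j) (a j)) * (pZY z y * pXgZ z x) * (\<Prod>j\<in>{Suc i..<n}. pZY (b j) (yr j) * pXgZ (b j) (xr j))"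
      unfolding Pr_def prod.case prod_lessThan_split[OF i] by (simp add: glue_def)
    then show ?thesis
      by (simp add: w1_def w2_def prod.distrib)
  qed
  define I where "I = (\<lambda>((yl, yr, zl), xr). (glue i a x xr, glue i yl y yr, glue i zl z b))"
  define J where "J = (\<lambda>(xs :: nat \<Rightarrow> 'x, ys :: nat \<Rightarrow> 'y, zs :: nat \<Rightarrow> 'z).
    ((restrict ys {..<i}, restrict ys {Suc i..<n}, restrict zs {..<i}), restrict xs {Suc i..<n}))"
  have "mass \<Omega> Pr (\<lambda>\<omega>. (Qi i \<omega>, Ui i \<omega>)) ((x, y, z, v), u) =
      (\<Sum>(s, xr)\<in>{s\<in>?D1. ?E1 s} \<times> {xr\<in>?D2. ?E2 xr}. pZY z y * pXgZ z x * (w1 s * w2 xr))"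
    unfolding mass_def
  proof (rule sum.reindex_bij_witness[of _ I J])
    fix \<omega> assume \<omega>: "\<omega> \<in> {\<omega> \<in> \<Omega>. (Qi i \<omega>, Ui i \<omega>) = ((x, y, z, v), u)}"
    obtain xs ys zs where \<omega>_eq: "\<omega> = (xs, ys, zs)" by (cases \<omega>)
    have sq: "xs \<in> Seq n" "ys \<in> Seq n" "zs \<in> Seq n"
      and c: "xs i = x" "ys i = y" "zs i = z" "Vi i \<omega> = v" "f1 ys = t1" "restrict xs {..<i} = a" "restrict zs {Suc i..<n} = b"
      using \<omega> by (auto simp: \<omega>_eq \<Omega>_def Qi_def Ui_def u_eq T1_def)
    have gl: "glue i a x (restrict xs {Suc i..<n}) = xs" "glue i (restrict ys {..<i}) y (restrict ys {Suc i..<n}) = ys"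
      "glue i (restrict zs {..<i}) z b = zs"
      using glue_restrict[OF sq(1) i] glue_restrict[OF sq(2) i] glue_restrict[OF sq(3) i] c by auto
    show "I (J \<omega>) = \<omega>"
      by (simp add: I_def J_def \<omega>_eq gl)
    have "Ui i \<omega> = u" using \<omega> by simp
    then have "vsel i (f xs t1) u = v"
      using c(4,5) by (simp add: Vi_def T_def T1_def \<omega>_eq)
    then show "J \<omega> \<in> {s\<in>?D1. ?E1 s} \<times> {xr\<in>?D2. ?E2 xr}"
      using c(5) by (simp add: J_def \<omega>_eq gl)
    show "(case J \<omega> of (s, xr) \<Rightarrow> pZY z y * pXgZ z x * (w1 s * w2 xr)) = Pr \<omega>"
      using weight[of "restrict xs {Suc i..<n}" "restrict ys {..<i}" "restrict ys {Suc i..<n}" "restrict zs {..<i}"]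
      by (simp add: J_def \<omega>_eq gl)
  next
    fix s assume s: "s \<in> {s\<in>?D1. ?E1 s} \<times> {xr\<in>?D2. ?E2 xr}"
    obtain yl yr zl xr where s_eq: "s = ((yl, yr, zl), xr)" by (cases s) auto
    have m: "yl \<in> pre i" "yr \<in> suf i n" "zl \<in> pre i" "xr \<in> suf i n" "f1 (glue i yl y yr) = t1" "vsel i (f (glue i a x xr) t1) u = v"
      using s by (auto simp: s_eq)
    show "J (I s) = s"
      using m by (simp add: I_def J_def s_eq)
    have "Ui i (glue i a x xr, glue i yl y yr, glue i zl z b) = u"
      using m ab by (simp add: Ui_def T1_def u_eq)
    then show "I s \<in> {\<omega> \<in> \<Omega>. (Qi i \<omega>, Ui i \<omega>) = ((x, y, z, v), u)}"
      using m ab i by (simp add: I_def s_eq \<Omega>_def glue_in_Seq Qi_def Vi_def T_def T1_def)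
  qed
  also have "\<dots> = (\<Sum>s\<in>{s\<in>?D1. ?E1 s}. \<Sum>xr\<in>{xr\<in>?D2. ?E2 xr}. pZY z y * pXgZ z x * (w1 s * w2 xr))"
    by (rule sum.cartesian_product[symmetric])
  also have "\<dots> = pZY z y * pXgZ z x * ((\<Sum>s\<in>{s\<in>?D1. ?E1 s}. w1 s) * (\<Sum>xr\<in>{xr\<in>?D2. ?E2 xr}. w2 xr))"
    unfolding sum_product by (simp add: sum_distrib_left)
  also have "(\<Sum>s\<in>{s\<in>?D1. ?E1 s}. w1 s) = kap i y u"
    unfolding kap_def u_eq prod.case
    by (rule sum.mono_neutral_cong_left) (auto simp: w1_def)
  also have "(\<Sum>xr\<in>{xr\<in>?D2. ?E2 xr}. w2 xr) = Wi i u x v"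
    unfolding Wi_def u_eq prod.case
    by (rule sum.mono_neutral_cong_left) (auto simp: w2_def u_eq)
  finally show ?thesis by simp
qed

lemma vsel_optimal: "answer_cost i t u z (vsel i t u z) \<le> answer_cost i t u z h"
  unfolding vsel_def using someI_ex[OF finite_type_minimizer[of "answer_cost i t u z"]] by blast

text \<open>Fix Y, Z and the earlier X. What remains random, \<open>X\<^sub>i\<close> and the later
  X, has a law depending on Z only through \<open>Z\<^sub>i\<close> and later letters, and the given
  decoder depends on it only through T. So \<open>vsel\<close>, optimal for every value of T, is at
  least as good although it ignores the earlier Z.\<close>

lemma distortion_Vi:
  assumes i: "i < n"
  shows "(\<Sum>\<omega>\<in>\<Omega>. Pr \<omega> * d (Xs \<omega> i) (Vi i \<omega> (Zs \<omega> i))) \<le> (\<Sum>\<omega>\<in>\<Omega>. Pr \<omega> * d (Xs \<omega> i) (g (T \<omega>) (T1 \<omega>) (Zs \<omega>) i))"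
proof -
  have swap: "(\<Sum>\<omega>\<in>\<Omega>. F \<omega>) = (\<Sum>ys\<in>Seq n. \<Sum>zs\<in>Seq n. \<Sum>a\<in>pre i. \<Sum>(x, r)\<in>UNIV \<times> suf i n. F (glue i a x r, ys, zs))" for F
  proof -
    have "(\<Sum>\<omega>\<in>\<Omega>. F \<omega>) = (\<Sum>xs\<in>Seq n. \<Sum>ys\<in>Seq n. \<Sum>zs\<in>Seq n. F (xs, ys, zs))"
      by (simp add: \<Omega>_def sum_Times)
    also have "\<dots> = (\<Sum>ys\<in>Seq n. \<Sum>zs\<in>Seq n. \<Sum>xs\<in>Seq n. F (xs, ys, zs))"
      by (subst sum.swap, intro sum.cong refl, rule sum.swap)
    finally show ?thesis
      by (simp add: sum_Seq_glue[OF i])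
  qed
  show ?thesis
    unfolding swap
  proof (rule sum_mono, rule sum_mono, rule sum_mono)
    fix ys :: "nat \<Rightarrow> 'y" and zs :: "nat \<Rightarrow> 'z" and a :: "nat \<Rightarrow> 'x"
    assume a: "a \<in> pre i"
    define b where "b = restrict zs {Suc i..<n}"
    define u where "u = (f1 ys, a, b)"
    \<comment> \<open>Constant during the minimisation: all factors free of x and r.\<close>
    define C where "C = (\<Prod>j<i. pZY (zs j) (ys j) * pXgZ (zs j) (a j)) * pZY (zs i) (ys i) * (\<Prod>j\<in>{Suc i..<n}. pZY (zs j) (ys j))"
    define w where "w = (\<lambda>(x, r). pXgZ (zs i) x * (\<Prod>j\<in>{Suc i..<n}. pXgZ (b j) (r j)))"
    let ?A = "UNIV \<times> suf i n :: ('x \<times> (nat \<Rightarrow> 'x)) set"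
    let ?\<tau> = "\<lambda>(x, r). f (glue i a x r) (f1 ys)"
    have C: "C \<ge> 0"
      unfolding C_def by (intro mult_nonneg_nonneg prod_nonneg ballI pZY_nonneg pXgZ_nonneg)
    have Pr: "Pr (glue i a x r, ys, zs) = C * w (x, r)" for x r
    proof -
      have "Pr (glue i a x r, ys, zs) = (\<Prod>j<i. pZY (zs j) (ys j) * pXgZ (zs j) (a j)) * (pZY (zs i) (ys i) * pXgZ (zs i) x)
          * (\<Prod>j\<in>{Suc i..<n}. pZY (zs j) (ys j) * pXgZ (zs j) (r j))"
        unfolding Pr_def prod.case prod_lessThan_split[OF i] by (simp add: glue_def)
      then show ?thesis
        by (simp add: C_def w_def b_def prod.distrib)
    qed
    have V: "Vi i (glue i a x r, ys, zs) = vsel i (?\<tau> (x, r)) u" for x r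
      using a by (simp add: Vi_def T_def T1_def Ui_def u_def b_def)
    have "(\<Sum>p\<in>?A. w p * d (fst p) (vsel i (?\<tau> p) u (zs i))) \<le> (\<Sum>p\<in>?A. w p * d (fst p) (g (?\<tau> p) (f1 ys) zs i))"
    proof (rule groupwise_minimum_le[where c = "\<lambda>p h. w p * d (fst p) h" and best = "\<lambda>t. vsel i t u (zs i)"
          and \<gamma> = "\<lambda>t. g t (f1 ys) zs i"])
      show "finite ?A" by simp
      show "(\<Sum>p\<in>{p\<in>?A. ?\<tau> p = t}. w p * d (fst p) (vsel i t u (zs i))) \<le> (\<Sum>p\<in>{p\<in>?A. ?\<tau> p = t}. w p * d (fst p) h)" for t h
        using vsel_optimal[of i t u "zs i" h] by (simp add: answer_cost_def u_def w_def case_prod_unfold)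
    qed
    then have "C * (\<Sum>p\<in>?A. w p * d (fst p) (vsel i (?\<tau> p) u (zs i))) \<le> C * (\<Sum>p\<in>?A. w p * d (fst p) (g (?\<tau> p) (f1 ys) zs i))"
      using C by (rule mult_left_mono)
    then show "(\<Sum>(x, r)\<in>?A. Pr (glue i a x r, ys, zs) * d (Xs (glue i a x r, ys, zs) i) (Vi i (glue i a x r, ys, zs) (Zs (glue i a x r, ys, zs) i)))
        \<le> (\<Sum>(x, r)\<in>?A. Pr (glue i a x r, ys, zs) * d (Xs (glue i a x r, ys, zs) i)
            (g (T (glue i a x r, ys, zs)) (T1 (glue i a x r, ys, zs)) (Zs (glue i a x r, ys, zs)) i))"
      unfolding sum_distrib_left Pr V by (simp add: case_prod_unfold mult.assoc T_def T1_def)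
  qed
qed

end

section \<open>Entropies of the messages and of the source block\<close>

lemma log_card_msgs_le:
  assumes "msgs n R \<noteq> {}"
  shows "log 2 (card (msgs n R)) \<le> n * R"
proof -
  have "card (msgs n R) > 0" using assms by (simp add: card_gt_0_iff)
  moreover have "real (card (msgs n R)) \<le> 2 powr (n * R)"
    by (simp add: msgs_def of_nat_nat)
  ultimately have "log 2 (card (msgs n R)) \<le> log 2 (2 powr (n * R))"
    by (intro log_mono) auto
  then show ?thesis by simp
qed

lemma Seq_eq_iff: "xs \<in> Seq n \<Longrightarrow> xs' \<in> Seq n \<Longrightarrow> xs = xs' \<longleftrightarrow> (\<forall>i<n. xs i = xs' i)"
  by (auto intro!: PiE_ext[of xs "{..<n}" "\<lambda>_. UNIV" xs'])

lemma restrict_eq_iff: "restrict h I = restrict h' I \<longleftrightarrow> (\<forall>i\<in>I. h i = h' i)"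
  by (auto simp: restrict_def fun_eq_iff)

context source
begin

lemma sum_p3_Y: "(\<Sum>q\<in>UNIV. p3 q * of_bool (fst (snd q) = y)) = pY y"
proof -
  have "(\<Sum>q\<in>UNIV. p3 q * of_bool (fst (snd q) = y)) = (\<Sum>x\<in>UNIV. \<Sum>y'\<in>UNIV. \<Sum>z\<in>UNIV. pZY z y' * pXgZ z x * of_bool (y' = y))"
    unfolding UNIV_Times_UNIV[symmetric] sum_Times by (simp add: p3_def)
  also have "\<dots> = (\<Sum>x\<in>UNIV. \<Sum>z\<in>UNIV. pZY z y * pXgZ z x)"
    unfolding sum_distrib_right[symmetric] by simp
  also have "\<dots> = (\<Sum>z\<in>UNIV. \<Sum>x\<in>UNIV. pZY z y * pXgZ z x)"
    by (rule sum.swap)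
  finally show ?thesis
    by (simp add: sum_distrib_left[symmetric] pXgZ_sum pY_def)
qed

text \<open>The two sides are H(X | Z) and H(X | Y, Z). By the chain Y - Z - X the conditional law
  of X is \<open>pXgZ\<close> in either case.\<close>

lemma ent_X_given_Z:
  "ent UNIV p3 (\<lambda>(x, y, z). (x, z)) - ent UNIV p3 (\<lambda>(x, y, z). z)
    = ent UNIV p3 (\<lambda>(x, y, z). ((y, z), x)) - ent UNIV p3 (\<lambda>(x, y, z). (y, z))"
proof -
  have 1: "mass UNIV p3 (\<lambda>(x, y, z). (x, z)) (x, z) = (\<Sum>y\<in>UNIV. pZY z y) * pXgZ z x" for x z
  proof -
    have "mass UNIV p3 (\<lambda>(x, y, z). (x, z)) (x, z) = (\<Sum>y\<in>UNIV. p3 (x, y, z))"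
      unfolding mass_def by (rule sum.reindex_bij_witness[of _ "\<lambda>y. (x, y, z)" "\<lambda>(x, y, z). y"]) auto
    then show ?thesis by (simp add: p3_def sum_distrib_right)
  qed
  have 2: "mass UNIV p3 (\<lambda>(x, y, z). z) z = (\<Sum>y\<in>UNIV. pZY z y)" for z
  proof -
    have "mass UNIV p3 (\<lambda>(x, y, z). z) z = (\<Sum>(y, x)\<in>UNIV \<times> UNIV. p3 (x, y, z))"
      unfolding mass_def by (rule sum.reindex_bij_witness[of _ "\<lambda>(y, x). (x, y, z)" "\<lambda>(x, y, z). (y, x)"]) auto
    then show ?thesis by (simp add: sum_Times p3_def sum_distrib_left[symmetric] pXgZ_sum del: UNIV_Times_UNIV)
  qed
  have 3: "mass UNIV p3 (\<lambda>(x, y, z). ((y, z), x)) ((y, z), x) = pZY z y * pXgZ z x" for x y z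
  proof -
    have "{w \<in> UNIV. (case w of (x, y, z) \<Rightarrow> ((y, z), x)) = ((y, z), x)} = {(x, y, z)}" by auto
    then show ?thesis unfolding mass_def by (simp only:) (simp add: p3_def)
  qed
  have 4: "mass UNIV p3 (\<lambda>(x, y, z). (y, z)) (y, z) = pZY z y" for y z
  proof -
    have "mass UNIV p3 (\<lambda>(x, y, z). (y, z)) (y, z) = (\<Sum>x\<in>UNIV. p3 (x, y, z))"
      unfolding mass_def by (rule sum.reindex_bij_witness[of _ "\<lambda>x. (x, y, z)" "\<lambda>(x, y, z). x"]) auto
    then show ?thesis by (simp add: p3_def sum_distrib_left[symmetric] pXgZ_sum)
  qed
  have pt: "p3 (x, y, z) * log 2 ((\<Sum>y\<in>UNIV. pZY z y) * pXgZ z x) - p3 (x, y, z) * log 2 (\<Sum>y\<in>UNIV. pZY z y)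
      = p3 (x, y, z) * log 2 (pZY z y * pXgZ z x) - p3 (x, y, z) * log 2 (pZY z y)" for x y z
  proof (cases "p3 (x, y, z) = 0")
    case False
    then have pos: "pZY z y > 0" "pXgZ z x > 0"
      using pZY_nonneg[of z y] pXgZ_nonneg[of z x] by (auto simp: p3_def order_less_le)
    have "(\<Sum>y\<in>UNIV. pZY z y) \<ge> pZY z y"
      using pZY_nonneg by (intro member_le_sum) auto
    then have "(\<Sum>y\<in>UNIV. pZY z y) > 0" using pos by linarith
    then show ?thesis using pos by (simp add: log_mult algebra_simps)
  qed simp
  have "ent UNIV p3 (\<lambda>(x, y, z). z) - ent UNIV p3 (\<lambda>(x, y, z). (x, z))
      = (\<Sum>(x, y, z)\<in>UNIV. p3 (x, y, z) * log 2 ((\<Sum>y\<in>UNIV. pZY z y) * pXgZ z x) - p3 (x, y, z) * log 2 (\<Sum>y\<in>UNIV. pZY z y))"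
    unfolding ent_def sum_negf[symmetric] sum_subtractf[symmetric] by (intro sum.cong) (auto simp: 1 2)
  also have "\<dots> = (\<Sum>(x, y, z)\<in>UNIV. p3 (x, y, z) * log 2 (pZY z y * pXgZ z x) - p3 (x, y, z) * log 2 (pZY z y))"
    unfolding pt ..
  also have "\<dots> = ent UNIV p3 (\<lambda>(x, y, z). (y, z)) - ent UNIV p3 (\<lambda>(x, y, z). ((y, z), x))"
    unfolding ent_def sum_negf[symmetric] sum_subtractf[symmetric]
  proof (rule sum.cong[OF refl])
    fix w :: "'x \<times> 'y \<times> 'z"
    obtain x y z where w: "w = (x, y, z)" by (cases w)
    show "(case w of (x, y, z) \<Rightarrow> p3 (x, y, z) * log 2 (pZY z y * pXgZ z x) - p3 (x, y, z) * log 2 (pZY z y)) =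
        - (p3 w * log 2 (mass UNIV p3 (\<lambda>(x, y, z). (y, z)) (case w of (x, y, z) \<Rightarrow> (y, z))))
        - - (p3 w * log 2 (mass UNIV p3 (\<lambda>(x, y, z). ((y, z), x)) (case w of (x, y, z) \<Rightarrow> ((y, z), x))))"
      by (simp only: w prod.case 3 4)
  qed
  finally show ?thesis by simp
qed

end

section \<open>Single-letter forms of the rates and the distortion of a code\<close>

context coding_scheme
begin

definition zip3 :: "(nat \<Rightarrow> 'x) \<times> (nat \<Rightarrow> 'y) \<times> (nat \<Rightarrow> 'z) \<Rightarrow> nat \<Rightarrow> 'x \<times> 'y \<times> 'z" where
  "zip3 \<omega> = (\<lambda>i\<in>{..<n}. (Xs \<omega> i, Ys \<omega> i, Zs \<omega> i))"

lemma zip3_in: "zip3 ` \<Omega> \<subseteq> PiE {..<n} (\<lambda>_. UNIV)"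
  unfolding zip3_def by (rule image_subsetI) (rule restrict_PiE_iff[THEN iffD2], simp)

lemma \<Omega>_eq_iff:
  assumes "\<omega> \<in> \<Omega>" "\<omega>' \<in> \<Omega>"
  shows "Xs \<omega> = Xs \<omega>' \<longleftrightarrow> (\<forall>i<n. Xs \<omega> i = Xs \<omega>' i)" "Ys \<omega> = Ys \<omega>' \<longleftrightarrow> (\<forall>i<n. Ys \<omega> i = Ys \<omega>' i)"
    "Zs \<omega> = Zs \<omega>' \<longleftrightarrow> (\<forall>i<n. Zs \<omega> i = Zs \<omega>' i)"
  by (rule Seq_eq_iff; use assms in \<open>simp add: \<Omega>_def mem_Times_iff\<close>)+

lemma mass_zip3:
  assumes "ws \<in> PiE {..<n} (\<lambda>_. UNIV)"
  shows "mass \<Omega> Pr zip3 ws = (\<Prod>k<n. p3 (ws k))"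
proof -
  let ?\<omega> = "(\<lambda>i\<in>{..<n}. fst (ws i), \<lambda>i\<in>{..<n}. fst (snd (ws i)), \<lambda>i\<in>{..<n}. snd (snd (ws i)))"
  have "{\<omega> \<in> \<Omega>. zip3 \<omega> = ws} = {?\<omega>}"
  proof (intro set_eqI iffI)
    fix \<omega> assume "\<omega> \<in> {\<omega> \<in> \<Omega>. zip3 \<omega> = ws}"
    then have \<omega>: "Xs \<omega> \<in> Seq n" "Ys \<omega> \<in> Seq n" "Zs \<omega> \<in> Seq n" "zip3 \<omega> = ws"
      by (simp_all add: \<Omega>_def mem_Times_iff)
    have pt: "ws i = (Xs \<omega> i, Ys \<omega> i, Zs \<omega> i)" if "i < n" for i
      using \<omega>(4)[symmetric] that by (simp add: zip3_def)
    from \<omega> have "Xs \<omega> = (\<lambda>i\<in>{..<n}. fst (ws i))" "Ys \<omega> = (\<lambda>i\<in>{..<n}. fst (snd (ws i)))" "Zs \<omega> = (\<lambda>i\<in>{..<n}. snd (snd (ws i)))"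
      using pt by (subst Seq_eq_iff[of _ n], simp, simp, simp)+
    then show "\<omega> \<in> {?\<omega>}"
      by (simp add: prod_eq_iff)
  next
    fix \<omega> assume "\<omega> \<in> {?\<omega>}"
    then show "\<omega> \<in> {\<omega> \<in> \<Omega>. zip3 \<omega> = ws}"
      using assms by (auto simp: \<Omega>_def zip3_def fun_eq_iff PiE_def extensional_def)
  qed
  then have "mass \<Omega> Pr zip3 ws = Pr ?\<omega>" by (simp add: mass_def)
  also have "\<dots> = (\<Prod>k<n. p3 (ws k))"
    by (simp add: Pr_def p3_def case_prod_unfold)
  finally show ?thesis .
qed

lemma finite_Seq3: "finite (PiE {..<n} (\<lambda>_. UNIV :: ('x \<times> 'y \<times> 'z) set))"
  by (auto intro!: finite_PiE)

lemma sum_Pr: "sum Pr \<Omega> = 1"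
proof -
  have "sum Pr \<Omega> = (\<Sum>ws\<in>PiE {..<n} (\<lambda>_. UNIV). mass \<Omega> Pr zip3 ws)"
    using sum_mass[OF finite_\<Omega> finite_Seq3 zip3_in, of Pr "\<lambda>_. 1"] by simp
  also have "\<dots> = 1"
    using iid_total[of "{..<n}" UNIV p3] sum_p3 by (simp add: mass_zip3)
  finally show ?thesis .
qed

lemma ent_sequence: "ent \<Omega> Pr (\<lambda>\<omega>. \<lambda>i\<in>{..<n}. A (Xs \<omega> i, Ys \<omega> i, Zs \<omega> i)) = n * ent UNIV p3 A"
proof -
  have "ent \<Omega> Pr (\<lambda>\<omega>. \<lambda>i\<in>{..<n}. A (Xs \<omega> i, Ys \<omega> i, Zs \<omega> i)) = ent \<Omega> Pr (\<lambda>\<omega>. (\<lambda>ws. \<lambda>i\<in>{..<n}. A (ws i)) (zip3 \<omega>))"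
    by (simp add: zip3_def cong: restrict_cong)
  also have "\<dots> = ent (PiE {..<n} (\<lambda>_. UNIV)) (\<lambda>ws. \<Prod>k<n. p3 (ws k)) (\<lambda>ws. \<lambda>i\<in>{..<n}. A (ws i))"
    by (rule ent_comp[OF finite_\<Omega> finite_Seq3 zip3_in mass_zip3])
  also have "\<dots> = n * ent UNIV p3 A"
    by (rule ent_iid) (auto simp: p3_nonneg sum_p3)
  finally show ?thesis .
qed

lemma mass_coord:
  assumes "i < n"
  shows "mass \<Omega> Pr (\<lambda>\<omega>. (Xs \<omega> i, Ys \<omega> i, Zs \<omega> i)) q = p3 q"
proof -
  have "mass \<Omega> Pr (\<lambda>\<omega>. (Xs \<omega> i, Ys \<omega> i, Zs \<omega> i)) q = mass \<Omega> Pr (\<lambda>\<omega>. (\<lambda>ws. ws i) (zip3 \<omega>)) q"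
    using assms by (simp add: zip3_def)
  also have "\<dots> = mass (PiE {..<n} (\<lambda>_. UNIV)) (mass \<Omega> Pr zip3) (\<lambda>ws. ws i) q"
    by (rule mass_comp[OF finite_\<Omega> finite_Seq3 zip3_in])
  also have "\<dots> = (\<Sum>ws\<in>PiE {..<n} (\<lambda>_. UNIV). (\<Prod>k<n. p3 (ws k)) * of_bool (ws i = q))"
    unfolding mass_def[of "PiE {..<n} (\<lambda>_. UNIV)"] using finite_Seq3
    by (intro sum.mono_neutral_cong_left) (auto simp: mass_zip3)
  also have "\<dots> = (\<Sum>s\<in>UNIV. p3 s * of_bool (s = q))"
    by (rule iid_expectation) (use assms sum_p3 in auto)
  also have "\<dots> = p3 q" by (simp add: of_bool_def if_distrib cong: if_cong)
  finally show ?thesis .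
qed

lemma ent_coord:
  assumes "i < n"
  shows "ent \<Omega> Pr (\<lambda>\<omega>. A (Xs \<omega> i, Ys \<omega> i, Zs \<omega> i)) = ent UNIV p3 A"
  by (rule ent_comp[OF finite_\<Omega>]) (use mass_coord[OF assms] in auto)

definition Wv :: "nat \<Rightarrow> nat \<times> (nat \<Rightarrow> 'x) \<times> (nat \<Rightarrow> 'z) \<Rightarrow> real^('x \<times> ('z \<Rightarrow> 'xh))" where
  "Wv i u = (\<chi> p. Wi i u (fst p) (snd p))"

text \<open>The joint probability of \<open>Y\<^sub>i = y\<close> and \<open>U\<^sub>i = u\<close>.
  It is left unnormalised in y, so that its total mass is the weight of u.\<close>

definition piv :: "nat \<Rightarrow> nat \<times> (nat \<Rightarrow> 'x) \<times> (nat \<Rightarrow> 'z) \<Rightarrow> real^'y" where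
  "piv i u = (\<chi> y. pY y * kap i y u)"

lemma mass_QU_law:
  assumes "i < n" "u \<in> UK i"
  shows "mass \<Omega> Pr (\<lambda>\<omega>. (Qi i \<omega>, Ui i \<omega>)) (q, u) = law (piv i u) (Wv i u) q"
proof -
  obtain x y z v where q: "q = (x, y, z, v)" by (cases q)
  show ?thesis
    using mass_QU[OF assms, of x y z v] pZY_zero[of y z]
    by (cases "pY y = 0") (auto simp: q law_def piv_def Wv_def)
qed

lemma ent_QU:
  assumes "i < n"
  shows "ent \<Omega> Pr (\<lambda>\<omega>. (A (Qi i \<omega>), Ui i \<omega>)) = (\<Sum>u\<in>UK i. ent UNIV (law (piv i u) (Wv i u)) A)"
  by (rule ent_pair_eq_sum_fibers[OF finite_\<Omega> finite_UK Ui_in_UK mass_QU_law[OF assms]])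

lemma sum_entYZ_X:
  assumes "i < n"
  shows "(\<Sum>u\<in>UK i. entYZ_X (law (piv i u) (Wv i u))) =
    ent \<Omega> Pr (\<lambda>\<omega>. ((Ys \<omega> i, Zs \<omega> i), Xs \<omega> i, Ui i \<omega>)) - ent \<Omega> Pr (\<lambda>\<omega>. (Xs \<omega> i, Ui i \<omega>))"
proof -
  have "ent \<Omega> Pr (\<lambda>\<omega>. ((Ys \<omega> i, Zs \<omega> i), Xs \<omega> i, Ui i \<omega>)) = ent \<Omega> Pr (\<lambda>\<omega>. ((\<lambda>(x, y, z, v). ((y, z), x)) (Qi i \<omega>), Ui i \<omega>))"
    by (rule ent_cong_fibers) (auto simp: Qi_def)
  moreover have "ent \<Omega> Pr (\<lambda>\<omega>. (Xs \<omega> i, Ui i \<omega>)) = ent \<Omega> Pr (\<lambda>\<omega>. ((\<lambda>(x, y, z, v). x) (Qi i \<omega>), Ui i \<omega>))"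
    by (rule ent_cong_fibers) (auto simp: Qi_def)
  ultimately show ?thesis
    unfolding entYZ_X_def sum_subtractf by (simp only: ent_QU[OF assms])
qed

lemma sum_miXV_Z:
  assumes "i < n"
  shows "(\<Sum>u\<in>UK i. miXV_Z (law (piv i u) (Wv i u))) =
    (ent \<Omega> Pr (\<lambda>\<omega>. (Xs \<omega> i, Zs \<omega> i, Ui i \<omega>)) - ent \<Omega> Pr (\<lambda>\<omega>. (Zs \<omega> i, Ui i \<omega>)))
    - (ent \<Omega> Pr (\<lambda>\<omega>. (Xs \<omega> i, Vi i \<omega>, Zs \<omega> i, Ui i \<omega>)) - ent \<Omega> Pr (\<lambda>\<omega>. (Vi i \<omega>, Zs \<omega> i, Ui i \<omega>)))"
proof -
  have "ent \<Omega> Pr (\<lambda>\<omega>. (Xs \<omega> i, Zs \<omega> i, Ui i \<omega>)) = ent \<Omega> Pr (\<lambda>\<omega>. ((\<lambda>(x, y, z, v). (x, z)) (Qi i \<omega>), Ui i \<omega>))"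
    by (rule ent_cong_fibers) (auto simp: Qi_def)
  moreover have "ent \<Omega> Pr (\<lambda>\<omega>. (Zs \<omega> i, Ui i \<omega>)) = ent \<Omega> Pr (\<lambda>\<omega>. ((\<lambda>(x, y, z, v). z) (Qi i \<omega>), Ui i \<omega>))"
    by (rule ent_cong_fibers) (auto simp: Qi_def)
  moreover have "ent \<Omega> Pr (\<lambda>\<omega>. (Xs \<omega> i, Vi i \<omega>, Zs \<omega> i, Ui i \<omega>)) = ent \<Omega> Pr (\<lambda>\<omega>. ((\<lambda>(x, y, z, v). (x, v, z)) (Qi i \<omega>), Ui i \<omega>))"
    by (rule ent_cong_fibers) (auto simp: Qi_def)
  moreover have "ent \<Omega> Pr (\<lambda>\<omega>. (Vi i \<omega>, Zs \<omega> i, Ui i \<omega>)) = ent \<Omega> Pr (\<lambda>\<omega>. ((\<lambda>(x, y, z, v). (v, z)) (Qi i \<omega>), Ui i \<omega>))"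
    by (rule ent_cong_fibers) (auto simp: Qi_def)
  ultimately show ?thesis
    unfolding miXV_Z_def sum_subtractf sum.distrib by (simp only: ent_QU[OF assms])
qed

lemma sum_law_test:
  assumes "i < n"
  shows "(\<Sum>u\<in>UK i. \<Sum>q\<in>UNIV. law (piv i u) (Wv i u) q * F q) = (\<Sum>\<omega>\<in>\<Omega>. Pr \<omega> * F (Qi i \<omega>))"
proof -
  have "(\<Sum>\<omega>\<in>\<Omega>. Pr \<omega> * F (fst (Qi i \<omega>, Ui i \<omega>))) = (\<Sum>qu\<in>UNIV \<times> UK i. mass \<Omega> Pr (\<lambda>\<omega>. (Qi i \<omega>, Ui i \<omega>)) qu * F (fst qu))"
    by (rule sum_mass[symmetric]) (use finite_\<Omega> finite_UK Ui_in_UK in auto)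
  also have "\<dots> = (\<Sum>q\<in>UNIV. \<Sum>u\<in>UK i. law (piv i u) (Wv i u) q * F q)"
    unfolding sum_Times using mass_QU_law[OF assms] by simp
  also have "\<dots> = (\<Sum>u\<in>UK i. \<Sum>q\<in>UNIV. law (piv i u) (Wv i u) q * F q)"
    by (rule sum.swap)
  finally show ?thesis by simp
qed

lemma sum_piv:
  assumes "i < n"
  shows "(\<Sum>u\<in>UK i. piv i u $ y) = pY y"
proof -
  have "(\<Sum>q\<in>UNIV. law (piv i u) (Wv i u) q * of_bool (fst (snd q) = y)) = piv i u $ y" for u
  proof -
    have "(\<Sum>q\<in>UNIV. law (piv i u) (Wv i u) q * of_bool (fst (snd q) = y)) =
        (\<Sum>x\<in>UNIV. \<Sum>y'\<in>UNIV. \<Sum>z\<in>UNIV. \<Sum>v\<in>UNIV. piv i u $ y' * (pZY z y' / pY y' * pXgZ z x) * Wi i u x v * of_bool (y' = y))"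
      unfolding UNIV_Times_UNIV[symmetric] sum_Times by (simp add: law_def Wv_def)
    also have "\<dots> = (\<Sum>x\<in>UNIV. \<Sum>y'\<in>UNIV. (\<Sum>z\<in>UNIV. piv i u $ y' * (pZY z y' / pY y' * pXgZ z x)) * of_bool (y' = y))"
      by (simp only: sum_distrib_right[symmetric] sum_distrib_left[symmetric] sum_Wi mult_1_right)
    also have "\<dots> = (\<Sum>x\<in>UNIV. \<Sum>z\<in>UNIV. piv i u $ y * (pZY z y / pY y * pXgZ z x))"
      by (simp add: of_bool_def if_distrib cong: if_cong)
    also have "\<dots> = (\<Sum>z\<in>UNIV. \<Sum>x\<in>UNIV. piv i u $ y * (pZY z y / pY y * pXgZ z x))"
      by (rule sum.swap)
    also have "\<dots> = piv i u $ y * (\<Sum>z\<in>UNIV. pZY z y / pY y)"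
      by (simp only: sum_distrib_left[symmetric] pXgZ_sum mult_1_right)
    \<comment> \<open>If \<open>pY y = 0\<close> the quotients are 0, but then so is
      \<open>piv\<close>.\<close>
    also have "\<dots> = piv i u $ y"
      by (simp add: sum_divide_distrib[symmetric] pY_def[symmetric] piv_def)
    finally show ?thesis .
  qed
  then have "(\<Sum>u\<in>UK i. piv i u $ y) = (\<Sum>\<omega>\<in>\<Omega>. Pr \<omega> * of_bool (fst (snd (Qi i \<omega>)) = y))"
    using sum_law_test[OF assms, of "\<lambda>q. of_bool (fst (snd q) = y)"] by simp
  also have "\<dots> = (\<Sum>\<omega>\<in>\<Omega>. Pr \<omega> * of_bool (fst (snd (Xs \<omega> i, Ys \<omega> i, Zs \<omega> i)) = y))"
    by (simp add: Qi_def)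
  also have "\<dots> = (\<Sum>q\<in>UNIV. mass \<Omega> Pr (\<lambda>\<omega>. (Xs \<omega> i, Ys \<omega> i, Zs \<omega> i)) q * of_bool (fst (snd q) = y))"
    by (rule sum_mass[symmetric]) (use finite_\<Omega> in auto)
  also have "\<dots> = pY y"
    unfolding mass_coord[OF assms] by (rule sum_p3_Y)
  finally show ?thesis .
qed

lemma T_msgs: "T1 ` \<Omega> \<subseteq> msgs n R1" "T ` \<Omega> \<subseteq> msgs n R"
  by (rule image_subsetI, simp add: T1_def T_def \<Omega>_def mem_Times_iff f1_msgs f_msgs)+

lemma ent_messages: "ent \<Omega> Pr T1 \<le> n * R1" "ent \<Omega> Pr T \<le> n * R"
proof -
  have "\<Omega> \<noteq> {}" using sum_Pr by auto
  then have ne: "msgs n R1 \<noteq> {}" "msgs n R \<noteq> {}" using T_msgs by auto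
  show "ent \<Omega> Pr T1 \<le> n * R1"
    using ent_le_log_card[of \<Omega> Pr, OF finite_\<Omega> Pr_nonneg sum_Pr finite_msgs T_msgs(1)] log_card_msgs_le[OF ne(1)] by linarith
  show "ent \<Omega> Pr T \<le> n * R"
    using ent_le_log_card[of \<Omega> Pr, OF finite_\<Omega> Pr_nonneg sum_Pr finite_msgs T_msgs(2)] log_card_msgs_le[OF ne(2)] by linarith
qed

lemmas antimono = cond_ent_antimono[of \<Omega> Pr, OF finite_\<Omega> Pr_nonneg]

text \<open>n R1 >= H(T1) >= I(T1; Y^n, Z^n | X^n). The chain rule runs from the last letter down,
  so that the conditioning at time i contains all X and the later Y and Z; together with T1 these
  determine \<open>X\<^sub>i\<close> and \<open>U\<^sub>i\<close>. Z accompanies Y because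
  \<open>U\<^sub>i\<close> contains later Z.\<close>

lemma helper_rate:
  "n * (ent UNIV p3 (\<lambda>(x, y, z). ((y, z), x)) - ent UNIV p3 (\<lambda>(x, y, z). x)) - n * R1
    \<le> (\<Sum>i<n. \<Sum>u\<in>UK i. entYZ_X (law (piv i u) (Wv i u)))"
proof -
  define e where "e = (\<lambda>i. ent \<Omega> Pr (\<lambda>\<omega>. (restrict (Ys \<omega>) {i..<n}, restrict (Zs \<omega>) {i..<n}, Xs \<omega>, T1 \<omega>)))"
  have step: "e i - e (Suc i) \<le> (\<Sum>u\<in>UK i. entYZ_X (law (piv i u) (Wv i u)))" if i: "i < n" for i
  proof -
    have "{i..<n} = insert i {Suc i..<n}" using i by auto
    then have "e i = ent \<Omega> Pr (\<lambda>\<omega>. ((Ys \<omega> i, Zs \<omega> i), restrict (Ys \<omega>) {Suc i..<n}, restrict (Zs \<omega>) {Suc i..<n}, Xs \<omega>, T1 \<omega>))"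
      unfolding e_def by (intro ent_cong_fibers) (auto simp: restrict_eq_iff)
    moreover have "ent \<Omega> Pr (\<lambda>\<omega>. ((Ys \<omega> i, Zs \<omega> i), restrict (Ys \<omega>) {Suc i..<n}, restrict (Zs \<omega>) {Suc i..<n}, Xs \<omega>, T1 \<omega>)) - e (Suc i)
        \<le> ent \<Omega> Pr (\<lambda>\<omega>. ((Ys \<omega> i, Zs \<omega> i), Xs \<omega> i, Ui i \<omega>)) - ent \<Omega> Pr (\<lambda>\<omega>. (Xs \<omega> i, Ui i \<omega>))"
      unfolding e_def by (rule antimono) (auto simp: Ui_def)
    ultimately show ?thesis
      unfolding sum_entYZ_X[OF i] by simp
  qed
  have "e 0 - e n = (\<Sum>i<n. e i - e (Suc i))"
    by (rule sum_lessThan_telescope'[symmetric])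
  also have "\<dots> \<le> (\<Sum>i<n. \<Sum>u\<in>UK i. entYZ_X (law (piv i u) (Wv i u)))"
    by (intro sum_mono step) auto
  finally have tele: "e 0 - e n \<le> (\<Sum>i<n. \<Sum>u\<in>UK i. entYZ_X (law (piv i u) (Wv i u)))" .
  have "e n = ent \<Omega> Pr (\<lambda>\<omega>. (Xs \<omega>, T1 \<omega>))"
    unfolding e_def by (intro ent_cong_fibers) auto
  also have "\<dots> \<le> ent \<Omega> Pr Xs + ent \<Omega> Pr T1"
    by (rule ent_subadditive[of \<Omega> Pr, OF finite_\<Omega> Pr_nonneg sum_Pr])
  finally have "e n \<le> ent \<Omega> Pr Xs + n * R1"
    using ent_messages(1) by linarith
  moreover have "ent \<Omega> Pr Xs = n * ent UNIV p3 (\<lambda>(x, y, z). x)"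
    unfolding ent_sequence[symmetric] by (rule ent_cong_fibers) (simp only: prod.inject \<Omega>_eq_iff restrict_eq_iff prod.case Ball_def lessThan_iff; blast)
  moreover have "n * ent UNIV p3 (\<lambda>(x, y, z). ((y, z), x)) \<le> e 0"
    unfolding ent_sequence[symmetric] e_def
    by (rule ent_mono[of \<Omega> Pr, OF finite_\<Omega> Pr_nonneg]) (auto simp: restrict_eq_iff)
  ultimately show ?thesis
    using tele by (simp add: algebra_simps)
qed

text \<open>n R >= H(T) >= I(X^n; T | T1, Z^n). As T1 is a function of Y^n, H(X^n | T1, Z^n) is at
  least H(X^n | Y^n, Z^n), which is n H(X | Z) by the chain Y - Z - X. The other term is expanded
  upwards: the earlier X with T, T1 and all Z determine \<open>U\<^sub>i\<close>,
  \<open>V\<^sub>i\<close> and \<open>Z\<^sub>i\<close>.\<close>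

lemma encoder_rate: "(\<Sum>i<n. \<Sum>u\<in>UK i. miXV_Z (law (piv i u) (Wv i u))) \<le> n * R"
proof -
  define h2 where "h2 = ent UNIV p3 (\<lambda>(x, y, z). ((y, z), x)) - ent UNIV p3 (\<lambda>(x, y, z). (y, z))"
  define e where "e = (\<lambda>i. ent \<Omega> Pr (\<lambda>\<omega>. (restrict (Xs \<omega>) {..<i}, T \<omega>, T1 \<omega>, Zs \<omega>)))"
  have step: "(\<Sum>u\<in>UK i. miXV_Z (law (piv i u) (Wv i u))) \<le> h2 - (e (Suc i) - e i)" if i: "i < n" for i
  proof -
    have "e (Suc i) = ent \<Omega> Pr (\<lambda>\<omega>. (Xs \<omega> i, restrict (Xs \<omega>) {..<i}, T \<omega>, T1 \<omega>, Zs \<omega>))"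
      unfolding e_def lessThan_Suc by (intro ent_cong_fibers) (auto simp: restrict_eq_iff)
    moreover have "ent \<Omega> Pr (\<lambda>\<omega>. (Xs \<omega> i, restrict (Xs \<omega>) {..<i}, T \<omega>, T1 \<omega>, Zs \<omega>)) - e i
        \<le> ent \<Omega> Pr (\<lambda>\<omega>. (Xs \<omega> i, Vi i \<omega>, Zs \<omega> i, Ui i \<omega>)) - ent \<Omega> Pr (\<lambda>\<omega>. (Vi i \<omega>, Zs \<omega> i, Ui i \<omega>))"
      unfolding e_def by (rule antimono) (auto simp: Ui_def Vi_def)
    moreover have "ent \<Omega> Pr (\<lambda>\<omega>. (Xs \<omega> i, Zs \<omega> i, Ui i \<omega>)) - ent \<Omega> Pr (\<lambda>\<omega>. (Zs \<omega> i, Ui i \<omega>))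
        \<le> ent \<Omega> Pr (\<lambda>\<omega>. (Xs \<omega> i, Zs \<omega> i)) - ent \<Omega> Pr (\<lambda>\<omega>. Zs \<omega> i)"
      by (rule antimono) auto
    moreover have "ent \<Omega> Pr (\<lambda>\<omega>. (Xs \<omega> i, Zs \<omega> i)) - ent \<Omega> Pr (\<lambda>\<omega>. Zs \<omega> i) = h2"
      using ent_coord[OF i, of "\<lambda>(x, y, z). (x, z)"] ent_coord[OF i, of "\<lambda>(x, y, z). z"] ent_X_given_Z
      by (simp add: h2_def)
    ultimately show ?thesis
      unfolding sum_miXV_Z[OF i] by linarith
  qed
  have "(\<Sum>i<n. \<Sum>u\<in>UK i. miXV_Z (law (piv i u) (Wv i u))) \<le> (\<Sum>i<n. h2 - (e (Suc i) - e i))"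
    by (intro sum_mono step) auto
  also have "\<dots> = n * h2 - (e n - e 0)"
    unfolding sum_subtractf[of "\<lambda>_. h2" "\<lambda>i. e (Suc i) - e i"] sum_lessThan_telescope by simp
  finally have tele: "(\<Sum>i<n. \<Sum>u\<in>UK i. miXV_Z (law (piv i u) (Wv i u))) \<le> n * h2 - (e n - e 0)" .
  have "e 0 = ent \<Omega> Pr (\<lambda>\<omega>. (T \<omega>, T1 \<omega>, Zs \<omega>))"
    unfolding e_def by (intro ent_cong_fibers) auto
  also have "\<dots> \<le> ent \<Omega> Pr T + ent \<Omega> Pr (\<lambda>\<omega>. (T1 \<omega>, Zs \<omega>))"
    by (rule ent_subadditive[of \<Omega> Pr, OF finite_\<Omega> Pr_nonneg sum_Pr])
  finally have "e 0 \<le> n * R + ent \<Omega> Pr (\<lambda>\<omega>. (T1 \<omega>, Zs \<omega>))"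
    using ent_messages(2) by linarith
  moreover have "ent \<Omega> Pr (\<lambda>\<omega>. (Xs \<omega>, T1 \<omega>, Zs \<omega>)) \<le> e n"
    unfolding e_def
    by (rule ent_mono[of \<Omega> Pr, OF finite_\<Omega> Pr_nonneg]) (simp only: prod.inject \<Omega>_eq_iff restrict_eq_iff prod.case Ball_def lessThan_iff; blast)
  moreover have "ent \<Omega> Pr (\<lambda>\<omega>. (Xs \<omega>, Ys \<omega>, Zs \<omega>)) - ent \<Omega> Pr (\<lambda>\<omega>. (Ys \<omega>, Zs \<omega>))
      \<le> ent \<Omega> Pr (\<lambda>\<omega>. (Xs \<omega>, T1 \<omega>, Zs \<omega>)) - ent \<Omega> Pr (\<lambda>\<omega>. (T1 \<omega>, Zs \<omega>))"
    by (rule antimono) (auto simp: T1_def)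
  moreover have "ent \<Omega> Pr (\<lambda>\<omega>. (Xs \<omega>, Ys \<omega>, Zs \<omega>)) = n * ent UNIV p3 (\<lambda>(x, y, z). ((y, z), x))"
    unfolding ent_sequence[symmetric] by (rule ent_cong_fibers) (simp only: prod.inject \<Omega>_eq_iff restrict_eq_iff prod.case Ball_def lessThan_iff; blast)
  moreover have "ent \<Omega> Pr (\<lambda>\<omega>. (Ys \<omega>, Zs \<omega>)) = n * ent UNIV p3 (\<lambda>(x, y, z). (y, z))"
    unfolding ent_sequence[symmetric] by (rule ent_cong_fibers) (simp only: prod.inject \<Omega>_eq_iff restrict_eq_iff prod.case Ball_def lessThan_iff; blast)
  ultimately show ?thesis
    using tele by (simp add: h2_def algebra_simps)
qed

lemma code_distortion:
  "(\<Sum>i<n. \<Sum>u\<in>UK i. exp_dist d (law (piv i u) (Wv i u)))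
    \<le> (\<Sum>i<n. \<Sum>\<omega>\<in>\<Omega>. Pr \<omega> * d (Xs \<omega> i) (g (T \<omega>) (T1 \<omega>) (Zs \<omega>) i))"
proof (rule sum_mono)
  fix i assume "i \<in> {..<n}"
  then have i: "i < n" by simp
  have "(\<Sum>u\<in>UK i. exp_dist d (law (piv i u) (Wv i u))) = (\<Sum>\<omega>\<in>\<Omega>. Pr \<omega> * d (Xs \<omega> i) (Vi i \<omega> (Zs \<omega> i)))"
    using sum_law_test[OF i, of "\<lambda>(x, y, z, v). d x (v z)"] by (simp add: exp_dist_def Qi_def case_prod_unfold)
  then show "(\<Sum>u\<in>UK i. exp_dist d (law (piv i u) (Wv i u))) \<le> (\<Sum>\<omega>\<in>\<Omega>. Pr \<omega> * d (Xs \<omega> i) (g (T \<omega>) (T1 \<omega>) (Zs \<omega>) i))"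
    using distortion_Vi[OF i] by simp
qed

text \<open>A uniformly distributed time i together with a value u of \<open>U\<^sub>i\<close>
  serves as one auxiliary variable, whence the factor 1 / n. Its law of Y averages to
  \<open>pY\<close> because every letter has the law of the source.\<close>

lemma profile_point:
  "\<exists>a b c. (\<chi> y. pY y, a, b, c) \<in> profile_hull d
    \<and> ent UNIV p3 (\<lambda>(x, y, z). ((y, z), x)) - ent UNIV p3 (\<lambda>(x, y, z). x) - a \<le> R1 \<and> b \<le> R
    \<and> c \<le> (1 / n) * (\<Sum>i<n. \<Sum>\<omega>\<in>\<Omega>. Pr \<omega> * d (Xs \<omega> i) (g (T \<omega>) (T1 \<omega>) (Zs \<omega>) i))"
proof -
  let ?K = "Sigma {..<n} UK"
  define \<pi> where "\<pi> = (\<lambda>(i, u). (1 / real n) *\<^sub>R piv i u)"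
  define W where "W = (\<lambda>(i, u). Wv i u)"
  let ?a = "\<Sum>i<n. \<Sum>u\<in>UK i. entYZ_X (law (piv i u) (Wv i u))"
  let ?b = "\<Sum>i<n. \<Sum>u\<in>UK i. miXV_Z (law (piv i u) (Wv i u))"
  let ?c = "\<Sum>i<n. \<Sum>u\<in>UK i. exp_dist d (law (piv i u) (Wv i u))"
  have piv_nonneg: "piv i u $ y \<ge> 0" for i u y
    by (simp add: piv_def pY_nonneg kap_nonneg)
  have Wv_nonneg: "Wv i u $ p \<ge> 0" for i u p
    by (simp add: Wv_def Wi_nonneg)
  have sumSig: "(\<Sum>k\<in>?K. F k) = (\<Sum>i<n. \<Sum>u\<in>UK i. F (i, u))" for F :: "_ \<Rightarrow> 'w::comm_monoid_add"
    using sum.Sigma[of "{..<n}" UK "\<lambda>i u. F (i, u)"] finite_UK by simp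
  have "(\<Sum>k\<in>?K. profile d (\<pi> k, W k)) \<in> profile_hull d"
  proof (rule sum_profile_in_hull)
    show "finite ?K" using finite_UK by auto
    show "\<pi> k $ y \<ge> 0" for k y
      by (cases k) (simp add: \<pi>_def piv_nonneg)
    show "W k $ p \<ge> 0" for k p
      by (cases k) (simp add: W_def Wv_nonneg)
    show "(\<Sum>v\<in>UNIV. W k $ (x, v)) = 1" for k x
      by (cases k) (simp add: W_def Wv_def sum_Wi)
    have "(\<Sum>k\<in>?K. \<Sum>y\<in>UNIV. \<pi> k $ y) = (\<Sum>y\<in>UNIV. \<Sum>k\<in>?K. \<pi> k $ y)"
      by (rule sum.swap)
    also have "\<dots> = (\<Sum>y\<in>UNIV. \<Sum>i<n. (1 / real n) * pY y)"
      unfolding sumSig \<pi>_def by (intro sum.cong refl) (simp add: sum_divide_distrib[symmetric] sum_piv)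
    also have "\<dots> = 1"
      using n_pos sum_pY by simp
    finally show "(\<Sum>k\<in>?K. \<Sum>y\<in>UNIV. \<pi> k $ y) = 1" .
  qed
  also have "(\<Sum>k\<in>?K. profile d (\<pi> k, W k)) = (1 / real n) *\<^sub>R (\<Sum>i<n. \<Sum>u\<in>UK i. profile d (piv i u, Wv i u))"
    unfolding sumSig \<pi>_def W_def scaleR_sum_right prod.case
    by (intro sum.cong refl profile_scale piv_nonneg Wv_nonneg) simp
  also have "(\<Sum>i<n. \<Sum>u\<in>UK i. profile d (piv i u, Wv i u)) = (real n *\<^sub>R (\<chi> y. pY y), ?a, ?b, ?c)"
    by (simp add: profile_def prod_eq_iff fst_sum snd_sum vec_eq_iff sum_piv)
  finally have "(\<chi> y. pY y, ?a / n, ?b / n, ?c / n) \<in> profile_hull d"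
    using n_pos by simp
  moreover have "ent UNIV p3 (\<lambda>(x, y, z). ((y, z), x)) - ent UNIV p3 (\<lambda>(x, y, z). x) - ?a / n \<le> R1"
    using helper_rate n_pos by (simp add: field_simps)
  moreover have "?b / n \<le> R"
    using encoder_rate n_pos by (simp add: field_simps)
  moreover have "?c / n \<le> (1 / n) * (\<Sum>i<n. \<Sum>\<omega>\<in>\<Omega>. Pr \<omega> * d (Xs \<omega> i) (g (T \<omega>) (T1 \<omega>) (Zs \<omega>) i))"
    using code_distortion n_pos by (simp add: divide_right_mono)
  ultimately show ?thesis by blast
qed

end

section \<open>Removing the slack by compactness\<close>

context source
begin

text \<open>Slack enters twice, through the closure in \<open>op_region\<close> and through the
  distortion tolerance in \<open>achievable\<close>; one \<open>\<epsilon>\<close> serves for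
  both.\<close>

lemma approximate_profile:
  fixes d :: "'x \<Rightarrow> 'xh::finite \<Rightarrow> real"
  assumes "(R, R1) \<in> op_region pZY pXgZ d D" "\<epsilon> > 0"
  shows "\<exists>a b c. (\<chi> y. pY y, a, b, c) \<in> profile_hull d
    \<and> ent UNIV p3 (\<lambda>(x, y, z). ((y, z), x)) - ent UNIV p3 (\<lambda>(x, y, z). x) - a \<le> R1 + \<epsilon> \<and> b \<le> R + \<epsilon> \<and> c \<le> D + \<epsilon>"
proof -
  obtain p where p: "case p of (R, R1) \<Rightarrow> achievable pZY pXgZ d D R R1" "dist p (R, R1) < \<epsilon>"
    using assms unfolding op_region_def closure_approachable by blast
  obtain R' R1' where p_eq: "p = (R', R1')" by (cases p)
  have near: "R' \<le> R + \<epsilon>" "R1' \<le> R1 + \<epsilon>"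
    using dist_fst_le[of p "(R, R1)"] dist_snd_le[of p "(R, R1)"] p(2) by (auto simp: p_eq dist_real_def)
  have ach: "achievable pZY pXgZ d D R' R1'" using p(1) by (simp add: p_eq)
  then obtain N where N: "\<forall>n\<ge>N. \<exists>(f1 :: (nat \<Rightarrow> 'y) \<Rightarrow> nat) (f :: (nat \<Rightarrow> 'x) \<Rightarrow> nat \<Rightarrow> nat) (g :: nat \<Rightarrow> nat \<Rightarrow> (nat \<Rightarrow> 'z) \<Rightarrow> nat \<Rightarrow> 'xh).
       (\<forall>ys\<in>Seq n. f1 ys \<in> msgs n R1') \<and> (\<forall>xs\<in>Seq n. \<forall>t1\<in>msgs n R1'. f xs t1 \<in> msgs n R') \<and>
       (\<Sum>xs\<in>Seq n. \<Sum>ys\<in>Seq n. \<Sum>zs\<in>Seq n. (\<Prod>i<n. pZY (zs i) (ys i) * pXgZ (zs i) (xs i)) *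
          ((1 / real n) * (\<Sum>i<n. d (xs i) (g (f xs (f1 ys)) (f1 ys) zs i)))) \<le> D + \<epsilon>"
    using assms(2) unfolding achievable_def by blast
  \<comment> \<open>The successor makes the block length positive.\<close>
  define n where "n = Suc N"
  obtain f1 :: "(nat \<Rightarrow> 'y) \<Rightarrow> nat" and f :: "(nat \<Rightarrow> 'x) \<Rightarrow> nat \<Rightarrow> nat" and g :: "nat \<Rightarrow> nat \<Rightarrow> (nat \<Rightarrow> 'z) \<Rightarrow> nat \<Rightarrow> 'xh"
    where code: "\<forall>ys\<in>Seq n. f1 ys \<in> msgs n R1'" "\<forall>xs\<in>Seq n. \<forall>t1\<in>msgs n R1'. f xs t1 \<in> msgs n R'"
      "(\<Sum>xs\<in>Seq n. \<Sum>ys\<in>Seq n. \<Sum>zs\<in>Seq n. (\<Prod>i<n. pZY (zs i) (ys i) * pXgZ (zs i) (xs i)) *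
          ((1 / real n) * (\<Sum>i<n. d (xs i) (g (f xs (f1 ys)) (f1 ys) zs i)))) \<le> D + \<epsilon>"
    using N[rule_format, of n] by (auto simp: n_def)
  interpret C: coding_scheme pZY pXgZ d n R' R1' f1 f g
    by unfold_locales (use code(1,2) in \<open>simp_all add: n_def\<close>)
  have "(1 / n) * (\<Sum>i<n. \<Sum>\<omega>\<in>C.\<Omega>. C.Pr \<omega> * d (fst \<omega> i) (g (C.T \<omega>) (C.T1 \<omega>) (snd (snd \<omega>)) i))
      = (\<Sum>\<omega>\<in>C.\<Omega>. C.Pr \<omega> * ((1 / n) * (\<Sum>i<n. d (fst \<omega> i) (g (C.T \<omega>) (C.T1 \<omega>) (snd (snd \<omega>)) i))))"
    unfolding sum_distrib_left by (subst sum.swap) (simp only: ac_simps)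
  also have "\<dots> \<le> D + \<epsilon>"
    using code(3) by (simp add: C.\<Omega>_def sum_Times C.Pr_def C.T_def C.T1_def)
  finally show ?thesis
    using C.profile_point near by force
qed

text \<open>Block length and alphabet of U vary with \<open>\<epsilon>\<close>, but all profiles lie
  in the same compact hull. There the violation \<open>\<phi>\<close> of the constraints attains its
  minimum, which is at most every positive \<open>\<epsilon>\<close>, so some profile meets all
  constraints without slack.\<close>

lemma converse:
  fixes d :: "'x \<Rightarrow> 'xh::finite \<Rightarrow> real"
  assumes "(R, R1) \<in> op_region pZY pXgZ d D"
  shows "(R, R1) \<in> sl_region pZY pXgZ d D"
proof -
  define h1 where "h1 = ent UNIV p3 (\<lambda>(x, y, z). ((y, z), x)) - ent UNIV p3 (\<lambda>(x, y, z). x)"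
  \<comment> \<open>The norm turns the equality constraint on the law of Y into an upper
    bound.\<close>
  define \<phi> where "\<phi> = (\<lambda>(\<pi> :: real^'y, a, b, c). max (norm (\<pi> - (\<chi> y. pY y))) (max (h1 - a - R1) (max (b - R) (c - D))))"
  have approx: "\<exists>q\<in>profile_hull d. \<phi> q \<le> \<epsilon>" if \<epsilon>: "\<epsilon> > 0" for \<epsilon>
  proof -
    obtain a b c where "(\<chi> y. pY y, a, b, c) \<in> profile_hull d" "h1 - a \<le> R1 + \<epsilon>" "b \<le> R + \<epsilon>" "c \<le> D + \<epsilon>"
      using approximate_profile[OF assms \<epsilon>] unfolding h1_def by blast
    then show ?thesis
      using \<epsilon> by (intro bexI[of _ "(\<chi> y. pY y, a, b, c)"]) (auto simp: \<phi>_def)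
  qed
  have "continuous_on (profile_hull d) \<phi>"
    unfolding \<phi>_def case_prod_unfold by (intro continuous_intros)
  then obtain q where q: "q \<in> profile_hull d" "\<And>q'. q' \<in> profile_hull d \<Longrightarrow> \<phi> q \<le> \<phi> q'"
    using continuous_attains_inf[OF compact_hull] approx[of 1] by (metis empty_iff zero_less_one)
  have "\<phi> q \<le> \<epsilon>" if "\<epsilon> > 0" for \<epsilon>
    using approx[OF that] q(2) by (meson order_trans)
  then have "\<phi> q \<le> 0"
    by (rule field_le_epsilon[of _ 0, simplified])
  moreover obtain \<pi> a b c where q_eq: "q = (\<pi>, a, b, c)" by (cases q)
  ultimately have "\<pi> = (\<chi> y. pY y)" "h1 - a \<le> R1" "b \<le> R" "c \<le> D"
    by (auto simp: \<phi>_def)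
  then show ?thesis
    using sl_region_of_profile_hull[of a b c d R1 R D] q(1) by (auto simp: q_eq h1_def)
qed

end

theorem theorem3:
  fixes pZY :: "'z::finite \<Rightarrow> 'y::finite \<Rightarrow> real"
    and pXgZ :: "'z \<Rightarrow> 'x::finite \<Rightarrow> real"
    and d :: "'x \<Rightarrow> 'xh::finite \<Rightarrow> real"
    and D :: real
  assumes "\<forall>z y. pZY z y \<ge> 0" and "(\<Sum>z\<in>UNIV. \<Sum>y\<in>UNIV. pZY z y) = 1"
    and "\<forall>z x. pXgZ z x \<ge> 0" and "\<forall>z. (\<Sum>x\<in>UNIV. pXgZ z x) = 1"
    and "\<forall>x xh. d x xh \<ge> 0"
  shows "op_region pZY pXgZ d D = sl_region pZY pXgZ d D"
proof -
  interpret source pZY pXgZ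
    by unfold_locales (use assms in auto)
  have "p \<in> op_region pZY pXgZ d D" if sl: "p \<in> sl_region pZY pXgZ d D" for p
    unfolding op_region_def closure_approachable
  proof (intro allI impI)
    fix \<epsilon> :: real assume "\<epsilon> > 0"
    obtain R R1 where p: "p = (R, R1)" by (cases p)
    \<comment> \<open>The 16 allows for the factor 4 in \<open>achievability\<close>: both
      coordinates move by \<open>\<epsilon>\<close> / 4, a distance of at most
      \<open>\<epsilon>\<close> / 2.\<close>
    have "achievable pZY pXgZ d D (R + 4 * (\<epsilon> / 16)) (R1 + 4 * (\<epsilon> / 16))"
      using achievability[of d R R1 D "\<epsilon> / 16"] assms(5) sl \<open>\<epsilon> > 0\<close> by (simp add: p)
    moreover have "dist (R + 4 * (\<epsilon> / 16), R1 + 4 * (\<epsilon> / 16)) p < \<epsilon>"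
    proof -
      have "dist (R + 4 * (\<epsilon> / 16), R1 + 4 * (\<epsilon> / 16)) p \<le> \<bar>\<epsilon> / 4\<bar> + \<bar>\<epsilon> / 4\<bar>"
        unfolding p dist_Pair_Pair using sqrt_sum_squares_le_sum_abs[of "\<epsilon> / 4" "\<epsilon> / 4"] \<open>\<epsilon> > 0\<close>
        by (simp add: dist_real_def)
      then show ?thesis using \<open>\<epsilon> > 0\<close> by linarith
    qed
    ultimately show "\<exists>y\<in>{(R, R1). achievable pZY pXgZ d D R R1}. dist y p < \<epsilon>"
      by blast
  qed
  then show ?thesis
    using converse by (auto simp: prod_eq_iff)
qed

end
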